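(* Let $X$ be a compact complex manifold with $\dim_{\mathbb C}X=n$ and let $\omega$ be a Hermitian metric on $X$. (i) The metric $\omega$ is strongly Gauduchon (sG) if and only if $\omega^{n-1}$ is $E_2\overline{E}_2$-closed. In particular, in this case, $\omega^{n-1}$ induces an $E_2$-Aeppli cohomology class $\{\omega^{n-1}\}_{E_{2,A}}\in E_{2,A}^{n-1,n-1}(X)$. (ii) The metric $\omega$ is Hermitian-symplectic (H-S) if and only if $\omega$ is $E_3\overline{E}_3$-closed. In particular, in this case, $\omega$ induces an $E_3$-Aeppli cohomology class $\{\omega\}_{E_{3,A}}\in E_{3,A}^{1,1}(X)$. When $n=3$, $\omega$ is Hermitian-symplectic (H-S) if and only if $\omega$ is $E_2\overline{E}_2$-closed. In particular, in this case, $\omega$ induces an $E_2$-Aeppli cohomology class $\{\omega\}_{E_{2,A}}\in E_{2,A}^{1,1}(X)$.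
   Context: Hermitian metrics are identified with smooth positive definite $(1,1)$-forms $\omega$; $C^\infty_{p,q}(X)$ is the space of smooth $\mathbb C$-valued $(p,q)$-forms. $\omega$ is strongly Gauduchon (sG) if $\partial\omega^{n-1}$ is $\bar\partial$-exact. $\omega$ is Hermitian-symplectic (H-S) if there is $\rho^{0,2}\in C^\infty_{0,2}(X)$ with $d(\overline{\rho^{0,2}}+\omega+\rho^{0,2})=0$. For $r\ge2$, a form $\alpha\in C^\infty_{p,q}(X)$ is $E_r\overline{E}_r$-closed if there are smooth forms $\eta_1,\dots,\eta_{r-1}$ and $\rho_1,\dots,\rho_{r-1}$ with $\partial\alpha=\bar\partial\eta_1$, $\partial\eta_1=\bar\partial\eta_2,\dots,\partial\eta_{r-2}=\bar\partial\eta_{r-1}$ and $\bar\partial\alpha=\partial\rho_1$, $\bar\partial\rho_1=\partial\rho_2,\dots,\bar\partial\rho_{r-2}=\partial\rho_{r-1}$. The $E_r$-Aeppli cohomology $E_{r,A}^{p,q}(X)$ is the quotient of the $E_r\overline{E}_r$-closed smooth $(p,q)$-forms by those lying in $\mathrm{Im}\,\partial+\mathrm{Im}\,\bar\partial$; the class of $\alpha$ is denoted $\{\alpha\}_{E_{r,A}}$. *)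

theory Defs
  imports "HOL-Analysis.Analysis" "HOL-Combinatorics.Permutations"
    "HOL-Library.Function_Algebras"
begin

section \<open>Smooth and holomorphic maps between open subsets of vector spaces\<close>

fun Ck_on :: "nat \<Rightarrow> 'a::real_normed_vector set \<Rightarrow> ('a \<Rightarrow> 'b::real_normed_vector) \<Rightarrow> bool" where
  "Ck_on 0 S f \<longleftrightarrow> continuous_on S f"
| "Ck_on (Suc k) S f \<longleftrightarrow>
     (\<forall>x\<in>S. f differentiable (at x)) \<and>
     (\<forall>u. Ck_on k S (\<lambda>x. frechet_derivative f (at x) u))"

definition smooth_on :: "'a::real_normed_vector set \<Rightarrow> ('a \<Rightarrow> 'b::real_normed_vector) \<Rightarrow> bool" where
  "smooth_on S f \<longleftrightarrow> (\<forall>k. Ck_on k S f)"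

text \<open>Holomorphic in several variables: smooth and satisfying the Cauchy--Riemann equations,
  i.e. with complex linear differential.\<close>

definition holomorphic_map_on :: "(complex^'n) set \<Rightarrow> (complex^'n \<Rightarrow> complex^'m) \<Rightarrow> bool" where
  "holomorphic_map_on S f \<longleftrightarrow> smooth_on S f \<and>
     (\<forall>x\<in>S. \<forall>a u. frechet_derivative f (at x) (a *s u) = a *s frechet_derivative f (at x) u)"


section \<open>Compact complex manifolds\<close>

text \<open>The manifold is the (nonempty, Hausdorff) space \<open>'a\<close>, its dimension is \<open>CARD('n)\<close>,
  and its complex structure is given by an atlas. A chart is a pair of a domain and a
  coordinate map; the values of the coordinate map off the domain are irrelevant. The manifold is
  not required to be connected, and second countability follows from compactness.\<close>

type_synonym ('a, 'n) chart = "'a set \<times> ('a \<Rightarrow> complex^'n)"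

definition chart_image :: "('a, 'n) chart \<Rightarrow> (complex^'n) set" where
  "chart_image c = snd c ` fst c"

definition overlap :: "('a, 'n) chart \<Rightarrow> ('a, 'n) chart \<Rightarrow> (complex^'n) set" where
  "overlap c d = snd c ` (fst c \<inter> fst d)"

definition transition :: "('a, 'n) chart \<Rightarrow> ('a, 'n) chart \<Rightarrow> complex^'n \<Rightarrow> complex^'n" where
  "transition c d = snd d \<circ> inv_into (fst c) (snd c)"

definition complex_atlas :: "('a::t2_space, 'n::finite) chart set \<Rightarrow> bool" where
  "complex_atlas A \<longleftrightarrow>
     (\<forall>c\<in>A. open (fst c) \<and> open (chart_image c) \<and>
        homeomorphism (fst c) (chart_image c) (snd c) (inv_into (fst c) (snd c))) \<and>
     (\<Union>c\<in>A. fst c) = UNIV \<and>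
     (\<forall>c\<in>A. \<forall>d\<in>A. holomorphic_map_on (overlap c d) (transition c d))"

definition compact_complex_manifold :: "('a::t2_space, 'n::finite) chart set \<Rightarrow> bool" where
  "compact_complex_manifold A \<longleftrightarrow> complex_atlas A \<and> compact (UNIV :: 'a set)"


section \<open>Exterior algebra\<close>

text \<open>A complex valued alternating form on \<open>complex^'n\<close> of possibly mixed degree is a function on
  lists of vectors; its component of degree \<open>k\<close> is the restriction to lists of length \<open>k\<close>.\<close>

type_synonym 'n altform = "(complex^'n) list \<Rightarrow> complex"

definition alternating :: "'n::finite altform \<Rightarrow> bool" where
  "alternating L \<longleftrightarrow>
     (\<forall>v. \<forall>i<length v. linear (\<lambda>u. L (v[i := u]))) \<and>
     (\<forall>v. \<forall>j<length v. \<forall>i<j. v ! i = v ! j \<longrightarrow> L v = 0)"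

definition unit_alt :: "'n::finite altform" where
  "unit_alt v = (if v = [] then 1 else 0)"

text \<open>Normalised so that a wedge product of covectors is the determinant of their values.\<close>

definition wedge_alt :: "'n::finite altform \<Rightarrow> 'n altform \<Rightarrow> 'n altform" where
  "wedge_alt L M v = (\<Sum>k\<le>length v. 1 / (fact k * fact (length v - k)) *
     (\<Sum>\<sigma> | \<sigma> permutes {..<length v}. of_int (sign \<sigma>) *
        L (map (\<lambda>i. v ! \<sigma> i) [0..<k]) * M (map (\<lambda>i. v ! \<sigma> i) [k..<length v])))"

definition dz :: "'n::finite \<Rightarrow> 'n altform" where
  "dz j v = (case v of [u] \<Rightarrow> u $ j | _ \<Rightarrow> 0)"

definition dzbar :: "'n::finite \<Rightarrow> 'n altform" where
  "dzbar j v = (case v of [u] \<Rightarrow> cnj (u $ j) | _ \<Rightarrow> 0)"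

definition dz_dzbar :: "'n::finite list \<Rightarrow> 'n list \<Rightarrow> 'n altform" where
  "dz_dzbar I J = foldr wedge_alt (map dz I @ map dzbar J) unit_alt"

text \<open>The sum runs over all multi-indices, not only the increasing ones; the span is the same.\<close>

definition bidegree_alt :: "nat \<Rightarrow> nat \<Rightarrow> 'n::finite altform \<Rightarrow> bool" where
  "bidegree_alt p q L \<longleftrightarrow>
     (\<exists>f. \<forall>v. L v = (\<Sum>I | length I = p. \<Sum>J | length J = q. f I J * dz_dzbar I J v))"


section \<open>Differential forms\<close>

text \<open>A form assigns to each chart its coordinate expression, which is compatible with
  pullback along coordinate changes. It is set to zero where it has no meaning, so that equality of
  forms is equality of functions.\<close>

type_synonym ('a, 'n) form = "('a, 'n) chart \<Rightarrow> complex^'n \<Rightarrow> 'n altform"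

definition smooth_forms :: "('a::t2_space, 'n::finite) chart set \<Rightarrow> ('a, 'n) form set" where
  "smooth_forms A = {\<alpha>.
     (\<forall>c x v. c \<notin> A \<or> x \<notin> chart_image c \<longrightarrow> \<alpha> c x v = 0) \<and>
     (\<forall>c\<in>A. \<forall>x\<in>chart_image c. alternating (\<alpha> c x)) \<and>
     (\<forall>c\<in>A. \<forall>v. smooth_on (chart_image c) (\<lambda>x. \<alpha> c x v)) \<and>
     (\<forall>c\<in>A. \<forall>d\<in>A. \<forall>x\<in>overlap c d. \<forall>v.
        \<alpha> c x v =
        \<alpha> d (transition c d x) (map (frechet_derivative (transition c d) (at x)) v))}"

definition pq_forms :: "('a::t2_space, 'n::finite) chart set \<Rightarrow> nat \<Rightarrow> nat \<Rightarrow> ('a, 'n) form set" where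
  "pq_forms A p q =
     {\<alpha> \<in> smooth_forms A. \<forall>c\<in>A. \<forall>x\<in>chart_image c. bidegree_alt p q (\<alpha> c x)}"

definition conj_form :: "('a, 'n::finite) form \<Rightarrow> ('a, 'n) form" where
  "conj_form \<alpha> c x v = cnj (\<alpha> c x v)"

fun wedge_power :: "('a, 'n::finite) chart set \<Rightarrow> ('a, 'n) form \<Rightarrow> nat \<Rightarrow> ('a, 'n) form" where
  "wedge_power A \<alpha> 0 =
     (\<lambda>c x v. if c \<in> A \<and> x \<in> chart_image c then unit_alt v else 0)"
| "wedge_power A \<alpha> (Suc k) = (\<lambda>c x. wedge_alt (\<alpha> c x) (wedge_power A \<alpha> k c x))"

text \<open>In a chart, \<open>d\<alpha> = (\<Sum>j. dx\<^sub>j \<and> \<partial>\<alpha>/\<partial>x\<^sub>j + dy\<^sub>j \<and> \<partial>\<alpha>/\<partial>y\<^sub>j)\<close>,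
  \<open>\<partial>\<alpha> = (\<Sum>j. dz\<^sub>j \<and> \<partial>\<alpha>/\<partial>z\<^sub>j)\<close> and similarly for the conjugate operator, the coefficients of
  \<open>\<alpha>\<close> being differentiated. All three are \<open>ext_deriv D\<close>, where \<open>D f x\<close> is respectively the full
  differential of a function, its complex linear part \<open>\<Sum>j. \<partial>f/\<partial>z\<^sub>j dz\<^sub>j\<close>, and its
  conjugate linear part.\<close>

definition ext_deriv ::
  "((complex^'n \<Rightarrow> complex) \<Rightarrow> complex^'n \<Rightarrow> complex^'n \<Rightarrow> complex) \<Rightarrow>
   ('a, 'n::finite) chart set \<Rightarrow> ('a, 'n) form \<Rightarrow> ('a, 'n) form" where
  "ext_deriv D A \<alpha> c x v =
     (if c \<in> A \<and> x \<in> chart_image c then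
        (\<Sum>i<length v. (-1)^i * D (\<lambda>y. \<alpha> c y (take i v @ drop (Suc i) v)) x (v ! i))
      else 0)"

definition diff10 :: "(complex^'n \<Rightarrow> complex) \<Rightarrow> complex^'n::finite \<Rightarrow> complex^'n \<Rightarrow> complex" where
  "diff10 f x u =
     (frechet_derivative f (at x) u - \<i> * frechet_derivative f (at x) (\<i> *s u)) / 2"

definition diff01 :: "(complex^'n \<Rightarrow> complex) \<Rightarrow> complex^'n::finite \<Rightarrow> complex^'n \<Rightarrow> complex" where
  "diff01 f x u =
     (frechet_derivative f (at x) u + \<i> * frechet_derivative f (at x) (\<i> *s u)) / 2"

definition d_op :: "('a, 'n::finite) chart set \<Rightarrow> ('a, 'n) form \<Rightarrow> ('a, 'n) form" where
  "d_op = ext_deriv (\<lambda>f x. frechet_derivative f (at x))"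

definition del :: "('a, 'n::finite) chart set \<Rightarrow> ('a, 'n) form \<Rightarrow> ('a, 'n) form" where
  "del = ext_deriv diff10"

definition delbar :: "('a, 'n::finite) chart set \<Rightarrow> ('a, 'n) form \<Rightarrow> ('a, 'n) form" where
  "delbar = ext_deriv diff01"


section \<open>Hermitian metrics\<close>

definition positive_definite_11 :: "'n::finite altform \<Rightarrow> bool" where
  "positive_definite_11 L \<longleftrightarrow> (\<exists>h :: complex^'n^'n.
     (\<forall>j k. h $ k $ j = cnj (h $ j $ k)) \<and>
     (\<forall>u. u \<noteq> 0 \<longrightarrow> Re (\<Sum>j\<in>UNIV. \<Sum>k\<in>UNIV. h $ j $ k * u $ j * cnj (u $ k)) > 0) \<and>
     (\<forall>v. L v = \<i> * (\<Sum>j\<in>UNIV. \<Sum>k\<in>UNIV. h $ j $ k * wedge_alt (dz j) (dzbar k) v)))"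

definition hermitian_metric :: "('a::t2_space, 'n::finite) chart set \<Rightarrow> ('a, 'n) form \<Rightarrow> bool" where
  "hermitian_metric A \<omega> \<longleftrightarrow>
     \<omega> \<in> pq_forms A 1 1 \<and> (\<forall>c\<in>A. \<forall>x\<in>chart_image c. positive_definite_11 (\<omega> c x))"

definition strongly_Gauduchon :: "('a::t2_space, 'n::finite) chart set \<Rightarrow> ('a, 'n) form \<Rightarrow> bool" where
  "strongly_Gauduchon A \<omega> \<longleftrightarrow>
     (\<exists>\<beta>\<in>smooth_forms A. del A (wedge_power A \<omega> (CARD('n) - 1)) = delbar A \<beta>)"

definition hermitian_symplectic :: "('a::t2_space, 'n::finite) chart set \<Rightarrow> ('a, 'n) form \<Rightarrow> bool" where
  "hermitian_symplectic A \<omega> \<longleftrightarrow>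
     (\<exists>\<rho>\<in>pq_forms A 0 2. d_op A (conj_form \<rho> + \<omega> + \<rho>) = 0)"


section \<open>Higher-page Aeppli cohomology\<close>

text \<open>For \<open>r \<ge> 2\<close>. The two towers of \<open>r - 1\<close> equations are made uniform by putting
  \<open>\<eta>\<^sub>0 = \<rho>\<^sub>0 = \<alpha>\<close>; only \<open>\<eta>\<^sub>0, \<dots>, \<eta>\<^sub>r\<^sub>-\<^sub>1\<close> and \<open>\<rho>\<^sub>0, \<dots>, \<rho>\<^sub>r\<^sub>-\<^sub>1\<close> matter. No bidegree is
  imposed on the forms \<open>\<eta>\<^sub>l\<close> and \<open>\<rho>\<^sub>l\<close>.\<close>

definition Er_closed ::
  "('a::t2_space, 'n::finite) chart set \<Rightarrow> nat \<Rightarrow> nat \<Rightarrow> nat \<Rightarrow> ('a, 'n) form set" where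
  "Er_closed A r p q = {\<alpha> \<in> pq_forms A p q.
     (\<exists>\<eta>. \<eta> 0 = \<alpha> \<and> (\<forall>l<r. \<eta> l \<in> smooth_forms A) \<and>
        (\<forall>l<r - 1. del A (\<eta> l) = delbar A (\<eta> (Suc l)))) \<and>
     (\<exists>\<rho>. \<rho> 0 = \<alpha> \<and> (\<forall>l<r. \<rho> l \<in> smooth_forms A) \<and>
        (\<forall>l<r - 1. delbar A (\<rho> l) = del A (\<rho> (Suc l))))}"

definition aeppli_rel ::
  "('a::t2_space, 'n::finite) chart set \<Rightarrow> nat \<Rightarrow> nat \<Rightarrow> nat \<Rightarrow> (('a, 'n) form \<times> ('a, 'n) form) set" where
  "aeppli_rel A r p q = {(\<alpha>, \<beta>). \<alpha> \<in> Er_closed A r p q \<and> \<beta> \<in> Er_closed A r p q \<and>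
     (\<exists>\<gamma>\<in>smooth_forms A. \<exists>\<delta>\<in>smooth_forms A. \<alpha> - \<beta> = del A \<gamma> + delbar A \<delta>)}"

definition Er_aeppli ::
  "('a::t2_space, 'n::finite) chart set \<Rightarrow> nat \<Rightarrow> nat \<Rightarrow> nat \<Rightarrow> ('a, 'n) form set set" where
  "Er_aeppli A r p q = Er_closed A r p q // aeppli_rel A r p q"

definition aeppli_class ::
  "('a::t2_space, 'n::finite) chart set \<Rightarrow> nat \<Rightarrow> nat \<Rightarrow> nat \<Rightarrow> ('a, 'n) form \<Rightarrow> ('a, 'n) form set" where
  "aeppli_class A r p q \<alpha> = aeppli_rel A r p q `` {\<alpha>}"

end

theory Submission
  imports Defs
begin

text \<open>All three equivalences compare a condition on a real form with a tower of equations in which no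
bidegrees are prescribed. The second half of each tower is the complex conjugate of the first, so only
the first half matters.

For \<open>\<omega>\<^sup>n\<^sup>-\<^sup>1\<close> the first half is the definition of a strongly Gauduchon metric. What has to be
shown is that \<open>\<omega>\<^sup>n\<^sup>-\<^sup>1\<close> is real and of type \<open>(n-1, n-1)\<close>. For the type, the wedge product of two monomials in
the \<open>dz\<close> and \<open>dzbar\<close> is identified with a determinant of covectors (\<open>wedge_covec_det\<close>), which may be
reordered up to sign.

Let now \<open>\<omega>\<close> be Hermitian-symplectic. The closed form \<open>conj_form \<rho> + \<omega> + \<rho>\<close> has a differential with
components of four types, and their vanishing says that \<open>del \<omega> = delbar (- conj_form \<rho>)\<close> and
\<open>del (conj_form \<rho>) = 0\<close>, together with the conjugate equations; this is a tower as required for \<open>r = 3\<close>, ending in 0.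
Conversely, suppose \<open>del \<omega> = delbar \<eta>\<close> and \<open>del \<eta> = delbar \<zeta>\<close>, and let \<open>\<theta>\<close> be the
(2,0)-component of \<open>\<eta>\<close>. Comparing types, \<open>delbar \<theta> = del \<omega>\<close> (\<open>delbar_part20\<close>) and \<open>del \<theta> = 0\<close>
(\<open>del_part20\<close>), so \<open>\<rho> = - conj_form \<theta>\<close> shows that \<open>\<omega>\<close> is Hermitian-symplectic (\<open>hermitian_symplecticI\<close>).
Types are separated throughout by the action of the circle that multiplies all argument vectors by a
complex number of modulus one: type \<open>(p, q)\<close> has weight \<open>p - q\<close>, and the two operators shift
weights by one in opposite directions (\<open>del_scale\<close>).

In dimension three the equation \<open>del \<theta> = 0\<close> is automatic. From \<open>delbar \<theta> = del \<omega>\<close> it follows that the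
top degree form \<open>f = del \<theta>\<close> is holomorphic (\<open>del_holomorphic\<close>), and then the
integral of \<open>f \<and> cnj f = d (\<theta> \<and> cnj f)\<close> is zero by Stokes' theorem, whence \<open>f = 0\<close>
(\<open>exact_holomorphic_3form_zero\<close>). Stokes' theorem is proved for this purpose by a partition of unity,
integration by parts in charts (\<open>integral_derivative_compact_support\<close>) and the change of variables
formula. The latter applies since \<open>f\<close> changes by the complex Jacobian determinant
(\<open>del_natural\<close>), whose squared modulus is the real Jacobian determinant (\<open>real_det_eq\<close>).\<close>

section \<open>Calculus of finitely often differentiable functions\<close>

lemma frechet_derivative_eqI: "(f has_derivative f') (at x) \<Longrightarrow> frechet_derivative f (at x) = f'"
  using frechet_derivative_at by metis

lemma frechet_derivative_cong_open:
  assumes "open S" "x \<in> S" "\<And>y. y \<in> S \<Longrightarrow> f y = g y"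
  shows "frechet_derivative f (at x) = frechet_derivative g (at x)"
proof -
  have "(f has_derivative D) (at x) \<longleftrightarrow> (g has_derivative D) (at x)" for D
    using assms has_derivative_transform_within_open[of f D x UNIV S g]
      has_derivative_transform_within_open[of g D x UNIV S f] by auto
  then show ?thesis
    by (simp add: frechet_derivative_def)
qed

lemma differentiable_cong_open:
  assumes "open S" "x \<in> S" "\<And>y. y \<in> S \<Longrightarrow> f y = g y"
  shows "f differentiable (at x) \<longleftrightarrow> g differentiable (at x)"
  using assms has_derivative_transform_within_open[of f _ x UNIV S g]
      has_derivative_transform_within_open[of g _ x UNIV S f]
  unfolding differentiable_def by metis

lemma Ck_on_cong:
  assumes "open S" "\<And>x. x \<in> S \<Longrightarrow> f x = g x"
  shows "Ck_on k S f \<longleftrightarrow> Ck_on k S g"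
  using assms(2)
proof (induction k arbitrary: f g)
  case 0
  then show ?case by (simp cong: continuous_on_cong)
next
  case (Suc k)
  have "f differentiable (at x) \<longleftrightarrow> g differentiable (at x)" if "x \<in> S" for x
    using differentiable_cong_open[OF assms(1) that, of f g] Suc.prems by blast
  moreover have "Ck_on k S (\<lambda>x. frechet_derivative f (at x) u) \<longleftrightarrow>
      Ck_on k S (\<lambda>x. frechet_derivative g (at x) u)" for u
    using frechet_derivative_cong_open[OF assms(1), of _ f g] Suc.prems
    by (intro Suc.IH) simp
  ultimately show ?case by simp
qed

lemma Ck_on_eqI:
  "Ck_on k S g \<Longrightarrow> open S \<Longrightarrow> (\<And>x. x \<in> S \<Longrightarrow> f x = g x) \<Longrightarrow> Ck_on k S f"
  using Ck_on_cong by blast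

lemma Ck_on_SucD: "Ck_on (Suc k) S f \<Longrightarrow> Ck_on k S f"
proof (induction k arbitrary: f)
  case 0
  then show ?case
    by (auto intro!: continuous_at_imp_continuous_on differentiable_imp_continuous_within)
qed auto

lemma Ck_on_Un:
  assumes "Ck_on k S f" "Ck_on k T f" "open S" "open T"
  shows "Ck_on k (S \<union> T) f"
  using assms by (induction k arbitrary: f) (auto intro: continuous_on_open_Un)

lemma Ck_on_const [simp]: "Ck_on k S (\<lambda>_. c)"
  by (induction k arbitrary: c) (simp_all add: frechet_derivative_const)

lemma frechet_derivative_bounded_linear_comp:
  assumes "bounded_linear L" "f differentiable (at x)"
  shows "frechet_derivative (\<lambda>x. L (f x)) (at x) = (\<lambda>u. L (frechet_derivative f (at x) u))"
  using bounded_linear.has_derivative[OF assms(1) frechet_derivative_works[THEN iffD1, OF assms(2)]]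
  by (rule frechet_derivative_eqI)

lemma Ck_on_bounded_linear:
  assumes L: "bounded_linear L" and "open S" and "Ck_on k S f"
  shows "Ck_on k S (\<lambda>x. L (f x))"
  using assms(3)
proof (induction k arbitrary: f)
  case 0
  then show ?case
    using bounded_linear.continuous_on[OF L] by simp
next
  case (Suc k)
  have "Ck_on k S (\<lambda>x. L (frechet_derivative f (at x) u))" for u
    using Suc by simp
  then have "Ck_on k S (\<lambda>x. frechet_derivative (\<lambda>x. L (f x)) (at x) u)" for u
    using \<open>open S\<close>
    by (rule Ck_on_eqI) (use Suc.prems in \<open>simp add: frechet_derivative_bounded_linear_comp[OF L]\<close>)
  then show ?case
    using Suc.prems bounded_linear.has_derivative[OF L] unfolding differentiable_def Ck_on.simps by blast
qed

lemma frechet_derivative_add: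
  assumes "f differentiable (at x)" "g differentiable (at x)"
  shows "frechet_derivative (\<lambda>x. f x + g x) (at x) =
    (\<lambda>u. frechet_derivative f (at x) u + frechet_derivative g (at x) u)"
  using assms by (intro frechet_derivative_eqI has_derivative_add) (auto simp: frechet_derivative_works[symmetric])

lemma Ck_on_add:
  assumes "open S" "Ck_on k S f" "Ck_on k S g"
  shows "Ck_on k S (\<lambda>x. f x + g x)"
  using assms(2,3)
proof (induction k arbitrary: f g)
  case 0
  then show ?case by (simp add: continuous_on_add)
next
  case (Suc k)
  have "Ck_on k S (\<lambda>x. frechet_derivative f (at x) u + frechet_derivative g (at x) u)" for u
    using Suc by simp
  then have "Ck_on k S (\<lambda>x. frechet_derivative (\<lambda>x. f x + g x) (at x) u)" for u
    using \<open>open S\<close> by (rule Ck_on_eqI) (use Suc.prems in \<open>simp add: frechet_derivative_add\<close>)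
  then show ?case
    using Suc.prems by auto
qed

lemma Ck_on_sum:
  assumes "open S" "\<And>i. i \<in> I \<Longrightarrow> Ck_on k S (f i)"
  shows "Ck_on k S (\<lambda>x. \<Sum>i\<in>I. f i x)"
  using assms(2) by (induction I rule: infinite_finite_induct) (auto intro: Ck_on_add assms(1))

lemma (in bounded_bilinear) frechet_derivative_prod:
  assumes "f differentiable (at x)" "g differentiable (at x)"
  shows "frechet_derivative (\<lambda>x. prod (f x) (g x)) (at x) =
    (\<lambda>u. prod (f x) (frechet_derivative g (at x) u) + prod (frechet_derivative f (at x) u) (g x))"
  using assms by (intro frechet_derivative_eqI FDERIV) (auto simp: frechet_derivative_works[symmetric])

lemma (in bounded_bilinear) Ck_on_prod:
  assumes "open S" "Ck_on k S f" "Ck_on k S g"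
  shows "Ck_on k S (\<lambda>x. prod (f x) (g x))"
  using assms(2,3)
proof (induction k arbitrary: f g)
  case 0
  then show ?case by (simp add: continuous_on)
next
  case (Suc k)
  have "Ck_on k S f" "Ck_on k S g"
    using Suc.prems by (auto dest: Ck_on_SucD simp del: Ck_on.simps)
  then have "Ck_on k S (\<lambda>x. prod (f x) (frechet_derivative g (at x) u) +
      prod (frechet_derivative f (at x) u) (g x))" for u
    using Suc by (intro Ck_on_add[OF assms(1)]) simp_all
  then have "Ck_on k S (\<lambda>x. frechet_derivative (\<lambda>x. prod (f x) (g x)) (at x) u)" for u
    using \<open>open S\<close> by (rule Ck_on_eqI) (use Suc.prems in \<open>simp add: frechet_derivative_prod\<close>)
  moreover have "(\<lambda>x. prod (f x) (g x)) differentiable (at x)" if "x \<in> S" for x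
    using Suc.prems that FDERIV[of f _ x UNIV g] unfolding differentiable_def Ck_on.simps by blast
  ultimately show ?case by simp
qed

text \<open>The two outer functions composed below, the square of the positive part and the reciprocal, are
  real functions of one variable, so that the chain rule is needed only in this form.\<close>

lemma C1_on_compose_real:
  fixes f :: "'a::real_normed_vector \<Rightarrow> real"
  assumes "open S" "Ck_on 1 S f"
    and g: "\<And>t. t \<in> f ` S \<Longrightarrow> (g has_real_derivative g' t) (at t)" "continuous_on (f ` S) g'"
  shows "Ck_on 1 S (\<lambda>x. g (f x))"
proof -
  have f: "f differentiable (at x)" "continuous_on S (\<lambda>x. frechet_derivative f (at x) u)" if "x \<in> S" for x u
    using assms that by auto
  have *: "((\<lambda>x. g (f x)) has_derivative (\<lambda>u. g' (f x) * frechet_derivative f (at x) u)) (at x)"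
    if "x \<in> S" for x
    using has_derivative_compose[OF frechet_derivative_works[THEN iffD1, OF f(1)[OF that]]
        g(1)[unfolded has_field_derivative_def]] that by auto
  have "continuous_on S f"
    using Ck_on_SucD[of 0 S f] assms by simp
  then have g': "continuous_on S (\<lambda>x. g' (f x))"
    using continuous_on_compose2[OF g(2)] by blast
  have "continuous_on S (\<lambda>x. frechet_derivative (\<lambda>x. g (f x)) (at x) u)" for u
  proof (cases "S = {}")
    case False
    then have "continuous_on S (\<lambda>x. g' (f x) * frechet_derivative f (at x) u)"
      using g' f(2) by (intro continuous_on_mult) auto
    then show ?thesis
      by (rule continuous_on_eq) (simp add: frechet_derivative_eqI[OF *])
  qed simp
  then show ?thesis
    using * by (auto simp: differentiable_def)
qed

lemma smooth_onD: "smooth_on S f \<Longrightarrow> Ck_on k S f"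
  by (simp add: smooth_on_def)

lemma smooth_on_derivative: "smooth_on S f \<Longrightarrow> smooth_on S (\<lambda>x. frechet_derivative f (at x) u)"
  unfolding smooth_on_def by (metis Ck_on.simps(2))

lemma smooth_on_differentiable: "smooth_on S f \<Longrightarrow> x \<in> S \<Longrightarrow> f differentiable (at x)"
  unfolding smooth_on_def by (metis Ck_on.simps(2))

lemma smooth_on_continuous: "smooth_on S f \<Longrightarrow> continuous_on S f"
  unfolding smooth_on_def by (metis Ck_on.simps(1))

lemma smooth_on_cong: "open S \<Longrightarrow> (\<And>x. x \<in> S \<Longrightarrow> f x = g x) \<Longrightarrow> smooth_on S f \<longleftrightarrow> smooth_on S g"
  unfolding smooth_on_def using Ck_on_cong by blast

lemma smooth_on_const [simp]: "smooth_on S (\<lambda>_. c)"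
  by (simp add: smooth_on_def)

lemma smooth_on_bounded_linear:
  "bounded_linear L \<Longrightarrow> open S \<Longrightarrow> smooth_on S f \<Longrightarrow> smooth_on S (\<lambda>x. L (f x))"
  by (simp add: smooth_on_def Ck_on_bounded_linear)

lemma smooth_on_add: "open S \<Longrightarrow> smooth_on S f \<Longrightarrow> smooth_on S g \<Longrightarrow> smooth_on S (\<lambda>x. f x + g x)"
  by (simp add: smooth_on_def Ck_on_add)

lemma smooth_on_sum:
  "open S \<Longrightarrow> (\<And>i. i \<in> I \<Longrightarrow> smooth_on S (f i)) \<Longrightarrow> smooth_on S (\<lambda>x. \<Sum>i\<in>I. f i x)"
  by (simp add: smooth_on_def Ck_on_sum)

lemma smooth_on_mult:
  fixes f :: "'a::real_normed_vector \<Rightarrow> 'b::real_normed_algebra"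
  shows "open S \<Longrightarrow> smooth_on S f \<Longrightarrow> smooth_on S g \<Longrightarrow> smooth_on S (\<lambda>x. f x * g x)"
  by (simp add: smooth_on_def bounded_bilinear.Ck_on_prod[OF bounded_bilinear_mult])

lemma smooth_on_cmult:
  fixes f :: "'a::real_normed_vector \<Rightarrow> 'b::real_normed_algebra"
  shows "open S \<Longrightarrow> smooth_on S f \<Longrightarrow> smooth_on S (\<lambda>x. c * f x)"
  by (rule smooth_on_mult) auto

lemma smooth_on_cnj: "open S \<Longrightarrow> smooth_on S f \<Longrightarrow> smooth_on S (\<lambda>x. cnj (f x))"
  by (rule smooth_on_bounded_linear[OF bounded_linear_cnj])

section \<open>Symmetry of second derivatives\<close>

text \<open>The mixed second difference on the left is symmetric in \<open>u\<close> and \<open>v\<close>. The mean value theorem,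
  applied along \<open>u\<close> to the increment in direction \<open>v\<close> and then along \<open>v\<close>, turns it into one of the
  two mixed derivatives at a nearby point; exchanging the roles yields the other one.\<close>

lemma mixed_difference_mean_value:
  fixes f :: "'a::real_normed_vector \<Rightarrow> real"
  assumes S: "open S" "Ck_on 2 S f" and h: "h > 0"
    and sq: "\<And>s t. 0 \<le> s \<Longrightarrow> s \<le> h \<Longrightarrow> 0 \<le> t \<Longrightarrow> t \<le> h \<Longrightarrow> x + s *\<^sub>R u + t *\<^sub>R v \<in> S"
  obtains s t where "0 < s" "s < h" "0 < t" "t < h"
    "f (x + h *\<^sub>R u + h *\<^sub>R v) - f (x + h *\<^sub>R u) - f (x + h *\<^sub>R v) + f x =
       h * h * frechet_derivative (\<lambda>y. frechet_derivative f (at y) u) (at (x + s *\<^sub>R u + t *\<^sub>R v)) v"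
proof -
  define fu where "fu = (\<lambda>y. frechet_derivative f (at y) u)"
  have f: "(f has_derivative frechet_derivative f (at y)) (at y)" if "y \<in> S" for y
    using S(2) that by (auto simp: numeral_2_eq_2 frechet_derivative_works[symmetric])
  have fu: "(fu has_derivative frechet_derivative fu (at y)) (at y)" if "y \<in> S" for y
    using S(2) that by (auto simp: fu_def numeral_2_eq_2 frechet_derivative_works[symmetric])
  have hom: "frechet_derivative g (at y) (c *\<^sub>R w) = c * frechet_derivative g (at y) w"
    if "(g has_derivative frechet_derivative g (at y)) (at y)" for g :: "'a \<Rightarrow> real" and y c w
    using linear_cmul[OF has_derivative_linear[OF that]] by simp
  define \<phi> where "\<phi> = (\<lambda>s. f (x + s *\<^sub>R u + h *\<^sub>R v) - f (x + s *\<^sub>R u))"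
  have der1: "((\<lambda>s. f (x + s *\<^sub>R u + w)) has_real_derivative fu (x + s *\<^sub>R u + w)) (at s)"
    if "x + s *\<^sub>R u + w \<in> S" for s w
  proof -
    have "((\<lambda>s. f (x + s *\<^sub>R u + w)) has_derivative
       (\<lambda>r. frechet_derivative f (at (x + s *\<^sub>R u + w)) (r *\<^sub>R u))) (at s)"
      by (rule has_derivative_compose[of "\<lambda>s. x + s *\<^sub>R u + w" "\<lambda>r. r *\<^sub>R u" s UNIV f])
        (use f[OF that] in \<open>auto intro!: derivative_eq_intros\<close>)
    then show ?thesis
      unfolding has_field_derivative_def fu_def hom[OF f[OF that]] by (simp add: mult.commute[of _ "frechet_derivative _ _ _"])
  qed
  have "(\<phi> has_real_derivative (fu (x + s *\<^sub>R u + h *\<^sub>R v) - fu (x + s *\<^sub>R u))) (at s)"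
    if "0 \<le> s" "s \<le> h" for s
    unfolding \<phi>_def using der1[of s "h *\<^sub>R v"] der1[of s 0] sq[of s h] sq[of s 0] that h
    by (auto intro!: DERIV_diff)
  from MVT2[OF h this] obtain s where s: "0 < s" "s < h"
    "\<phi> h - \<phi> 0 = h * (fu (x + s *\<^sub>R u + h *\<^sub>R v) - fu (x + s *\<^sub>R u))"
    by auto
  have "((\<lambda>t. fu (x + s *\<^sub>R u + t *\<^sub>R v)) has_real_derivative
      frechet_derivative fu (at (x + s *\<^sub>R u + t *\<^sub>R v)) v) (at t)"
    if "0 \<le> t" "t \<le> h" for t
  proof -
    have m: "x + s *\<^sub>R u + t *\<^sub>R v \<in> S" using sq s that by simp
    have "((\<lambda>t. fu (x + s *\<^sub>R u + t *\<^sub>R v)) has_derivative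
       (\<lambda>r. frechet_derivative fu (at (x + s *\<^sub>R u + t *\<^sub>R v)) (r *\<^sub>R v))) (at t)"
      by (rule has_derivative_compose[of "\<lambda>t. x + s *\<^sub>R u + t *\<^sub>R v" "\<lambda>r. r *\<^sub>R v" t UNIV fu])
        (use fu[OF m] in \<open>auto intro!: derivative_eq_intros\<close>)
    then show ?thesis
      unfolding has_field_derivative_def hom[OF fu[OF m]] by (simp add: mult.commute[of _ "frechet_derivative _ _ _"])
  qed
  from MVT2[OF h this] obtain t where t: "0 < t" "t < h"
    "fu (x + s *\<^sub>R u + h *\<^sub>R v) - fu (x + s *\<^sub>R u + 0 *\<^sub>R v) =
       h * frechet_derivative fu (at (x + s *\<^sub>R u + t *\<^sub>R v)) v"
    by auto
  show thesis
    by (rule that[OF s(1,2) t(1,2)]) (use s(3) t(3) in \<open>auto simp: \<phi>_def fu_def\<close>)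
qed

text \<open>For a small square, the two mixed derivatives agree at two points of the square, which may be
  different. Continuity at the corner \<open>x\<close> then gives equality there.\<close>

lemma second_derivative_symmetric_real:
  fixes f :: "'a::real_normed_vector \<Rightarrow> real"
  assumes S: "open S" "Ck_on 2 S f" "x \<in> S"
  shows "frechet_derivative (\<lambda>y. frechet_derivative f (at y) u) (at x) v =
    frechet_derivative (\<lambda>y. frechet_derivative f (at y) v) (at x) u"
proof -
  define F where "F = (\<lambda>u v y. frechet_derivative (\<lambda>y. frechet_derivative f (at y) u) (at y) v)"
  have cont: "continuous_on S (F u v)" for u v
    using S(2) by (simp add: F_def numeral_2_eq_2)
  have "\<bar>F u v x - F v u x\<bar> < e" if "e > 0" for e
  proof -
    have "\<exists>d>0. \<forall>y. dist y x < d \<longrightarrow> y \<in> S \<and> dist (F a b y) (F a b x) < e / 2" for a b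
    proof -
      have "continuous (at x) (F a b)"
        using cont[of a b] S continuous_on_eq_continuous_at by blast
      then obtain d where "d > 0" "\<And>y. dist y x < d \<Longrightarrow> dist (F a b y) (F a b x) < e / 2"
        unfolding continuous_at_eps_delta using \<open>e > 0\<close> by (meson half_gt_zero)
      moreover obtain d' where "d' > 0" "\<And>y. dist y x < d' \<Longrightarrow> y \<in> S"
        using S(1,3) by (auto simp: open_dist)
      ultimately show ?thesis
        by (intro exI[of _ "min d d'"]) auto
    qed
    then obtain d where d: "d > 0"
      "\<And>y. dist y x < d \<Longrightarrow> y \<in> S \<and> dist (F u v y) (F u v x) < e / 2 \<and> dist (F v u y) (F v u x) < e / 2"
      by (metis min_less_iff_conj)
    (* This side length keeps the square within distance d of x; the 1 avoids a zero denominator. *)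
    define h where "h = d / (norm u + norm v + 1)"
    have h: "h > 0" using d by (simp add: h_def add_nonneg_pos)
    have near: "dist (x + s *\<^sub>R u + t *\<^sub>R v) x < d" if "0 \<le> s" "s \<le> h" "0 \<le> t" "t \<le> h" for s t
    proof -
      have "dist (x + s *\<^sub>R u + t *\<^sub>R v) x \<le> s * norm u + t * norm v"
        using norm_triangle_ineq[of "s *\<^sub>R u" "t *\<^sub>R v"] that by (simp add: dist_norm add.assoc)
      also have "\<dots> \<le> h * norm u + h * norm v"
        using that by (intro add_mono mult_right_mono) auto
      also have "\<dots> < h * (norm u + norm v + 1)"
        using h by (simp add: algebra_simps)
      also have "\<dots> = d"
        using norm_ge_zero[of u] norm_ge_zero[of v] unfolding h_def
        by (metis add_nonneg_pos add_nonneg_nonneg less_irrefl nonzero_eq_divide_eq zero_less_one)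
      finally show ?thesis .
    qed
    have near': "dist (x + s *\<^sub>R v + t *\<^sub>R u) x < d" if "0 \<le> s" "s \<le> h" "0 \<le> t" "t \<le> h" for s t
      using near[of t s] that by (simp add: add_ac)
    obtain s t where st: "0 < s" "s < h" "0 < t" "t < h"
      "f (x + h *\<^sub>R u + h *\<^sub>R v) - f (x + h *\<^sub>R u) - f (x + h *\<^sub>R v) + f x =
         h * h * F u v (x + s *\<^sub>R u + t *\<^sub>R v)"
      using mixed_difference_mean_value[OF S(1,2) h, of x u v] near d(2) unfolding F_def by metis
    obtain s' t' where st': "0 < s'" "s' < h" "0 < t'" "t' < h"
      "f (x + h *\<^sub>R v + h *\<^sub>R u) - f (x + h *\<^sub>R v) - f (x + h *\<^sub>R u) + f x =
         h * h * F v u (x + s' *\<^sub>R v + t' *\<^sub>R u)"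
      using mixed_difference_mean_value[OF S(1,2) h, of x v u] near' d(2) unfolding F_def by metis
    have "h * h * F u v (x + s *\<^sub>R u + t *\<^sub>R v) = h * h * F v u (x + s' *\<^sub>R v + t' *\<^sub>R u)"
      using st(5) st'(5) by (simp add: algebra_simps)
    then have "F u v (x + s *\<^sub>R u + t *\<^sub>R v) = F v u (x + s' *\<^sub>R v + t' *\<^sub>R u)"
      using h by simp
    then show ?thesis
      using d(2)[OF near[of s t]] d(2)[OF near'[of s' t']] st st' unfolding dist_real_def
      by (auto simp: abs_if split: if_splits)
  qed
  then have "F u v x = F v u x"
    by (metis abs_ge_zero abs_le_zero_iff eq_iff_diff_eq_0 less_irrefl not_le_imp_less)
  then show ?thesis by (simp add: F_def)
qed

lemma second_derivative_symmetric:
  fixes f :: "'a::real_normed_vector \<Rightarrow> complex"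
  assumes S: "open S" "Ck_on 2 S f" "x \<in> S"
  shows "frechet_derivative (\<lambda>y. frechet_derivative f (at y) u) (at x) v =
    frechet_derivative (\<lambda>y. frechet_derivative f (at y) v) (at x) u"
proof -
  have *: "frechet_derivative (\<lambda>y. frechet_derivative (\<lambda>z. L (f z)) (at y) a) (at x) b =
      L (frechet_derivative (\<lambda>y. frechet_derivative f (at y) a) (at x) b)"
    if L: "bounded_linear L" for L :: "complex \<Rightarrow> real" and a b
  proof -
    have "frechet_derivative (\<lambda>y. frechet_derivative (\<lambda>z. L (f z)) (at y) a) (at x) =
        frechet_derivative (\<lambda>y. L (frechet_derivative f (at y) a)) (at x)"
      using S by (intro frechet_derivative_cong_open[OF S(1,3)])
        (simp add: frechet_derivative_bounded_linear_comp[OF L] numeral_2_eq_2)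
    also have "\<dots> = (\<lambda>b. L (frechet_derivative (\<lambda>y. frechet_derivative f (at y) a) (at x) b))"
      using S by (intro frechet_derivative_bounded_linear_comp[OF L]) (simp add: numeral_2_eq_2)
    finally show ?thesis by simp
  qed
  show ?thesis
    using second_derivative_symmetric_real[OF S(1) Ck_on_bounded_linear[OF bounded_linear_Re S(1,2)] S(3), of u v]
      second_derivative_symmetric_real[OF S(1) Ck_on_bounded_linear[OF bounded_linear_Im S(1,2)] S(3), of u v]
    unfolding *[OF bounded_linear_Re] *[OF bounded_linear_Im] by (rule complex_eqI)
qed

section \<open>The wedge product and determinants of covectors\<close>

definition alternator :: "('b list \<Rightarrow> complex) \<Rightarrow> 'b list \<Rightarrow> complex" where
  "alternator g v = (\<Sum>\<sigma> | \<sigma> permutes {..<length v}. of_int (sign \<sigma>) * g (permute_list \<sigma> v))"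

text \<open>The wedge product is a sum of unnormalised antisymmetrisations, one for each way of cutting the
  list of arguments in two. Its algebra is derived from that of antisymmetrisation.\<close>

lemma wedge_alt_eq_alternator:
  "wedge_alt L M v = (\<Sum>k\<le>length v. 1 / (fact k * fact (length v - k)) *
     alternator (\<lambda>w. L (take k w) * M (drop k w)) v)"
proof -
  have "map (\<lambda>i. v ! \<sigma> i) [0..<k] = take k (permute_list \<sigma> v)" if "k \<le> length v" for k \<sigma>
    using that by (simp add: permute_list_def take_map)
  moreover have "map (\<lambda>i. v ! \<sigma> i) [k..<length v] = drop k (permute_list \<sigma> v)" for k \<sigma>
    by (simp add: permute_list_def drop_map)
  ultimately show ?thesis
    unfolding wedge_alt_def alternator_def by (simp add: mult.assoc)
qed

lemma alternator_permute:
  assumes "\<pi> permutes {..<length v}"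
  shows "alternator (\<lambda>w. g (permute_list \<pi> w)) v = of_int (sign \<pi>) * alternator g v"
proof -
  let ?P = "{\<sigma>. \<sigma> permutes {..<length v}}"
  have perm: "permutation \<sigma>" if "\<sigma> permutes {..<length v}" for \<sigma>
    using permutes_imp_permutation[OF _ that] by simp
  have sgn: "of_int (sign \<sigma>) = (of_int (sign \<pi>) * of_int (sign (\<sigma> \<circ> \<pi>)) :: complex)"
    if "\<sigma> \<in> ?P" for \<sigma>
  proof -
    have "sign \<pi> * sign (\<sigma> \<circ> \<pi>) = sign \<sigma>"
      using that assms perm by (simp add: sign_compose)
    then show ?thesis by (metis of_int_mult)
  qed
  have "alternator (\<lambda>w. g (permute_list \<pi> w)) v =
      (\<Sum>\<sigma>\<in>?P. of_int (sign \<sigma>) * g (permute_list (\<sigma> \<circ> \<pi>) v))"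
    using assms by (simp add: alternator_def permute_list_compose)
  also have "\<dots> = (\<Sum>\<sigma>\<in>?P. of_int (sign \<pi>) * (of_int (sign (\<sigma> \<circ> \<pi>)) * g (permute_list (\<sigma> \<circ> \<pi>) v)))"
    by (intro sum.cong refl) (simp add: sgn)
  also have "\<dots> = of_int (sign \<pi>) * (\<Sum>\<sigma>\<in>?P. of_int (sign (\<sigma> \<circ> \<pi>)) * g (permute_list (\<sigma> \<circ> \<pi>) v))"
    by (simp add: sum_distrib_left)
  also have "\<dots> = of_int (sign \<pi>) * alternator g v"
    unfolding alternator_def by (subst sum_permutations_compose_right[OF assms]) simp
  finally show ?thesis .
qed

lemma alternator_sum: "alternator (\<lambda>w. \<Sum>i\<in>I. f i w) v = (\<Sum>i\<in>I. alternator (f i) v)"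
  unfolding alternator_def by (subst sum.swap) (simp add: sum_distrib_left)

lemma alternator_cmult: "alternator (\<lambda>w. c * f w) v = c * alternator f v"
  unfolding alternator_def by (simp add: sum_distrib_left mult_ac)

lemma alternator_map: "alternator f (map T v) = alternator (\<lambda>w. f (map T w)) v"
  unfolding alternator_def by (simp add: permute_list_map)

lemma alternator_cong: "(\<And>w. length w = length v \<Longrightarrow> f w = g w) \<Longrightarrow> alternator f v = alternator g v"
  by (simp add: alternator_def)

text \<open>Exchanging the equal vectors does not change the list, but it reverses the sign of every
  permutation.\<close>

lemma alternator_eq_0:
  assumes ij: "i < j" "j < length v" "v ! i = v ! j"
  shows "alternator g v = 0"
proof -
  let ?t = "Transposition.transpose i j" and ?P = "{\<sigma>. \<sigma> permutes {..<length v}}"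
  have t: "?t permutes {..<length v}"
    using ij by (intro permutes_swap_id) auto
  have v: "permute_list ?t v = v"
  proof (rule nth_equalityI)
    show "permute_list ?t v ! k = v ! k" if "k < length (permute_list ?t v)" for k
      using that permute_list_nth[OF t, of k] ij
      by (cases "k = i"; cases "k = j") auto
  qed simp
  have "of_int (sign (?t \<circ> \<sigma>)) = - (of_int (sign \<sigma>) :: complex)" if "\<sigma> \<in> ?P" for \<sigma>
  proof -
    have "sign (?t \<circ> \<sigma>) = sign ?t * sign \<sigma>"
      using that permutes_imp_permutation[of "{..<length v}" \<sigma>]
      by (intro sign_compose permutation_swap_id) auto
    then show ?thesis using ij by (simp add: sign_swap_id)
  qed
  moreover have "permute_list (?t \<circ> \<sigma>) v = permute_list \<sigma> v" if "\<sigma> \<in> ?P" for \<sigma>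
    using that v by (simp add: permute_list_compose)
  ultimately have "alternator g v = - alternator g v"
    unfolding alternator_def
    by (subst setum_permutations_compose_left[OF t]) (simp add: sum_negf)
  then show ?thesis by simp
qed

lemma permute_list_update:
  assumes \<sigma>: "\<sigma> permutes {..<length v}" and i: "i < length v"
  shows "permute_list \<sigma> (v[i := u]) = (permute_list \<sigma> v)[inv \<sigma> i := u]"
proof (rule nth_equalityI)
  fix k assume "k < length (permute_list \<sigma> (v[i := u]))"
  moreover have "\<sigma> k = i \<longleftrightarrow> k = inv \<sigma> i"
    using permutes_inverses[OF \<sigma>] by metis
  moreover have "\<sigma> k < length v" if "k < length v"
    using permutes_in_image[OF \<sigma>, of k] that by simp
  ultimately show "permute_list \<sigma> (v[i := u]) ! k = (permute_list \<sigma> v)[inv \<sigma> i := u] ! k"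
    by (auto simp: permute_list_def nth_list_update)
qed simp

lemma linear_mult_const:
  fixes f :: "'b::real_vector \<Rightarrow> complex"
  shows "linear f \<Longrightarrow> linear (\<lambda>u. c * f u)" and "linear f \<Longrightarrow> linear (\<lambda>u. f u * c)"
  by (simp_all add: linear_iff distrib_left distrib_right)

lemma alternating_alternator:
  fixes g :: "nat \<Rightarrow> 'n::finite altform"
  assumes "\<And>w i. i < length w \<Longrightarrow> linear (\<lambda>u. g (length w) (w[i := u]))"
  shows "alternating (\<lambda>v. alternator (g (length v)) v)"
  unfolding alternating_def
proof (intro conjI allI impI)
  fix v :: "(complex^'n) list" and i assume i: "i < length v"
  have "linear (\<lambda>u. of_int (sign \<sigma>) * g (length v) (permute_list \<sigma> (v[i := u])))"
    if \<sigma>: "\<sigma> permutes {..<length v}" for \<sigma>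
  proof -
    have "inv \<sigma> i < length v"
      using permutes_in_image[OF permutes_inv[OF \<sigma>], of i] i by simp
    then have "linear (\<lambda>u. g (length v) ((permute_list \<sigma> v)[inv \<sigma> i := u]))"
      using assms[of "inv \<sigma> i" "permute_list \<sigma> v"] by simp
    then show ?thesis
      unfolding permute_list_update[OF \<sigma> i] by (rule linear_mult_const)
  qed
  then show "linear (\<lambda>u. alternator (g (length (v[i := u]))) (v[i := u]))"
    unfolding alternator_def length_list_update by (intro linear_compose_sum) auto
qed (simp add: alternator_eq_0)

lemma alternating_cmult: "alternating f \<Longrightarrow> alternating (\<lambda>v. c * f v)"
  unfolding alternating_def by (simp add: linear_iff distrib_left)

text \<open>In every permuted list each argument lands in exactly one of the two factors, which gives
  linearity; the vanishing on repeated arguments is a property of antisymmetrisation alone.\<close>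

lemma alternating_wedge:
  assumes "alternating L" "alternating M"
  shows "alternating (wedge_alt L M)"
proof -
  have lin: "linear (\<lambda>u. L (take k (w[i := u])) * M (drop k (w[i := u])))"
    if i: "i < length w" for w i k
  proof (cases "i < k")
    case True
    then have "linear (\<lambda>u. L ((take k w)[i := u]))"
      using assms(1) i unfolding alternating_def by auto
    then show ?thesis
      using True by (simp add: take_update_swap linear_mult_const)
  next
    case False
    then have "linear (\<lambda>u. M ((drop k w)[i - k := u]))"
      using assms(2) i unfolding alternating_def by auto
    then show ?thesis
      using False by (simp add: drop_update_swap linear_mult_const)
  qed
  define g where "g N k w = (if k \<le> N then 1 / (fact k * fact (N - k)) * (L (take k w) * M (drop k w)) else 0)"
    for N k and w :: "(complex^'a) list"
  have "wedge_alt L M v = alternator (\<lambda>w. \<Sum>k\<le>length v. g (length v) k w) v" for v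
    unfolding wedge_alt_eq_alternator alternator_sum
    by (intro sum.cong refl) (simp only: g_def atMost_iff if_True alternator_cmult)
  moreover have "linear (\<lambda>u. \<Sum>k\<le>length w. g (length w) k (w[i := u]))" if "i < length w" for w i
  proof (rule linear_compose_sum)
    show "\<forall>k\<in>{..length w}. linear (\<lambda>u. g (length w) k (w[i := u]))"
    proof
      fix k
      show "linear (\<lambda>u. g (length w) k (w[i := u]))"
        unfolding g_def by (cases "k \<le> length w") (simp_all only: if_True if_False linear_mult_const(1)[OF lin[OF that]] linear_zero)
    qed
  qed
  ultimately show ?thesis
    using alternating_alternator[of "\<lambda>N w. \<Sum>k\<le>N. g N k w"] by presburger
qed

lemma wedge_alt_map:
  "wedge_alt L M (map T v) = wedge_alt (\<lambda>w. L (map T w)) (\<lambda>w. M (map T w)) v"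
  by (simp add: wedge_alt_eq_alternator alternator_map take_map drop_map)

lemma wedge_alt_sum_left:
  "wedge_alt (\<lambda>v. \<Sum>i\<in>I. L i v) M v = (\<Sum>i\<in>I. wedge_alt (L i) M v)"
  unfolding wedge_alt_eq_alternator sum_distrib_right alternator_sum sum_distrib_left
  by (rule sum.swap)

lemma wedge_alt_sum_right:
  "wedge_alt L (\<lambda>v. \<Sum>i\<in>I. M i v) v = (\<Sum>i\<in>I. wedge_alt L (M i) v)"
  unfolding wedge_alt_eq_alternator sum_distrib_left[of "L _"] alternator_sum sum_distrib_left
  by (rule sum.swap)

lemma wedge_alt_cmult_left: "wedge_alt (\<lambda>v. c * L v) M v = c * wedge_alt L M v"
  unfolding wedge_alt_eq_alternator mult.assoc alternator_cmult by (simp add: sum_distrib_left mult_ac)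

lemma wedge_alt_cmult_right: "wedge_alt L (\<lambda>v. c * M v) v = c * wedge_alt L M v"
  unfolding wedge_alt_eq_alternator mult.left_commute[of _ c] alternator_cmult
  by (simp add: sum_distrib_left mult_ac)

lemma wedge_alt_cnj: "wedge_alt (\<lambda>v. cnj (L v)) (\<lambda>v. cnj (M v)) v = cnj (wedge_alt L M v)"
  unfolding wedge_alt_def by simp

text \<open>The Leibniz formula for the determinant of the values of the covectors \<open>fs\<close>, which is the
  wedge product of \<open>fs\<close>.\<close>

definition covec_det :: "(complex^'n \<Rightarrow> complex) list \<Rightarrow> 'n::finite altform" where
  "covec_det fs v =
     (if length v = length fs then alternator (\<lambda>w. \<Prod>i<length fs. (fs ! i) (w ! i)) v else 0)"

lemma lift_permutation:
  assumes "\<tau> permutes {..<l::nat}"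
  obtains \<pi> where "\<pi> permutes {..<k + l}" "sign \<pi> = sign \<tau>"
    "\<And>i. i < k \<Longrightarrow> \<pi> i = i" "\<And>j. j < l \<Longrightarrow> \<pi> (k + j) = k + \<tau> j"
proof
  let ?\<pi> = "map_permutation {..<l} (\<lambda>j. k + j) \<tau>"
  have "bij_betw (\<lambda>j. k + j) {..<l} {k..<k + l}"
    by (rule bij_betwI[of _ _ _ "\<lambda>i. i - k"]) auto
  then have *: "?\<pi> permutes {k..<k + l}"
    using assms by (rule map_permutation_permutes)
  show "?\<pi> permutes {..<k + l}"
    using * by (rule permutes_subset) auto
  show "sign ?\<pi> = sign \<tau>"
    using assms by (intro sign_map_permutation) auto
  show "?\<pi> i = i" if "i < k" for i
    using that by (intro permutes_not_in[OF *]) auto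
  show "?\<pi> (k + j) = k + \<tau> j" if "j < l" for j
    using that by (intro map_permutation_apply[where f="\<lambda>j. k + j"]) auto
qed

lemma prod_lessThan_add:
  fixes f :: "nat \<Rightarrow> 'b::comm_monoid_mult"
  shows "(\<Prod>i<k + l. f i) = (\<Prod>i<k. f i) * (\<Prod>j<l. f (k + j))"
  by (induction l) (simp_all add: mult.assoc)

text \<open>This identity stands in for associativity and graded commutativity of the wedge product. Permutations of
  the first block and of the second block extend to permutations of the whole list; the outer
  antisymmetrisation absorbs each pair of them together with its sign, and there are as many pairs
  as the normalising factor \<open>fact k * fact l\<close> removes.\<close>

lemma wedge_covec_det:
  "wedge_alt (covec_det fs) (covec_det gs) = covec_det (fs @ gs)"
proof
  fix v :: "(complex^'a) list"
  let ?k = "length fs" and ?l = "length gs"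
  show "wedge_alt (covec_det fs) (covec_det gs) v = covec_det (fs @ gs) v"
  proof (cases "length v = ?k + ?l")
    case False
    have "alternator (\<lambda>w. covec_det fs (take k w) * covec_det gs (drop k w)) v = 0" if "k \<le> length v" for k
      using that False unfolding alternator_def
      by (intro sum.neutral) (auto simp: covec_det_def)
    then show ?thesis
      using False by (simp add: wedge_alt_eq_alternator) (simp add: covec_det_def)
  next
    case N: True
    define a where "a w = (\<Prod>i<?k. (fs ! i) (w ! i))" for w
    define b where "b w = (\<Prod>j<?l. (gs ! j) (w ! j))" for w
    define p where "p w = a (take ?k w) * b (drop ?k w)" for w
    have p: "(\<Prod>i<length (fs @ gs). ((fs @ gs) ! i) (w ! i)) = p w" if "length w = length v" for w
    proof -
      have "(\<Prod>i<?k + ?l. ((fs @ gs) ! i) (w ! i)) =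
          (\<Prod>i<?k. ((fs @ gs) ! i) (w ! i)) * (\<Prod>j<?l. ((fs @ gs) ! (?k + j)) (w ! (?k + j)))"
        by (rule prod_lessThan_add)
      then show ?thesis
        using that N by (simp add: p_def a_def b_def nth_append)
    qed
    have red: "alternator (\<lambda>w. a (permute_list \<tau> (take ?k w)) * b (permute_list \<tau>' (drop ?k w))) v =
        of_int (sign \<tau>) * of_int (sign \<tau>') * alternator p v"
      if t: "\<tau> permutes {..<?k}" "\<tau>' permutes {..<?l}" for \<tau> \<tau>'
    proof -
      obtain \<pi> where \<pi>: "\<pi> permutes {..<length v}" "sign \<pi> = sign \<tau>'"
        "\<And>i. i < ?k \<Longrightarrow> \<pi> i = i" "\<And>j. j < ?l \<Longrightarrow> \<pi> (?k + j) = ?k + \<tau>' j"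
        using lift_permutation[OF t(2), of ?k] N by metis
      have \<tau>: "\<tau> permutes {..<length v}"
        using t(1) by (rule permutes_subset) (use N in auto)
      have comp: "\<tau> \<circ> \<pi> permutes {..<length v}"
        using \<tau> \<pi>(1) by (rule permutes_compose[rotated])
      have sgn: "sign (\<tau> \<circ> \<pi>) = sign \<tau> * sign \<tau>'"
        using permutes_imp_permutation[OF _ \<tau>] permutes_imp_permutation[OF _ \<pi>(1)] \<pi>(2)
        by (simp add: sign_compose)
      have "a (permute_list \<tau> (take ?k w)) * b (permute_list \<tau>' (drop ?k w)) = p (permute_list (\<tau> \<circ> \<pi>) w)"
        if w: "length w = length v" for w
      proof -
        have "\<tau> i < ?k" if "i < ?k" for i
          using permutes_in_image[OF t(1), of i] that by simp
        then have 1: "permute_list \<tau> (take ?k w) = take ?k (permute_list (\<tau> \<circ> \<pi>) w)"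
          using w N \<pi>(3) by (intro nth_equalityI) (auto simp: permute_list_def)
        have "\<tau> (?k + \<tau>' j) = ?k + \<tau>' j" "\<tau>' j < ?l" if "j < ?l" for j
          using permutes_in_image[OF t(2), of j] that permutes_not_in[OF t(1)] by auto
        then have 2: "permute_list \<tau>' (drop ?k w) = drop ?k (permute_list (\<tau> \<circ> \<pi>) w)"
          using w N \<pi>(4) by (intro nth_equalityI) (auto simp: permute_list_def)
        show ?thesis
          unfolding 1 2 p_def ..
      qed
      then have "alternator (\<lambda>w. a (permute_list \<tau> (take ?k w)) * b (permute_list \<tau>' (drop ?k w))) v =
          alternator (\<lambda>w. p (permute_list (\<tau> \<circ> \<pi>) w)) v"
        by (rule alternator_cong)
      also have "\<dots> = of_int (sign \<tau>) * of_int (sign \<tau>') * alternator p v"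
        unfolding alternator_permute[OF comp] sgn by simp
      finally show ?thesis .
    qed
    have one: "of_int (sign \<tau>) * of_int (sign \<tau>) = (1::complex)" for \<tau> :: "nat \<Rightarrow> nat"
      by (metis of_int_1 of_int_mult sign_idempotent)
    have "alternator (\<lambda>w. covec_det fs (take ?k w) * covec_det gs (drop ?k w)) v =
      alternator (\<lambda>w. \<Sum>\<tau>\<in>{\<tau>. \<tau> permutes {..<?k}}. \<Sum>\<tau>'\<in>{\<tau>'. \<tau>' permutes {..<?l}}.
         (of_int (sign \<tau>) * of_int (sign \<tau>')) *
         (a (permute_list \<tau> (take ?k w)) * b (permute_list \<tau>' (drop ?k w)))) v"
      using N by (intro alternator_cong)
        (simp add: covec_det_def alternator_def a_def b_def sum_product mult_ac)
    also have "\<dots> = (\<Sum>\<tau>\<in>{\<tau>. \<tau> permutes {..<?k}}. \<Sum>\<tau>'\<in>{\<tau>'. \<tau>' permutes {..<?l}}.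
         (of_int (sign \<tau>) * of_int (sign \<tau>')) * (of_int (sign \<tau>) * of_int (sign \<tau>') * alternator p v))"
      unfolding alternator_sum alternator_cmult by (intro sum.cong refl) (simp add: red)
    also have "\<dots> = (\<Sum>\<tau>\<in>{\<tau>. \<tau> permutes {..<?k}}. \<Sum>\<tau>'\<in>{\<tau>'. \<tau>' permutes {..<?l}}. alternator p v)"
      using one by (intro sum.cong refl) (simp add: mult.assoc mult.left_commute)
    also have "\<dots> = fact ?k * fact ?l * alternator p v"
      by (simp add: card_permutations[OF refl])
    finally have main: "alternator (\<lambda>w. covec_det fs (take ?k w) * covec_det gs (drop ?k w)) v =
      fact ?k * fact ?l * alternator p v" .
    have other: "alternator (\<lambda>w. covec_det fs (take k w) * covec_det gs (drop k w)) v = 0"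
      if "k \<le> length v" "k \<noteq> ?k" for k
      using that unfolding alternator_def by (intro sum.neutral) (auto simp: covec_det_def)
    have "wedge_alt (covec_det fs) (covec_det gs) v =
        (\<Sum>k\<in>{?k}. 1 / (fact k * fact (length v - k)) *
           alternator (\<lambda>w. covec_det fs (take k w) * covec_det gs (drop k w)) v)"
      unfolding wedge_alt_eq_alternator using N other
      by (intro sum.mono_neutral_right) auto
    also have "\<dots> = alternator p v"
      using N by (simp add: main)
    also have "\<dots> = covec_det (fs @ gs) v"
      unfolding covec_det_def using N alternator_cong[of v _ p, OF p] by simp
    finally show ?thesis .
  qed
qed

text \<open>Reordering the covectors costs at most a sign. This suffices to move the \<open>dz\<close> of a second factor
  past the \<open>dzbar\<close> of a first one.\<close>

lemma covec_det_mset: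
  assumes "mset fs = mset gs"
  obtains \<epsilon> where "\<And>v. covec_det fs v = \<epsilon> * covec_det gs v"
proof -
  obtain \<pi> where \<pi>: "\<pi> permutes {..<length gs}" "permute_list \<pi> gs = fs"
    using mset_eq_permutation[OF assms] by auto
  have len: "length fs = length gs"
    using assms by (rule mset_eq_length)
  have inv: "inv \<pi> permutes {..<length gs}"
    using \<pi>(1) by (rule permutes_inv)
  have eq: "(\<Prod>i<length fs. (fs ! i) (w ! i)) = (\<Prod>i<length gs. (gs ! i) (permute_list (inv \<pi>) w ! i))"
    if "length w = length gs" for w
  proof -
    have "(\<Prod>i<length gs. (gs ! i) (permute_list (inv \<pi>) w ! i)) =
        (\<Prod>i<length gs. (gs ! \<pi> i) (permute_list (inv \<pi>) w ! \<pi> i))"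
      using prod.permute[OF \<pi>(1)] by (simp add: o_def)
    also have "\<dots> = (\<Prod>i<length gs. (fs ! i) (w ! i))"
    proof (rule prod.cong[OF refl])
      fix i assume i: "i \<in> {..<length gs}"
      then have "\<pi> i < length gs"
        using permutes_in_image[OF \<pi>(1), of i] by simp
      then have "permute_list (inv \<pi>) w ! \<pi> i = w ! i"
        using permute_list_nth[of "inv \<pi>" w "\<pi> i"] inv that permutes_inverses[OF \<pi>(1)] by simp
      moreover have "fs ! i = gs ! \<pi> i"
        using permute_list_nth[OF \<pi>(1), of i] i \<pi>(2) by simp
      ultimately show "(gs ! \<pi> i) (permute_list (inv \<pi>) w ! \<pi> i) = (fs ! i) (w ! i)" by simp
    qed
    finally show ?thesis using len by simp
  qed
  have "covec_det fs v = of_int (sign (inv \<pi>)) * covec_det gs v" for v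
  proof (cases "length v = length gs")
    case True
    then have "covec_det fs v = alternator (\<lambda>w. \<Prod>i<length gs. (gs ! i) (permute_list (inv \<pi>) w ! i)) v"
      unfolding covec_det_def using len eq by (auto intro!: alternator_cong)
    also have "\<dots> = of_int (sign (inv \<pi>)) * covec_det gs v"
      using alternator_permute[of "inv \<pi>" v "\<lambda>w. \<Prod>i<length gs. (gs ! i) (w ! i)"] inv True
      by (simp add: covec_det_def)
    finally show ?thesis .
  qed (simp add: covec_det_def len)
  then show thesis by (rule that)
qed

lemma covec_det_Nil: "covec_det [] = unit_alt"
  by (rule ext) (simp add: covec_det_def unit_alt_def alternator_def)

lemma covec_det_single: "covec_det [f] v = (case v of [u] \<Rightarrow> f u | _ \<Rightarrow> 0)"
  by (auto simp: covec_det_def alternator_def lessThan_Suc permute_list_def split: list.split)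

lemma foldr_wedge_covec_det:
  "foldr wedge_alt (map (\<lambda>f. covec_det [f]) fs) unit_alt = covec_det fs"
  by (induction fs) (simp_all add: covec_det_Nil wedge_covec_det)

lemma dz_dzbar_covec_det:
  fixes I J :: "'n::finite list"
  shows "dz_dzbar I J = covec_det (map (\<lambda>j u. u $ j) I @ map (\<lambda>j u. cnj (u $ j)) J)"
proof -
  have "dz = (\<lambda>j::'n. covec_det [\<lambda>u. u $ j])" "dzbar = (\<lambda>j::'n. covec_det [\<lambda>u. cnj (u $ j)])"
    by (auto simp: fun_eq_iff dz_def dzbar_def covec_det_single)
  then show ?thesis
    using foldr_wedge_covec_det[of "map (\<lambda>j u. u $ j) I @ map (\<lambda>j u. cnj (u $ j)) J"]
    by (simp add: dz_dzbar_def o_def del: foldr_append foldr_map)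
qed

lemma wedge_dz_dzbar:
  obtains \<epsilon> where
    "\<And>v. wedge_alt (dz_dzbar I J) (dz_dzbar I' J') v = \<epsilon> * dz_dzbar (I @ I') (J @ J') v"
proof -
  obtain \<epsilon> where "\<And>v. covec_det ((map (\<lambda>j u. u $ j) I @ map (\<lambda>j u. cnj (u $ j)) J) @
        map (\<lambda>j u. u $ j) I' @ map (\<lambda>j u. cnj (u $ j)) J') v =
      \<epsilon> * covec_det (map (\<lambda>j u. u $ j) (I @ I') @ map (\<lambda>j u. cnj (u $ j)) (J @ J')) v"
    by (rule covec_det_mset[of "(map (\<lambda>j u. u $ j) I @ map (\<lambda>j u. cnj (u $ j)) J) @
        map (\<lambda>j u. u $ j) I' @ map (\<lambda>j u. cnj (u $ j)) J'"
        "map (\<lambda>j u. u $ j) (I @ I') @ map (\<lambda>j u. cnj (u $ j)) (J @ J')"]) (auto simp: add_ac)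
  then show thesis
    by (intro that[of \<epsilon>]) (simp add: dz_dzbar_covec_det wedge_covec_det)
qed

section \<open>Bidegree\<close>

lemma finite_multi_indices: "finite {I :: 'n::finite list. length I = p}"
  using finite_lists_length_eq[of "UNIV :: 'n set" p] by simp

lemma bidegree_alt_dz_dzbar:
  fixes I J :: "'n::finite list"
  assumes "length I = p" "length J = q"
  shows "bidegree_alt p q (dz_dzbar I J)"
  unfolding bidegree_alt_def
proof (intro exI allI)
  fix v
  have "(\<Sum>I'\<in>{I. length I = p}. \<Sum>J'\<in>{J. length J = q}. of_bool (I' = I \<and> J' = J) * dz_dzbar I' J' v) =
     (\<Sum>I'\<in>{I. length I = p}. \<Sum>J'\<in>{J. length J = q}. if J' = J then of_bool (I' = I) * dz_dzbar I' J' v else 0)"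
    by (intro sum.cong refl) auto
  also have "\<dots> = (\<Sum>I'\<in>{I. length I = p}. if I' = I then dz_dzbar I' J v else 0)"
    using assms by (intro sum.cong refl) (simp add: finite_multi_indices)
  also have "\<dots> = dz_dzbar I J v"
    using assms by (simp add: finite_multi_indices)
  finally show "dz_dzbar I J v =
    (\<Sum>I'\<in>{I. length I = p}. \<Sum>J'\<in>{J. length J = q}. of_bool (I' = I \<and> J' = J) * dz_dzbar I' J' v)" ..
qed

lemma bidegree_alt_0: "bidegree_alt p q (\<lambda>_. 0)"
  unfolding bidegree_alt_def by (rule exI[of _ "\<lambda>_ _. 0"]) simp

lemma bidegree_alt_add:
  assumes "bidegree_alt p q L" "bidegree_alt p q M"
  shows "bidegree_alt p q (\<lambda>v. L v + M v)"
proof -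
  obtain f g where "\<And>v. L v = (\<Sum>I | length I = p. \<Sum>J | length J = q. f I J * dz_dzbar I J v)"
    "\<And>v. M v = (\<Sum>I | length I = p. \<Sum>J | length J = q. g I J * dz_dzbar I J v)"
    using assms unfolding bidegree_alt_def by blast
  then show ?thesis
    unfolding bidegree_alt_def
    by (intro exI[of _ "\<lambda>I J. f I J + g I J"]) (simp add: sum.distrib distrib_right)
qed

lemma bidegree_alt_cmult:
  assumes "bidegree_alt p q L"
  shows "bidegree_alt p q (\<lambda>v. c * L v)"
proof -
  obtain f where "\<And>v. L v = (\<Sum>I | length I = p. \<Sum>J | length J = q. f I J * dz_dzbar I J v)"
    using assms unfolding bidegree_alt_def by blast
  then show ?thesis
    unfolding bidegree_alt_def
    by (intro exI[of _ "\<lambda>I J. c * f I J"]) (simp add: sum_distrib_left mult.assoc)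
qed

lemma bidegree_alt_sum:
  "(\<And>i. i \<in> A \<Longrightarrow> bidegree_alt p q (L i)) \<Longrightarrow> bidegree_alt p q (\<lambda>v. \<Sum>i\<in>A. L i v)"
  by (induction A rule: infinite_finite_induct) (auto intro: bidegree_alt_0 bidegree_alt_add)

lemma bidegree_alt_wedge:
  assumes "bidegree_alt p q L" "bidegree_alt p' q' M"
  shows "bidegree_alt (p + p') (q + q') (wedge_alt L M)"
proof -
  obtain f where f: "L = (\<lambda>v. \<Sum>I | length I = p. \<Sum>J | length J = q. f I J * dz_dzbar I J v)"
    using assms(1) unfolding bidegree_alt_def fun_eq_iff by blast
  obtain g where g: "M = (\<lambda>v. \<Sum>I | length I = p'. \<Sum>J | length J = q'. g I J * dz_dzbar I J v)"
    using assms(2) unfolding bidegree_alt_def fun_eq_iff by blast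
  have basic: "bidegree_alt (p + p') (q + q') (\<lambda>v. wedge_alt (dz_dzbar I J) (dz_dzbar I' J') v)"
    if "length I = p" "length J = q" "length I' = p'" "length J' = q'" for I J I' J'
  proof -
    obtain \<epsilon> where "\<And>v. wedge_alt (dz_dzbar I J) (dz_dzbar I' J') v = \<epsilon> * dz_dzbar (I @ I') (J @ J') v"
      by (rule wedge_dz_dzbar) blast
    then show ?thesis
      using that by (simp add: bidegree_alt_cmult bidegree_alt_dz_dzbar)
  qed
  have "bidegree_alt (p + p') (q + q') (\<lambda>v. wedge_alt L M v)"
    unfolding f g wedge_alt_sum_left wedge_alt_sum_right wedge_alt_cmult_left wedge_alt_cmult_right
    by (intro bidegree_alt_sum bidegree_alt_cmult basic) auto
  then show ?thesis by simp
qed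

lemma bidegree_alt_degree:
  assumes "bidegree_alt p q L" "length v \<noteq> p + q"
  shows "L v = 0"
proof -
  have "dz_dzbar I J v = 0" if "length I = p" "length J = q" for I J
    using that assms(2) by (simp add: dz_dzbar_covec_det covec_det_def)
  then show ?thesis
    using assms(1) unfolding bidegree_alt_def by auto
qed

text \<open>On the unit circle this says that bidegree \<open>(p, q)\<close> has weight \<open>p - q\<close>. Together with the degree,
  the weight determines the bidegree, and it is easier to follow through the operators.\<close>

lemma bidegree_alt_scale:
  assumes "bidegree_alt p q L"
  shows "L (map ((*s) c) v) = c ^ p * cnj c ^ q * L v"
proof -
  have dz: "dz j (map ((*s) c) w) = c * dz j w" "dzbar j (map ((*s) c) w) = cnj c * dzbar j w"
    for j and w :: "(complex^'a) list"
    by (auto simp: dz_def dzbar_def split: list.split)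
  have zb: "foldr wedge_alt (map dzbar J) unit_alt (map ((*s) c) w) =
      cnj c ^ length J * foldr wedge_alt (map dzbar J) unit_alt w" for J :: "'a list" and w
    by (induction J arbitrary: w)
      (simp_all add: unit_alt_def wedge_alt_map dz wedge_alt_cmult_left wedge_alt_cmult_right)
  have "dz_dzbar I J (map ((*s) c) w) = c ^ length I * cnj c ^ length J * dz_dzbar I J w"
    for I J :: "'a list" and w
    unfolding dz_dzbar_def foldr_append
    by (induction I arbitrary: w)
      (simp_all add: zb wedge_alt_map dz wedge_alt_cmult_left wedge_alt_cmult_right mult.assoc)
  then show ?thesis
    using assms unfolding bidegree_alt_def
    by (auto simp: sum_distrib_left mult_ac intro!: sum.cong)
qed

section \<open>Charts and smooth forms\<close>

lemma complex_atlasD: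
  assumes "complex_atlas A" "c \<in> A"
  shows "open (fst c)" "open (chart_image c)"
    "homeomorphism (fst c) (chart_image c) (snd c) (inv_into (fst c) (snd c))"
  using assms by (auto simp: complex_atlas_def)

lemma open_overlap:
  assumes A: "complex_atlas A" and "c \<in> A" "d \<in> A"
  shows "open (overlap c d)"
proof -
  have "openin (top_of_set (fst c)) (fst c \<inter> fst d)"
    using complex_atlasD(1)[OF A] assms by (metis openin_open_Int)
  then have "openin (top_of_set (chart_image c)) (snd c ` (fst c \<inter> fst d))"
    by (rule homeomorphism_imp_open_map[OF complex_atlasD(3)[OF A \<open>c \<in> A\<close>]])
  then show ?thesis
    using complex_atlasD(2)[OF A \<open>c \<in> A\<close>] openin_open_trans by (auto simp: overlap_def)
qed

lemma overlap_subset: "overlap c d \<subseteq> chart_image c"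
  by (auto simp: overlap_def chart_image_def)

lemma chart_inverse:
  assumes A: "complex_atlas A" and "c \<in> A"
  shows "q \<in> fst c \<Longrightarrow> inv_into (fst c) (snd c) (snd c q) = q"
    and "x \<in> chart_image c \<Longrightarrow> inv_into (fst c) (snd c) x \<in> fst c"
    and "x \<in> chart_image c \<Longrightarrow> snd c (inv_into (fst c) (snd c) x) = x"
  using complex_atlasD(3)[OF A \<open>c \<in> A\<close>] by (auto simp: homeomorphism_def)

lemma overlapI: "q \<in> fst c \<Longrightarrow> q \<in> fst d \<Longrightarrow> snd c q \<in> overlap c d"
  by (auto simp: overlap_def)

lemma overlapE:
  assumes A: "complex_atlas A" and "c \<in> A" and "x \<in> overlap c d"
  obtains q where "q \<in> fst c" "q \<in> fst d" "x = snd c q" "inv_into (fst c) (snd c) x = q"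
    "transition c d x = snd d q"
  using assms chart_inverse(1)[OF A \<open>c \<in> A\<close>] unfolding overlap_def transition_def by force

lemma transition_in_overlap:
  assumes "complex_atlas A" "c \<in> A" "x \<in> overlap c d"
  shows "transition c d x \<in> overlap d c"
  using overlapE[OF assms] by (metis IntI image_eqI overlap_def)

lemma transition_in_chart_image:
  assumes "complex_atlas A" "c \<in> A" "x \<in> overlap c d"
  shows "transition c d x \<in> chart_image d"
  using transition_in_overlap[OF assms] overlap_subset by blast

lemma transition_derivative:
  assumes A: "complex_atlas A" "c \<in> A" "d \<in> A" "x \<in> overlap c d"
  defines "T \<equiv> frechet_derivative (transition c d) (at x)"
  shows "(transition c d has_derivative T) (at x)" "linear T" "T (a *s u) = a *s T u"
proof -
  have h: "holomorphic_map_on (overlap c d) (transition c d)"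
    using A by (auto simp: complex_atlas_def)
  then show T: "(transition c d has_derivative T) (at x)"
    using smooth_on_differentiable[of "overlap c d" "transition c d" x] A(4)
    by (simp add: holomorphic_map_on_def T_def frechet_derivative_works[symmetric])
  then show "linear T" by (rule has_derivative_linear)
  show "T (a *s u) = a *s T u"
    using h A(4) by (simp add: holomorphic_map_on_def T_def)
qed

lemma smooth_formsI:
  assumes "\<And>c x v. c \<notin> A \<or> x \<notin> chart_image c \<Longrightarrow> \<alpha> c x v = 0"
    and "\<And>c x. c \<in> A \<Longrightarrow> x \<in> chart_image c \<Longrightarrow> alternating (\<alpha> c x)"
    and "\<And>c v. c \<in> A \<Longrightarrow> smooth_on (chart_image c) (\<lambda>x. \<alpha> c x v)"
    and "\<And>c d x v. c \<in> A \<Longrightarrow> d \<in> A \<Longrightarrow> x \<in> overlap c d \<Longrightarrow>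
        \<alpha> c x v = \<alpha> d (transition c d x) (map (frechet_derivative (transition c d) (at x)) v)"
  shows "\<alpha> \<in> smooth_forms A"
  using assms unfolding smooth_forms_def by blast

lemma smooth_formsD:
  assumes "\<alpha> \<in> smooth_forms A"
  shows "c \<notin> A \<or> x \<notin> chart_image c \<Longrightarrow> \<alpha> c x v = 0"
    and "c \<in> A \<Longrightarrow> x \<in> chart_image c \<Longrightarrow> alternating (\<alpha> c x)"
    and "c \<in> A \<Longrightarrow> smooth_on (chart_image c) (\<lambda>x. \<alpha> c x v)"
    and "c \<in> A \<Longrightarrow> d \<in> A \<Longrightarrow> x \<in> overlap c d \<Longrightarrow>
        \<alpha> c x v = \<alpha> d (transition c d x) (map (frechet_derivative (transition c d) (at x)) v)"
  using assms unfolding smooth_forms_def by blast+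

lemma smooth_forms_differentiable:
  "\<alpha> \<in> smooth_forms A \<Longrightarrow> c \<in> A \<Longrightarrow> x \<in> chart_image c \<Longrightarrow> (\<lambda>y. \<alpha> c y v) differentiable (at x)"
  using smooth_formsD(3) smooth_on_differentiable by blast

lemma smooth_forms_zero: "0 \<in> smooth_forms A"
  by (rule smooth_formsI) (auto simp: alternating_def linear_iff)

lemma smooth_forms_add:
  assumes A: "complex_atlas A" and \<alpha>: "\<alpha> \<in> smooth_forms A" and \<beta>: "\<beta> \<in> smooth_forms A"
  shows "\<alpha> + \<beta> \<in> smooth_forms A"
proof (rule smooth_formsI)
  fix c d x v assume cd: "c \<in> A" "d \<in> A" "x \<in> overlap c d"
  show "(\<alpha> + \<beta>) c x v = (\<alpha> + \<beta>) d (transition c d x) (map (frechet_derivative (transition c d) (at x)) v)"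
    unfolding plus_fun_apply smooth_formsD(4)[OF \<alpha> cd, symmetric] smooth_formsD(4)[OF \<beta> cd, symmetric] ..
next
  fix c x assume "c \<in> A" "x \<in> chart_image c"
  then show "alternating ((\<alpha> + \<beta>) c x)"
    using smooth_formsD(2)[OF \<alpha>, of c x] smooth_formsD(2)[OF \<beta>, of c x]
    unfolding alternating_def plus_fun_apply by (auto intro: linear_compose_add)
qed (use smooth_formsD(1,3)[OF \<alpha>] smooth_formsD(1,3)[OF \<beta>] complex_atlasD(2)[OF A] in
    \<open>auto intro: smooth_on_add\<close>)

lemma smooth_forms_cmult:
  assumes A: "complex_atlas A" and \<alpha>: "\<alpha> \<in> smooth_forms A"
  shows "(\<lambda>c x v. k * \<alpha> c x v) \<in> smooth_forms A"
proof (rule smooth_formsI)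
  fix c d x v assume "c \<in> A" "d \<in> A" "x \<in> overlap c d"
  then show "k * \<alpha> c x v = k * \<alpha> d (transition c d x) (map (frechet_derivative (transition c d) (at x)) v)"
    using smooth_formsD(4)[OF \<alpha>] by metis
qed (use smooth_formsD(1-3)[OF \<alpha>] complex_atlasD(2)[OF A] in
    \<open>auto intro: alternating_cmult smooth_on_cmult\<close>)

lemma alternating_cnj: "alternating L \<Longrightarrow> alternating (\<lambda>v. cnj (L v))"
  unfolding alternating_def by (auto simp: linear_iff)

lemma smooth_forms_conj:
  assumes A: "complex_atlas A" and \<alpha>: "\<alpha> \<in> smooth_forms A"
  shows "conj_form \<alpha> \<in> smooth_forms A"
proof (rule smooth_formsI)
  fix c d x v assume "c \<in> A" "d \<in> A" "x \<in> overlap c d"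
  then show "conj_form \<alpha> c x v =
      conj_form \<alpha> d (transition c d x) (map (frechet_derivative (transition c d) (at x)) v)"
    using smooth_formsD(4)[OF \<alpha>] unfolding conj_form_def by metis
next
  fix c x assume "c \<in> A" "x \<in> chart_image c"
  then show "alternating (conj_form \<alpha> c x)"
    using alternating_cnj[OF smooth_formsD(2)[OF \<alpha>]] unfolding conj_form_def[abs_def] by blast
qed (use smooth_formsD(1,3)[OF \<alpha>] complex_atlasD(2)[OF A] in
    \<open>auto simp: conj_form_def intro: smooth_on_cnj\<close>)

lemma smooth_forms_wedge:
  assumes A: "complex_atlas A" and \<alpha>: "\<alpha> \<in> smooth_forms A" and \<beta>: "\<beta> \<in> smooth_forms A"
  shows "(\<lambda>c x. wedge_alt (\<alpha> c x) (\<beta> c x)) \<in> smooth_forms A"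
proof (rule smooth_formsI)
  fix c d x v assume cd: "c \<in> A" "d \<in> A" "x \<in> overlap c d"
  show "wedge_alt (\<alpha> c x) (\<beta> c x) v =
      wedge_alt (\<alpha> d (transition c d x)) (\<beta> d (transition c d x))
        (map (frechet_derivative (transition c d) (at x)) v)"
    unfolding wedge_alt_map smooth_formsD(4)[OF \<alpha> cd, symmetric] smooth_formsD(4)[OF \<beta> cd, symmetric] ..
next
  fix c v assume c: "c \<in> A"
  note op = complex_atlasD(2)[OF A c]
  show "smooth_on (chart_image c) (\<lambda>x. wedge_alt (\<alpha> c x) (\<beta> c x) v)"
    unfolding wedge_alt_def
    by (intro smooth_on_sum[OF op] smooth_on_mult[OF op] smooth_on_const smooth_formsD(3)[OF \<alpha> c]
        smooth_formsD(3)[OF \<beta> c])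
next
  fix c x v assume "c \<notin> A \<or> x \<notin> chart_image c"
  then show "wedge_alt (\<alpha> c x) (\<beta> c x) v = 0"
    using smooth_formsD(1)[OF \<alpha>] by (simp add: wedge_alt_def)
qed (use smooth_formsD(2)[OF \<alpha>] smooth_formsD(2)[OF \<beta>] in \<open>auto intro: alternating_wedge\<close>)

lemma smooth_forms_unit:
  fixes A :: "('a::t2_space, 'n::finite) chart set"
  assumes A: "complex_atlas A"
  shows "wedge_power A \<omega> 0 \<in> smooth_forms A"
proof (rule smooth_formsI)
  fix c d x and v :: "(complex^'n) list" assume cd: "c \<in> A" "d \<in> A" "x \<in> overlap c d"
  then show "wedge_power A \<omega> 0 c x v =
      wedge_power A \<omega> 0 d (transition c d x) (map (frechet_derivative (transition c d) (at x)) v)"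
    using transition_in_chart_image[OF A cd(1,3)] subsetD[OF overlap_subset cd(3)] by (simp add: unit_alt_def)
next
  fix c and v :: "(complex^'n) list" assume c: "c \<in> A"
  have "smooth_on (chart_image c) (\<lambda>x. unit_alt v)" by simp
  then show "smooth_on (chart_image c) (\<lambda>x. wedge_power A \<omega> 0 c x v)"
    by (rule smooth_on_cong[OF complex_atlasD(2)[OF A c], THEN iffD1, rotated]) (use c in auto)
next
  fix c x assume "c \<in> A" "x \<in> chart_image c"
  moreover have "alternating (unit_alt :: 'n altform)"
    unfolding alternating_def unit_alt_def by (auto simp: linear_iff)
  ultimately show "alternating (wedge_power A \<omega> 0 c x)"
    by (simp cong: if_cong)
qed auto

lemma wedge_power_pq:
  assumes A: "complex_atlas A" and \<omega>: "\<omega> \<in> pq_forms A 1 1"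
  shows "wedge_power A \<omega> k \<in> pq_forms A k k"
proof (induction k)
  case 0
  have "bidegree_alt 0 0 (unit_alt :: 'b altform)"
    using bidegree_alt_dz_dzbar[of "[] :: 'b list" 0 "[]" 0] by (simp add: dz_dzbar_def)
  then show ?case
    using smooth_forms_unit[OF A] by (simp add: pq_forms_def)
next
  case (Suc k)
  have "bidegree_alt (1 + k) (1 + k) (wedge_alt (\<omega> c x) (wedge_power A \<omega> k c x))"
    if "c \<in> A" "x \<in> chart_image c" for c x
    using Suc \<omega> that by (intro bidegree_alt_wedge) (auto simp: pq_forms_def)
  then show ?case
    using smooth_forms_wedge[OF A, of \<omega> "wedge_power A \<omega> k"] Suc \<omega> by (simp add: pq_forms_def)
qed

section \<open>Conjugation\<close>

lemma covec_det_pair: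
  "covec_det [f, g] v = (case v of [u, w] \<Rightarrow> f u * g w - f w * g u | _ \<Rightarrow> 0)"
proof (cases "length v = 2")
  case True
  then obtain u w where v: "v = [u, w]"
    by (auto simp: length_Suc_conv numeral_2_eq_2)
  have "{..<2} = {0, 1::nat}" by auto
  then have "{\<sigma>. \<sigma> permutes {..<2::nat}} = {id, Transposition.transpose 0 1}"
    by (auto simp: permutes_doubleton_iff)
  moreover have "id \<noteq> (Transposition.transpose 0 1 :: nat \<Rightarrow> nat)"
    by (metis id_apply transpose_apply_first zero_neq_one)
  ultimately show ?thesis
    by (simp add: covec_det_def alternator_def v permute_list_def sign_swap_id numeral_2_eq_2[symmetric])
      (simp add: numeral_2_eq_2 lessThan_Suc mult.commute)
next
  case False
  then show ?thesis
    by (auto simp: covec_det_def split: list.split)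
qed

lemma wedge_dz_dzbar_pair:
  "wedge_alt (dz j) (dzbar k) v = (case v of [u, w] \<Rightarrow> u $ j * cnj (w $ k) - w $ j * cnj (u $ k) | _ \<Rightarrow> 0)"
proof -
  have "dz j = covec_det [\<lambda>u. u $ j]" "dzbar k = covec_det [\<lambda>u. cnj (u $ k)]"
    by (auto simp: fun_eq_iff dz_def dzbar_def covec_det_single)
  then show ?thesis
    by (simp add: wedge_covec_det covec_det_pair)
qed

text \<open>Conjugation turns \<open>dz j \<and> dzbar k\<close> into minus \<open>dz k \<and> dzbar j\<close>; the sign is compensated by the
  factor \<open>\<i>\<close> and the exchange of indices by the Hermitian symmetry of the coefficients.\<close>

lemma positive_definite_11_real:
  assumes "positive_definite_11 L"
  shows "cnj (L v) = L v"
proof -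
  obtain h where h: "\<And>j k. h $ k $ j = cnj (h $ j $ k)"
    and L: "\<And>v. L v = \<i> * (\<Sum>j\<in>UNIV. \<Sum>k\<in>UNIV. h $ j $ k * wedge_alt (dz j) (dzbar k) v)"
    using assms unfolding positive_definite_11_def by blast
  have w: "cnj (wedge_alt (dz j) (dzbar k) v) = - wedge_alt (dz k) (dzbar j) v" for j k :: 'a
    by (auto simp: wedge_dz_dzbar_pair split: list.split)
  have "cnj (L v) = - \<i> * (\<Sum>j\<in>UNIV. \<Sum>k\<in>UNIV. - (h $ k $ j * wedge_alt (dz k) (dzbar j) v))"
    unfolding L complex_cnj_mult cnj_sum w h[symmetric] by (simp add: sum_negf)
  also have "\<dots> = L v"
    unfolding L by (subst sum.swap) (simp add: sum_negf)
  finally show ?thesis .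
qed

lemma hermitian_metric_real:
  assumes "hermitian_metric A \<omega>"
  shows "conj_form \<omega> = \<omega>"
proof (intro ext)
  fix c x v
  show "conj_form \<omega> c x v = \<omega> c x v"
    using assms positive_definite_11_real[of "\<omega> c x"] smooth_formsD(1)[of \<omega> A c x v]
    by (cases "c \<in> A \<and> x \<in> chart_image c") (auto simp: conj_form_def hermitian_metric_def pq_forms_def)
qed

lemma wedge_power_real:
  assumes "conj_form \<omega> = \<omega>"
  shows "conj_form (wedge_power A \<omega> k) = wedge_power A \<omega> k"
proof (induction k)
  case 0
  show ?case by (simp add: fun_eq_iff conj_form_def unit_alt_def)
next
  case (Suc k)
  have "cnj (\<omega> c x v) = \<omega> c x v" "cnj (wedge_power A \<omega> k c x v) = wedge_power A \<omega> k c x v" for c x v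
    using assms Suc by (metis conj_form_def)+
  then show ?case
    by (simp add: fun_eq_iff conj_form_def wedge_alt_cnj[symmetric])
qed

lemma diff_cnj:
  assumes "f differentiable (at x)"
  shows "diff01 (\<lambda>y. cnj (f y)) x u = cnj (diff10 f x u)"
    and "diff10 (\<lambda>y. cnj (f y)) x u = cnj (diff01 f x u)"
  unfolding diff01_def diff10_def frechet_derivative_bounded_linear_comp[OF bounded_linear_cnj assms]
  by simp_all

lemma conj_del:
  assumes "\<alpha> \<in> smooth_forms A"
  shows "conj_form (del A \<alpha>) = delbar A (conj_form \<alpha>)"
    and "conj_form (delbar A \<alpha>) = del A (conj_form \<alpha>)"
  using smooth_forms_differentiable[OF assms]
  by (auto simp: fun_eq_iff conj_form_def del_def delbar_def ext_deriv_def diff_cnj[OF smooth_forms_differentiable[OF assms]])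

section \<open>Strongly Gauduchon metrics\<close>

text \<open>The first of the two equations of closedness is the definition of a strongly Gauduchon metric; the
  second is its complex conjugate, because powers of a metric are real.\<close>

lemma strongly_Gauduchon_iff:
  fixes A :: "('a::t2_space, 'n::finite) chart set"
  assumes A: "complex_atlas A" and \<omega>: "hermitian_metric A \<omega>"
  defines "n \<equiv> CARD('n)"
  shows "strongly_Gauduchon A \<omega> \<longleftrightarrow> wedge_power A \<omega> (n - 1) \<in> Er_closed A 2 (n - 1) (n - 1)"
proof
  let ?\<Omega> = "wedge_power A \<omega> (n - 1)"
  have pq: "?\<Omega> \<in> pq_forms A (n - 1) (n - 1)"
    using wedge_power_pq[OF A] \<omega> by (simp add: hermitian_metric_def)
  then have sm: "?\<Omega> \<in> smooth_forms A" by (simp add: pq_forms_def)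
  assume "strongly_Gauduchon A \<omega>"
  then obtain \<beta> where \<beta>: "\<beta> \<in> smooth_forms A" "del A ?\<Omega> = delbar A \<beta>"
    unfolding strongly_Gauduchon_def n_def by blast
  have conj: "delbar A ?\<Omega> = del A (conj_form \<beta>)"
    using conj_del(1)[OF sm] conj_del(2)[OF \<beta>(1)] \<beta>(2)
      wedge_power_real[OF hermitian_metric_real[OF \<omega>], of A "n - 1"] by simp
  have "\<exists>\<eta>. \<eta> 0 = ?\<Omega> \<and> (\<forall>l<2. \<eta> l \<in> smooth_forms A) \<and>
      (\<forall>l<2 - 1. del A (\<eta> l) = delbar A (\<eta> (Suc l)))"
    using \<beta> sm by (intro exI[of _ "\<lambda>l. if l = 0 then ?\<Omega> else \<beta>"]) auto
  moreover have "\<exists>\<rho>. \<rho> 0 = ?\<Omega> \<and> (\<forall>l<2. \<rho> l \<in> smooth_forms A) \<and>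
      (\<forall>l<2 - 1. delbar A (\<rho> l) = del A (\<rho> (Suc l)))"
    using conj sm smooth_forms_conj[OF A \<beta>(1)]
    by (intro exI[of _ "\<lambda>l. if l = 0 then ?\<Omega> else conj_form \<beta>"]) auto
  ultimately show "?\<Omega> \<in> Er_closed A 2 (n - 1) (n - 1)"
    using pq unfolding Er_closed_def by blast
next
  assume "wedge_power A \<omega> (n - 1) \<in> Er_closed A 2 (n - 1) (n - 1)"
  then obtain \<eta> where "\<eta> 0 = wedge_power A \<omega> (n - 1)" "\<forall>l<2. \<eta> l \<in> smooth_forms A"
    "\<forall>l<2 - 1. del A (\<eta> l) = delbar A (\<eta> (Suc l))"
    unfolding Er_closed_def by blast
  then show "strongly_Gauduchon A \<omega>"
    unfolding strongly_Gauduchon_def n_def[symmetric]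
    by (intro bexI[of _ "\<eta> 1"]) auto
qed

section \<open>The operators and the circle action\<close>

lemma diff_vector_scale:
  assumes "f differentiable (at x)"
  shows "diff10 f x (c *s u) = c * diff10 f x u" and "diff01 f x (c *s u) = cnj c * diff01 f x u"
proof -
  let ?D = "frechet_derivative f (at x)"
  note lin = linear_frechet_derivative[OF assms]
  have dec: "c *s w = Re c *\<^sub>R w + Im c *\<^sub>R (\<i> *s w)" for w :: "complex^'a"
    by (simp add: vec_eq_iff complex_eq_iff)
  have D: "?D (c *s w) = Re c *\<^sub>R ?D w + Im c *\<^sub>R ?D (\<i> *s w)" for w
    using arg_cong[OF dec[of w], of ?D] by (simp only: linear_add[OF lin] linear_cmul[OF lin])
  have "\<i> *s (c *s u) = Re c *\<^sub>R (\<i> *s u) + (- Im c) *\<^sub>R u"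
    by (simp add: vec_eq_iff complex_eq_iff)
  then have D': "?D (\<i> *s (c *s u)) = Re c *\<^sub>R ?D (\<i> *s u) + (- Im c) *\<^sub>R ?D u"
    by (simp only: linear_add[OF lin] linear_cmul[OF lin])
  show "diff10 f x (c *s u) = c * diff10 f x u" "diff01 f x (c *s u) = cnj c * diff01 f x u"
    unfolding diff10_def diff01_def D D'
    by (auto simp: complex_eq_iff field_simps)
qed

lemma diff_add:
  assumes "f differentiable (at x)" "g differentiable (at x)"
  shows "diff10 (\<lambda>y. f y + g y) x u = diff10 f x u + diff10 g x u"
    and "diff01 (\<lambda>y. f y + g y) x u = diff01 f x u + diff01 g x u"
  unfolding diff10_def diff01_def frechet_derivative_add[OF assms]
  by (simp_all add: add_divide_distrib diff_divide_distrib algebra_simps)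

lemma diff_cmult:
  assumes "f differentiable (at x)"
  shows "diff10 (\<lambda>y. k * f y) x u = k * diff10 f x u"
    and "diff01 (\<lambda>y. k * f y) x u = k * diff01 f x u"
  unfolding diff10_def diff01_def
    frechet_derivative_bounded_linear_comp[OF bounded_linear_mult_right assms]
  by (simp_all add: field_simps)

lemma diff_const: "diff10 (\<lambda>y. k) x u = 0" "diff01 (\<lambda>y. k) x u = 0"
  unfolding diff10_def diff01_def by (simp_all add: frechet_derivative_const)

lemma diff_cong_open:
  assumes "open S" "x \<in> S" "\<And>y. y \<in> S \<Longrightarrow> f y = g y"
  shows "diff10 f x u = diff10 g x u" "diff01 f x u = diff01 g x u"
proof -
  have "frechet_derivative f (at x) = frechet_derivative g (at x)"
    using assms by (rule frechet_derivative_cong_open)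
  then show "diff10 f x u = diff10 g x u" "diff01 f x u = diff01 g x u"
    by (simp_all add: diff10_def diff01_def)
qed

lemma d_op_eq: "d_op A \<alpha> = del A \<alpha> + delbar A \<alpha>"
  by (auto simp: fun_eq_iff d_op_def del_def delbar_def ext_deriv_def sum.distrib[symmetric]
      distrib_left[symmetric] diff10_def diff01_def add_divide_distrib[symmetric] intro!: sum.cong)

lemma del_apply:
  assumes "c \<in> A" "x \<in> chart_image c"
  shows "del A \<alpha> c x v = (\<Sum>i<length v. (-1)^i * diff10 (\<lambda>y. \<alpha> c y (take i v @ drop (Suc i) v)) x (v ! i))"
    and "delbar A \<alpha> c x v = (\<Sum>i<length v. (-1)^i * diff01 (\<lambda>y. \<alpha> c y (take i v @ drop (Suc i) v)) x (v ! i))"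
  using assms by (simp_all add: del_def delbar_def ext_deriv_def)

lemma del_outside:
  assumes "c \<notin> A \<or> x \<notin> chart_image c"
  shows "del A \<alpha> c x v = 0" "delbar A \<alpha> c x v = 0"
  using assms by (auto simp: del_def delbar_def ext_deriv_def)

lemma del_add:
  assumes "\<alpha> \<in> smooth_forms A" "\<beta> \<in> smooth_forms A"
  shows "del A (\<alpha> + \<beta>) = del A \<alpha> + del A \<beta>" "delbar A (\<alpha> + \<beta>) = delbar A \<alpha> + delbar A \<beta>"
  by (auto simp: fun_eq_iff del_def delbar_def ext_deriv_def sum.distrib[symmetric]
      distrib_left[symmetric] diff_add smooth_forms_differentiable[OF assms(1)]
      smooth_forms_differentiable[OF assms(2)])

lemma del_cmult:
  assumes "\<alpha> \<in> smooth_forms A"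
  shows "del A (\<lambda>c x v. k * \<alpha> c x v) = (\<lambda>c x v. k * del A \<alpha> c x v)"
    and "delbar A (\<lambda>c x v. k * \<alpha> c x v) = (\<lambda>c x v. k * delbar A \<alpha> c x v)"
  by (auto simp: fun_eq_iff del_def delbar_def ext_deriv_def sum_distrib_left mult.left_commute
      diff_cmult[OF smooth_forms_differentiable[OF assms]])

text \<open>Multiplying all argument vectors by one complex number of modulus one is an action of the circle
  on forms, whose weight spaces in a fixed degree are the bidegrees. The operator \<open>del\<close> raises the
  weight by one and \<open>delbar\<close> lowers it by one.\<close>

lemma del_scale:
  assumes \<alpha>: "\<alpha> \<in> smooth_forms A"
  shows "del A \<alpha> c x (map ((*s) z) v) = z * del A (\<lambda>c y w. \<alpha> c y (map ((*s) z) w)) c x v"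
    and "delbar A \<alpha> c x (map ((*s) z) v) = cnj z * delbar A (\<lambda>c y w. \<alpha> c y (map ((*s) z) w)) c x v"
  by (cases "c \<in> A \<and> x \<in> chart_image c";
      auto simp: del_apply del_outside take_map drop_map sum_distrib_left mult_ac
        diff_vector_scale smooth_forms_differentiable[OF \<alpha>] simp flip: map_append intro!: sum.cong)+

lemma del_weight:
  assumes \<alpha>: "\<alpha> \<in> smooth_forms A" and z: "\<And>c y w. \<alpha> c y (map ((*s) z) w) = k * \<alpha> c y w"
  shows "del A \<alpha> c x (map ((*s) z) v) = z * k * del A \<alpha> c x v"
    and "delbar A \<alpha> c x (map ((*s) z) v) = cnj z * k * delbar A \<alpha> c x v"
  unfolding del_scale[OF \<alpha>] z del_cmult[OF \<alpha>] by simp_all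

lemma pq_forms_scale:
  assumes "\<alpha> \<in> pq_forms A p q"
  shows "\<alpha> c y (map ((*s) z) w) = z ^ p * cnj z ^ q * \<alpha> c y w"
  using assms bidegree_alt_scale[of p q "\<alpha> c y"] smooth_formsD(1)[of \<alpha> A c y]
  by (cases "c \<in> A \<and> y \<in> chart_image c") (auto simp: pq_forms_def)

lemma pq_forms_degree:
  assumes "\<alpha> \<in> pq_forms A p q" "length w \<noteq> p + q"
  shows "\<alpha> c y w = 0"
  using assms bidegree_alt_degree[of p q "\<alpha> c y"] smooth_formsD(1)[of \<alpha> A c y]
  by (cases "c \<in> A \<and> y \<in> chart_image c") (auto simp: pq_forms_def)

lemma del_degree:
  assumes "\<And>c y w. length w \<noteq> k \<Longrightarrow> \<alpha> c y w = 0" "length v \<noteq> Suc k"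
  shows "del A \<alpha> c x v = 0" "delbar A \<alpha> c x v = 0"
proof -
  have "\<alpha> c y (take i v @ drop (Suc i) v) = 0" if "i < length v" for i c y
    using assms that by (intro assms(1)) auto
  then show "del A \<alpha> c x v = 0" "delbar A \<alpha> c x v = 0"
    by (simp_all add: del_def delbar_def ext_deriv_def diff_const)
qed

lemma cis_quarter_pi_square: "cis (pi / 4) ^ 2 = \<i>"
proof -
  have "pi / 4 + pi / 4 = pi / 2" by simp
  then show ?thesis by (simp only: power2_eq_square cis_mult cis_pi_half)
qed

text \<open>The components of a three-form of types (3,0), (2,1), (1,2) and (0,3) have weights 3, 1, -1 and -3,
  and are therefore independent. It is enough to test with the points 1, \<open>\<i>\<close>, \<open>s\<close> and \<open>\<i> * s\<close>, where
  \<open>s\<close> is a square root of \<open>\<i>\<close>.\<close>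

lemma odd_weights_independent:
  assumes "\<And>z::complex. norm z = 1 \<Longrightarrow> z ^ 3 * a + z * b + cnj z * c + cnj z ^ 3 * d = 0"
  shows "a = 0 \<and> b = 0 \<and> c = 0 \<and> d = 0"
proof -
  have 1: "a + b + c + d = 0"
    using assms[of 1] by simp
  have 2: "- \<i> * a + \<i> * b - \<i> * c + \<i> * d = 0"
    using assms[of \<i>] by (simp add: power3_eq_cube)
  define s where "s = cis (pi / 4)"
  have s2: "s ^ 2 = \<i>" by (simp add: s_def cis_quarter_pi_square)
  have s: "norm s = 1" "cnj s * s = 1"
    by (simp_all add: s_def cis_cnj cis_mult)
  have "s ^ 3 * (s ^ 3 * a + s * b + cnj s * c + cnj s ^ 3 * d) =
     s^2 * s^2 * s^2 * a + s^2 * s^2 * b + s^2 * (cnj s * s) * c + (cnj s * s)^3 * d"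
    by (simp add: algebra_simps power2_eq_square power3_eq_cube)
  then have 3: "- \<i> * a - b + \<i> * c + d = 0"
    using assms[OF s(1)] by (simp add: s2 s(2))
  have "(\<i> * s) ^ 3 * ((\<i> * s) ^ 3 * a + (\<i> * s) * b + cnj (\<i> * s) * c + cnj (\<i> * s) ^ 3 * d) =
     - (s^2 * s^2 * s^2 * a) + s^2 * s^2 * b - s^2 * (cnj s * s) * c + (cnj s * s)^3 * d"
    by (simp add: algebra_simps power2_eq_square power3_eq_cube)
  then have 4: "\<i> * a - b - \<i> * c + d = 0"
    using assms[of "\<i> * s"] s(1) by (simp add: norm_mult s2 s(2))
  have ac: "c = - a" and bd: "d = - b"
    using 1 2 by (auto simp: complex_eq_iff)
  show ?thesis
    using 3 4 unfolding ac bd by (auto simp: complex_eq_iff)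
qed

section \<open>The (2,0)-component of a form\<close>

definition eighth_root :: complex where
  "eighth_root = cis (pi / 4)"

text \<open>In degree two the weights are 2, 0 and -2, so that \<open>eighth_root ^ m\<close> acts as \<open>\<i> ^ m\<close>, 1 and
  \<open>(-\<i>) ^ m\<close> on the three types; averaging against \<open>(-\<i>) ^ m\<close> keeps the first and removes the
  others. Compared with the usual formula in terms of multiplication by \<open>\<i>\<close> in single arguments, this
  average has the advantage that its interaction with the operators follows from \<open>del_scale\<close>.\<close>

definition part20 :: "('a, 'n::finite) form \<Rightarrow> ('a, 'n) form" where
  "part20 \<alpha> c x v = (if length v = 2
     then (\<Sum>m<4. (- \<i>) ^ m / 4 * \<alpha> c x (map ((*s) (eighth_root ^ m)) v)) else 0)"

lemma eighth_root:
  "eighth_root ^ 2 = \<i>" "norm eighth_root = 1" "cnj eighth_root * eighth_root = 1" "eighth_root \<noteq> 0"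
  "eighth_root = (1 + \<i>) / sqrt 2"
proof -
  show "eighth_root = (1 + \<i>) / sqrt 2"
    by (simp add: eighth_root_def complex_eq_iff cos_45 sin_45 real_div_sqrt)
qed (simp_all add: eighth_root_def cis_quarter_pi_square cis_cnj cis_mult)

lemma alternating_two:
  assumes "alternating L"
  shows "L [u + u', w] = L [u, w] + L [u', w]" "L [u, w + w'] = L [u, w] + L [u, w']"
    "L [r *\<^sub>R u, w] = r *\<^sub>R L [u, w]" "L [u, r *\<^sub>R w] = r *\<^sub>R L [u, w]"
    "L [u, u] = 0" "L [w, u] = - L [u, w]"
proof -
  have 1: "linear (\<lambda>u. L [u, w])" for w
    using assms[unfolded alternating_def, THEN conjunct1, rule_format, of 0 "[undefined, w]"] by simp
  have 2: "linear (\<lambda>w. L [u, w])" for u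
    using assms[unfolded alternating_def, THEN conjunct1, rule_format, of 1 "[u, undefined]"] by simp
  show a: "L [u + u', w] = L [u, w] + L [u', w]" "L [u, w + w'] = L [u, w] + L [u, w']" for u u' w w'
    using linear_add[OF 1] linear_add[OF 2] by blast+
  show "L [r *\<^sub>R u, w] = r *\<^sub>R L [u, w]" "L [u, r *\<^sub>R w] = r *\<^sub>R L [u, w]"
    using linear_cmul[OF 1] linear_cmul[OF 2] by blast+
  show z: "L [u, u] = 0" for u
    using assms[unfolded alternating_def, THEN conjunct2, rule_format, of 1 "[u, u]" 0] by simp
  show "L [w, u] = - L [u, w]"
    using a[of u w] z[of "u + w"] z[of u] z[of w] a(2)[of w u w]
    by (simp add: eq_neg_iff_add_eq_0 add.commute)
qed

text \<open>Expanding \<open>eighth_root = (1 + \<i>) / sqrt 2\<close> and its cube \<open>(- 1 + \<i>) / sqrt 2\<close> by real bilinearity.\<close>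

lemma alternating_two_eighth_root:
  assumes "alternating L"
  shows "L [eighth_root *s u, eighth_root *s w] =
      (L [u, w] + L [\<i> *s u, w] + L [u, \<i> *s w] + L [\<i> *s u, \<i> *s w]) / 2"
    and "L [eighth_root ^ 3 *s u, eighth_root ^ 3 *s w] =
      (L [u, w] - L [\<i> *s u, w] - L [u, \<i> *s w] + L [\<i> *s u, \<i> *s w]) / 2"
proof -
  have e3: "eighth_root ^ 3 = (- 1 + \<i>) / sqrt 2"
    using eighth_root(1) by (simp add: power3_eq_cube power2_eq_square eighth_root(5) field_simps)
  have 1: "eighth_root *s u = (1 / sqrt 2) *\<^sub>R (u + \<i> *s u)" for u :: "complex^'a"
    unfolding eighth_root(5) by (simp add: vec_eq_iff) (simp add: scaleR_conv_of_real field_simps)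
  have 3: "eighth_root ^ 3 *s u = (1 / sqrt 2) *\<^sub>R (\<i> *s u + (- 1) *\<^sub>R u)" for u :: "complex^'a"
    unfolding e3 by (simp add: vec_eq_iff) (simp add: scaleR_conv_of_real field_simps)
  have "(1 / sqrt 2) * (1 / sqrt 2) = (1 / 2 :: real)"
    by simp
  then have half: "(1 / sqrt 2) *\<^sub>R ((1 / sqrt 2) *\<^sub>R y) = y / 2" for y :: complex
    by (simp only: scaleR_scaleR) (simp add: scaleR_conv_of_real)
  have h: "L [(1 / sqrt 2) *\<^sub>R a, (1 / sqrt 2) *\<^sub>R b] = L [a, b] / 2" for a b
    unfolding alternating_two(3,4)[OF assms] half ..
  show "L [eighth_root *s u, eighth_root *s w] =
      (L [u, w] + L [\<i> *s u, w] + L [u, \<i> *s w] + L [\<i> *s u, \<i> *s w]) / 2"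
    unfolding 1 h alternating_two(1,2)[OF assms] by (simp add: add_ac)
  show "L [eighth_root ^ 3 *s u, eighth_root ^ 3 *s w] =
      (L [u, w] - L [\<i> *s u, w] - L [u, \<i> *s w] + L [\<i> *s u, \<i> *s w]) / 2"
    unfolding 3 h alternating_two(1-4)[OF assms] by (simp add: algebra_simps)
qed

lemma sum_lessThan_4: "(\<Sum>m<4::nat. f m) = f 0 + f 1 + f 2 + f 3"
  by (simp add: eval_nat_numeral lessThan_Suc add_ac)

text \<open>The right hand side exhibits the complex bilinear part of a real bilinear form.\<close>

lemma part20_pair:
  assumes "alternating (\<alpha> c x)"
  shows "part20 \<alpha> c x [u, w] = (\<alpha> c x [u, w] - \<alpha> c x [\<i> *s u, \<i> *s w]
     - \<i> * (\<alpha> c x [\<i> *s u, w] + \<alpha> c x [u, \<i> *s w])) / 4"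
proof -
  have pw: "(- \<i>) ^ 0 = 1" "(- \<i>) ^ 1 = - \<i>" "(- \<i>) ^ 2 = - 1" "(- \<i>) ^ 3 = \<i>"
    by (simp_all add: power3_eq_cube power2_eq_square)
  have e: "map ((*s) (eighth_root ^ 0)) [u, w] = [u, w]"
    "map ((*s) (eighth_root ^ 1)) [u, w] = [eighth_root *s u, eighth_root *s w]"
    "map ((*s) (eighth_root ^ 2)) [u, w] = [\<i> *s u, \<i> *s w]"
    "map ((*s) (eighth_root ^ 3)) [u, w] = [eighth_root ^ 3 *s u, eighth_root ^ 3 *s w]"
    by (simp_all add: eighth_root(1))
  have "length [u, w] = 2" by simp
  then show ?thesis
    unfolding part20_def if_P sum_lessThan_4 pw e alternating_two_eighth_root[OF assms]
    by (simp add: field_simps)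
qed

lemma part20_complex_bilinear:
  fixes \<alpha> :: "('a, 'b::finite) form"
  assumes L: "alternating (\<alpha> c x)"
  shows "part20 \<alpha> c x [z *s u, w] = z * part20 \<alpha> c x [u, w]"
    and "part20 \<alpha> c x [u, z *s w] = z * part20 \<alpha> c x [u, w]"
    and "part20 \<alpha> c x [u + u', w] = part20 \<alpha> c x [u, w] + part20 \<alpha> c x [u', w]"
    and "part20 \<alpha> c x [u, w + w'] = part20 \<alpha> c x [u, w] + part20 \<alpha> c x [u, w']"
    and "part20 \<alpha> c x [w, u] = - part20 \<alpha> c x [u, w]"
proof -
  let ?P = "\<lambda>u w. part20 \<alpha> c x [u, w]"
  have z: "z *s u = Re z *\<^sub>R u + Im z *\<^sub>R (\<i> *s u)" for u :: "complex^'b"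
    by (simp add: vec_eq_iff complex_eq_iff)
  have ii: "\<i> *s (\<i> *s u) = (- 1) *\<^sub>R u" for u :: "complex^'b"
    by (simp add: vec_eq_iff complex_eq_iff)
  have neg: "\<alpha> c x [- u, w] = - \<alpha> c x [u, w]" "\<alpha> c x [u, - w] = - \<alpha> c x [u, w]" for u w
    using alternating_two(3,4)[OF L, where r="-1"] by simp_all
  show skew: "?P w u = - ?P u w" for u w
  proof -
    have sk: "\<alpha> c x [w, u] = - \<alpha> c x [u, w]" "\<alpha> c x [\<i> *s w, \<i> *s u] = - \<alpha> c x [\<i> *s u, \<i> *s w]"
      "\<alpha> c x [\<i> *s w, u] = - \<alpha> c x [u, \<i> *s w]" "\<alpha> c x [w, \<i> *s u] = - \<alpha> c x [\<i> *s u, w]"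
      by (rule alternating_two(6)[OF L])+
    show ?thesis
      unfolding part20_pair[of \<alpha> c x, OF L] sk by (simp add: field_simps)
  qed
  show add: "?P (u + u') w = ?P u w + ?P u' w" for u u' w
    unfolding part20_pair[of \<alpha> c x, OF L] vector_add_ldistrib alternating_two(1)[OF L] by (simp add: field_simps)
  show "?P u (w + w') = ?P u w + ?P u w'"
    using add[of w w' u] skew by (metis minus_add_distrib)
  have i: "?P (\<i> *s u) w = \<i> * ?P u w" for u w
    unfolding part20_pair[of \<alpha> c x, OF L] ii by (simp add: neg field_simps)
  have r: "?P (r *\<^sub>R u) w = r * ?P u w" for r :: real and u w
  proof -
    have comm: "\<i> *s (r *\<^sub>R u) = r *\<^sub>R (\<i> *s u)"
      by (simp add: vec_eq_iff complex_eq_iff)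
    show ?thesis
      unfolding part20_pair[of \<alpha> c x, OF L] comm alternating_two(3)[OF L]
      by (simp add: scaleR_conv_of_real field_simps)
  qed
  show zz: "?P (z *s u) w = z * ?P u w" for u w
    unfolding z[of u] add r i by (subst (3) complex_eq) (simp add: algebra_simps)
  show "?P u (z *s w) = z * ?P u w"
    using zz[of w u] skew by (metis minus_equation_iff mult_minus_right)
qed

lemma smooth_forms_part20:
  fixes \<alpha> :: "('a::t2_space, 'b::finite) form"
  assumes A: "complex_atlas A" and \<alpha>: "\<alpha> \<in> smooth_forms A"
  shows "part20 \<alpha> \<in> smooth_forms A"
proof (rule smooth_formsI)
  fix c d x v assume cd: "c \<in> A" "d \<in> A" "x \<in> overlap c d"
  let ?T = "frechet_derivative (transition c d) (at x)"
  have "map ((*s) z) (map ?T v) = map ?T (map ((*s) z) v)" for z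
    using transition_derivative(3)[OF A cd] by (simp add: o_def)
  then have "\<alpha> d (transition c d x) (map ((*s) z) (map ?T v)) = \<alpha> c x (map ((*s) z) v)" for z
    using smooth_formsD(4)[OF \<alpha> cd] by (metis (no_types))
  then show "part20 \<alpha> c x v = part20 \<alpha> d (transition c d x) (map ?T v)"
    unfolding part20_def by (simp only: length_map)
next
  fix c x assume c: "c \<in> A" "x \<in> chart_image c"
  note L = smooth_formsD(2)[OF \<alpha> c]
  show "alternating (part20 \<alpha> c x)"
    unfolding alternating_def
  proof (intro conjI allI impI)
    fix v :: "(complex^'b) list" and i assume i: "i < length v"
    show "linear (\<lambda>u. part20 \<alpha> c x (v[i := u]))"
    proof (cases "length v = 2")
      case True
      then obtain u w where v: "v = [u, w]"
        by (auto simp: length_Suc_conv numeral_2_eq_2)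
      have sc: "r *\<^sub>R u = complex_of_real r *s u" for r and u :: "complex^'b"
        by (simp add: vec_eq_iff) (simp add: scaleR_conv_of_real)
      have "linear (\<lambda>u. part20 \<alpha> c x [u, w])" "linear (\<lambda>w. part20 \<alpha> c x [u, w])"
        unfolding linear_iff sc part20_complex_bilinear(1-4)[of \<alpha> c x, OF L]
        by (simp_all add: scaleR_conv_of_real)
      moreover have "i = 0 \<or> i = 1" using i v by auto
      ultimately show ?thesis unfolding v by auto
    qed (simp add: part20_def linear_iff)
  next
    fix v :: "(complex^'b) list" and i j assume ij: "j < length v" "i < j" "v ! i = v ! j"
    show "part20 \<alpha> c x v = 0"
    proof (cases "length v = 2")
      case True
      then obtain u w where v: "v = [u, w]"
        by (auto simp: length_Suc_conv numeral_2_eq_2)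
      then have "u = w" using ij by (auto simp: less_Suc_eq)
      then show ?thesis
        using part20_complex_bilinear(5)[of \<alpha> c x u u, OF L] v by simp
    qed (simp add: part20_def)
  qed
next
  fix c v assume c: "c \<in> A"
  note op = complex_atlasD(2)[OF A c]
  show "smooth_on (chart_image c) (\<lambda>x. part20 \<alpha> c x v)"
  proof (cases "length v = 2")
    case True
    show ?thesis
      unfolding part20_def if_P[OF True]
      by (intro smooth_on_sum[OF op] smooth_on_cmult[OF op] smooth_formsD(3)[OF \<alpha> c])
  qed (simp add: part20_def)
qed (auto simp: part20_def smooth_formsD(1)[OF \<alpha>])

lemma complex_linear_expansion:
  fixes f :: "complex^'n::finite \<Rightarrow> complex"
  assumes "\<And>u w. f (u + w) = f u + f w" "\<And>c u. f (c *s u) = \<phi> c * f u"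
  shows "f u = (\<Sum>j\<in>UNIV. \<phi> (u $ j) * f (axis j 1))"
proof -
  have f0: "f 0 = 0" using assms(1)[of 0 0] by simp
  have "f (\<Sum>j\<in>J. u $ j *s axis j 1) = (\<Sum>j\<in>J. \<phi> (u $ j) * f (axis j 1))" for J
    by (induction J rule: infinite_finite_induct) (simp_all add: f0 assms)
  from this[of UNIV] show ?thesis
    by (simp add: basis_expansion)
qed

text \<open>The coordinate expansion of the form. The multi-indices \<open>[j, k]\<close> and \<open>[k, j]\<close> both occur in the sum,
  hence the factor one half in the coefficients.\<close>

lemma bidegree_alt_02:
  fixes M :: "'n::finite altform"
  assumes deg: "\<And>v. length v \<noteq> 2 \<Longrightarrow> M v = 0"
    and add: "\<And>u u' w. M [u + u', w] = M [u, w] + M [u', w]"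
    and scale: "\<And>z u w. M [z *s u, w] = cnj z * M [u, w]"
    and skew: "\<And>u w. M [w, u] = - M [u, w]"
  shows "bidegree_alt 0 2 M"
  unfolding bidegree_alt_def
proof (intro exI allI)
  fix v
  let ?f = "\<lambda>I J. M [axis (J ! 0) 1, axis (J ! 1) 1] / 2"
  have dzb: "dz_dzbar [] [j, k] = covec_det [\<lambda>u. cnj (u $ j), \<lambda>u. cnj (u $ k)]" for j k :: 'n
    by (simp add: dz_dzbar_covec_det)
  have lists: "{J :: 'n list. length J = 2} = (\<lambda>(j, k). [j, k]) ` UNIV"
    by (auto simp: length_Suc_conv numeral_2_eq_2)
  have inj: "inj (\<lambda>(j, k). [j, k :: 'n])"
    by (auto simp: inj_on_def)
  have "(\<Sum>I | length I = 0. \<Sum>J | length J = 2. ?f I J * dz_dzbar I J v) =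
      (\<Sum>(j, k)\<in>UNIV. M [axis j 1, axis k 1] / 2 * dz_dzbar [] [j, k] v)"
    unfolding lists by (subst sum.reindex[OF inj]) (simp add: case_prod_beta)
  also have "\<dots> = (\<Sum>j\<in>UNIV. \<Sum>k\<in>UNIV. M [axis j 1, axis k 1] / 2 * dz_dzbar [] [j, k] v)"
    by (simp add: sum.cartesian_product)
  also have "\<dots> = M v"
  proof (cases "length v = 2")
    case True
    then obtain u w where v: "v = [u, w]"
      by (auto simp: length_Suc_conv numeral_2_eq_2)
    have e1: "M [u, w] = (\<Sum>j\<in>UNIV. cnj (u $ j) * M [axis j 1, w])" for u w
      by (rule complex_linear_expansion[of "\<lambda>u. M [u, w]"]) (rule add scale)+
    have e2: "M [u, w] = (\<Sum>k\<in>UNIV. cnj (w $ k) * M [u, axis k 1])" for u w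
      using e1[of w u] skew[of u] by (simp add: sum_negf)
    have e: "M [u, w] = (\<Sum>j\<in>UNIV. \<Sum>k\<in>UNIV. cnj (u $ j) * cnj (w $ k) * M [axis j 1, axis k 1])" for u w
      unfolding e1[of u w] e2[of "axis _ 1" w] by (simp add: sum_distrib_left mult.assoc)
    have "(\<Sum>j\<in>UNIV. \<Sum>k\<in>UNIV. M [axis j 1, axis k 1] / 2 * dz_dzbar [] [j, k] v) =
        (M [u, w] - M [w, u]) / 2"
      unfolding e[of u w] e[of w u] dzb covec_det_pair v
      by (simp add: sum_subtractf[symmetric] sum_divide_distrib field_simps)
    then show ?thesis using skew[of w u] v by simp
  next
    case False
    then show ?thesis
      by (auto simp: deg dzb covec_det_def)
  qed
  finally show "M v = (\<Sum>I | length I = 0. \<Sum>J | length J = 2. ?f I J * dz_dzbar I J v)" ..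
qed

lemma diff_sum_cmult:
  assumes "\<And>m. m \<in> I \<Longrightarrow> f m differentiable (at x)"
  shows "diff10 (\<lambda>y. \<Sum>m\<in>I. k m * f m y) x u = (\<Sum>m\<in>I. k m * diff10 (f m) x u)"
    and "diff01 (\<lambda>y. \<Sum>m\<in>I. k m * f m y) x u = (\<Sum>m\<in>I. k m * diff01 (f m) x u)"
proof -
  have *: "finite I \<Longrightarrow> (\<forall>m\<in>I. f m differentiable (at x)) \<Longrightarrow>
     (\<lambda>y. \<Sum>m\<in>I. k m * f m y) differentiable (at x) \<and>
     diff10 (\<lambda>y. \<Sum>m\<in>I. k m * f m y) x u = (\<Sum>m\<in>I. k m * diff10 (f m) x u) \<and>
     diff01 (\<lambda>y. \<Sum>m\<in>I. k m * f m y) x u = (\<Sum>m\<in>I. k m * diff01 (f m) x u)"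
    by (induction I rule: finite_induct)
      (auto simp: diff_const diff_add diff_cmult intro!: derivative_intros)
  show "diff10 (\<lambda>y. \<Sum>m\<in>I. k m * f m y) x u = (\<Sum>m\<in>I. k m * diff10 (f m) x u)"
    using * assms by (cases "finite I") (auto simp: diff_const)
  show "diff01 (\<lambda>y. \<Sum>m\<in>I. k m * f m y) x u = (\<Sum>m\<in>I. k m * diff01 (f m) x u)"
    using * assms by (cases "finite I") (auto simp: diff_const)
qed

text \<open>A combination of rotated forms is differentiated rotation by rotation; by \<open>del_scale\<close>, moving an
  operator past the rotation by \<open>z m\<close> multiplies the coefficient by \<open>z m\<close> or its conjugate. The hypothesis on
  \<open>\<beta>\<close> concerns only the degree that enters the value at \<open>v\<close>.\<close>

lemma del_sum_scale:
  assumes \<alpha>: "\<alpha> \<in> smooth_forms A"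
    and c: "c \<in> A" "x \<in> chart_image c"
    and \<beta>: "\<And>y w. y \<in> chart_image c \<Longrightarrow> Suc (length w) = length v \<Longrightarrow>
        \<beta> c y w = (\<Sum>m\<in>I. k m * \<alpha> c y (map ((*s) (z m)) w))"
    and op: "open (chart_image c)" and z: "\<And>m. m \<in> I \<Longrightarrow> cnj (z m) * z m = 1"
  shows "del A \<beta> c x v = (\<Sum>m\<in>I. k m * cnj (z m) * del A \<alpha> c x (map ((*s) (z m)) v))"
    and "delbar A \<beta> c x v = (\<Sum>m\<in>I. k m * z m * delbar A \<alpha> c x (map ((*s) (z m)) v))"
proof -
  let ?R = "\<lambda>m c y w. \<alpha> c y (map ((*s) (z m)) w)"
  have df: "(\<lambda>y. \<alpha> c y w) differentiable (at x)" for w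
    using smooth_forms_differentiable[OF \<alpha> c] .
  have D: "diff10 (\<lambda>y. \<beta> c y w) x u = (\<Sum>m\<in>I. k m * diff10 (\<lambda>y. ?R m c y w) x u)"
    "diff01 (\<lambda>y. \<beta> c y w) x u = (\<Sum>m\<in>I. k m * diff01 (\<lambda>y. ?R m c y w) x u)"
    if "Suc (length w) = length v" for w u
    using diff_cong_open[OF op c(2), of "\<lambda>y. \<beta> c y w" "\<lambda>y. \<Sum>m\<in>I. k m * ?R m c y w" u] \<beta>[OF _ that]
      diff_sum_cmult[of I "\<lambda>m y. ?R m c y w" x k u] df by simp_all
  have len: "Suc (length (take i v @ drop (Suc i) v)) = length v" if "i < length v" for i
    using that by simp
  have "del A \<beta> c x v = (\<Sum>i<length v. \<Sum>m\<in>I. k m * ((-1)^i * diff10 (\<lambda>y. ?R m c y (take i v @ drop (Suc i) v)) x (v ! i)))"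
    unfolding del_apply[OF c] by (intro sum.cong refl) (simp add: D[OF len] sum_distrib_left mult.left_commute)
  also have "\<dots> = (\<Sum>m\<in>I. k m * del A (?R m) c x v)"
    unfolding del_apply[OF c] by (subst sum.swap) (simp add: sum_distrib_left)
  also have "\<dots> = (\<Sum>m\<in>I. k m * cnj (z m) * del A \<alpha> c x (map ((*s) (z m)) v))"
  proof (intro sum.cong refl)
    fix m assume "m \<in> I"
    have "cnj (z m) * (z m * del A (?R m) c x v) = del A (?R m) c x v"
      using z[OF \<open>m \<in> I\<close>] by (simp add: mult.assoc[symmetric])
    then show "k m * del A (?R m) c x v = k m * cnj (z m) * del A \<alpha> c x (map ((*s) (z m)) v)"
      unfolding del_scale(1)[OF \<alpha>] by (simp add: mult.assoc)
  qed
  finally show "del A \<beta> c x v = (\<Sum>m\<in>I. k m * cnj (z m) * del A \<alpha> c x (map ((*s) (z m)) v))" .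
  have "delbar A \<beta> c x v = (\<Sum>i<length v. \<Sum>m\<in>I. k m * ((-1)^i * diff01 (\<lambda>y. ?R m c y (take i v @ drop (Suc i) v)) x (v ! i)))"
    unfolding del_apply[OF c] by (intro sum.cong refl) (simp add: D[OF len] sum_distrib_left mult.left_commute)
  also have "\<dots> = (\<Sum>m\<in>I. k m * delbar A (?R m) c x v)"
    unfolding del_apply[OF c] by (subst sum.swap) (simp add: sum_distrib_left)
  also have "\<dots> = (\<Sum>m\<in>I. k m * z m * delbar A \<alpha> c x (map ((*s) (z m)) v))"
  proof (intro sum.cong refl)
    fix m assume "m \<in> I"
    have "z m * (cnj (z m) * delbar A (?R m) c x v) = delbar A (?R m) c x v"
      using z[OF \<open>m \<in> I\<close>] by (simp add: mult.assoc[symmetric] mult.commute[of "z m"])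
    then show "k m * delbar A (?R m) c x v = k m * z m * delbar A \<alpha> c x (map ((*s) (z m)) v)"
      unfolding del_scale(2)[OF \<alpha>] by (simp add: mult.assoc)
  qed
  finally show "delbar A \<beta> c x v = (\<Sum>m\<in>I. k m * z m * delbar A \<alpha> c x (map ((*s) (z m)) v))" .
qed

lemma eighth_root_power_norm: "cnj (eighth_root ^ m) * eighth_root ^ m = 1"
  using eighth_root(3) by (simp add: power_mult_distrib[symmetric])

text \<open>Since \<open>\<omega>\<close> has weight 0, \<open>del A \<omega>\<close> has weight 1, and since \<open>delbar\<close> lowers weights by one, only the part of
  \<open>\<eta>\<close> of weight 2 contributes to it. So a form \<open>\<eta>\<close> of mixed type can be replaced by its (2,0)-component.\<close>

lemma delbar_part20:
  fixes A :: "('a::t2_space, 'b::finite) chart set"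
  assumes A: "complex_atlas A" and \<eta>: "\<eta> \<in> smooth_forms A" and \<omega>: "\<omega> \<in> pq_forms A 1 1"
    and eq: "del A \<omega> = delbar A \<eta>"
  shows "delbar A (part20 \<eta>) = del A \<omega>"
proof (intro ext)
  fix c x and v :: "(complex^'b) list"
  consider "c \<notin> A \<or> x \<notin> chart_image c" | "length v \<noteq> 3" | "c \<in> A" "x \<in> chart_image c" "length v = 3"
    by blast
  then show "delbar A (part20 \<eta>) c x v = del A \<omega> c x v"
  proof cases
    case 2
    then have "delbar A (part20 \<eta>) c x v = 0"
      by (intro del_degree(2)[where k = 2]) (auto simp: part20_def)
    moreover have "del A \<omega> c x v = 0"
      using 2 pq_forms_degree[OF \<omega>] by (intro del_degree(1)[where k = 2]) auto
    ultimately show ?thesis by simp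
  next
    case 3
    have sm: "\<omega> \<in> smooth_forms A" using \<omega> by (simp add: pq_forms_def)
    have one: "eighth_root ^ m * cnj (eighth_root ^ m) = 1" for m
      using eighth_root_power_norm[of m] by (simp add: mult.commute)
    have "\<omega> c' y (map ((*s) (eighth_root ^ m)) w) = 1 * \<omega> c' y w" for m c' y w
      using pq_forms_scale[OF \<omega>, of c' y "eighth_root ^ m" w] one[of m] by simp
    then have wt: "del A \<omega> c x (map ((*s) (eighth_root ^ m)) v) = eighth_root ^ m * del A \<omega> c x v" for m
      using del_weight(1)[OF sm, of "eighth_root ^ m" 1 c x v] by simp
    have "delbar A (part20 \<eta>) c x v =
        (\<Sum>m<4. (- \<i>) ^ m / 4 * eighth_root ^ m * delbar A \<eta> c x (map ((*s) (eighth_root ^ m)) v))"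
      using 3 by (intro del_sum_scale(2)[OF \<eta>] complex_atlasD(2)[OF A] eighth_root_power_norm)
        (simp_all add: part20_def)
    also have "\<dots> = (\<Sum>m<4. (- \<i> * eighth_root ^ 2) ^ m / 4 * del A \<omega> c x v)"
    proof (intro sum.cong refl)
      fix m
      have "(- \<i>) ^ m / 4 * eighth_root ^ m * (eighth_root ^ m * y) =
          ((- \<i>) ^ m * (eighth_root ^ m * eighth_root ^ m)) / 4 * y" for y
        by (simp add: mult_ac)
      then show "(- \<i>) ^ m / 4 * eighth_root ^ m * delbar A \<eta> c x (map ((*s) (eighth_root ^ m)) v) =
          (- \<i> * eighth_root ^ 2) ^ m / 4 * del A \<omega> c x v"
        unfolding eq[symmetric] wt by (simp only: power_mult_distrib power2_eq_square)
    qed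
    also have "\<dots> = del A \<omega> c x v"
      by (simp add: eighth_root(1) sum_lessThan_4)
    finally show ?thesis .
  qed (simp add: del_outside)
qed

text \<open>The three-form \<open>del A (part20 \<eta>)\<close> is the part of weight 3 of \<open>del A \<eta>\<close>. As the latter equals \<open>delbar A \<zeta>\<close>, that part is
  \<open>delbar\<close> of the part of weight 4 of \<open>\<zeta>\<close> in degree two, where the weights are at most 2. In terms of the average
  defining \<open>part20\<close>, the coefficients \<open>(-\<i>) ^ m\<close> become \<open>(-1) ^ m\<close>, for which the average of a two-form
  vanishes.\<close>

lemma del_part20:
  fixes A :: "('a::t2_space, 'b::finite) chart set"
  assumes A: "complex_atlas A" and \<eta>: "\<eta> \<in> smooth_forms A" and \<zeta>: "\<zeta> \<in> smooth_forms A"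
    and eq: "del A \<eta> = delbar A \<zeta>"
  shows "del A (part20 \<eta>) = 0"
proof (intro ext)
  fix c x and v :: "(complex^'b) list"
  consider "c \<notin> A \<or> x \<notin> chart_image c" | "length v \<noteq> 3" | "c \<in> A" "x \<in> chart_image c" "length v = 3"
    by blast
  then have "del A (part20 \<eta>) c x v = 0"
  proof cases
    case 2
    then show ?thesis
      by (intro del_degree(1)[where k = 2]) (auto simp: part20_def)
  next
    case 3
    note c = 3(1,2)
    have "del A (part20 \<eta>) c x v =
        (\<Sum>m<4. (- \<i>) ^ m / 4 * cnj (eighth_root ^ m) * del A \<eta> c x (map ((*s) (eighth_root ^ m)) v))"
      using 3 by (intro del_sum_scale(1)[OF \<eta>] complex_atlasD(2)[OF A] eighth_root_power_norm)
        (simp_all add: part20_def)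
    also have "\<dots> = (\<Sum>m<4. ((- \<i>) ^ m / 4 * cnj (eighth_root ^ m) ^ 2) *
        (eighth_root ^ m * delbar A \<zeta> c x (map ((*s) (eighth_root ^ m)) v)))"
    proof (intro sum.cong refl)
      fix m
      have "(- \<i>) ^ m / 4 * cnj (eighth_root ^ m) * y =
        (- \<i>) ^ m / 4 * cnj (eighth_root ^ m) * (cnj (eighth_root ^ m) * eighth_root ^ m) * y" for y
        unfolding eighth_root_power_norm by simp
      then show "(- \<i>) ^ m / 4 * cnj (eighth_root ^ m) * del A \<eta> c x (map ((*s) (eighth_root ^ m)) v) =
        (- \<i>) ^ m / 4 * cnj (eighth_root ^ m) ^ 2 *
        (eighth_root ^ m * delbar A \<zeta> c x (map ((*s) (eighth_root ^ m)) v))"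
        unfolding eq by (simp add: power2_eq_square mult.assoc)
    qed
    also have "\<dots> = (\<Sum>m<4. ((- 1) ^ m / 4) * eighth_root ^ m * delbar A \<zeta> c x (map ((*s) (eighth_root ^ m)) v))"
    proof (intro sum.cong refl)
      fix m
      have "cnj eighth_root ^ 2 = - \<i>"
        using arg_cong[OF eighth_root(1), of cnj] by simp
      then have "cnj (eighth_root ^ m) ^ 2 = (- \<i>) ^ m"
        by (metis complex_cnj_power power_commutes power_mult mult.commute)
      then have "(- \<i>) ^ m / 4 * cnj (eighth_root ^ m) ^ 2 = (- 1) ^ m / 4"
        by (simp add: power_mult_distrib[symmetric])
      then show "(- \<i>) ^ m / 4 * cnj (eighth_root ^ m) ^ 2 *
          (eighth_root ^ m * delbar A \<zeta> c x (map ((*s) (eighth_root ^ m)) v)) =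
         (- 1) ^ m / 4 * eighth_root ^ m * delbar A \<zeta> c x (map ((*s) (eighth_root ^ m)) v)"
        by (simp add: mult.assoc)
    qed
    also have "\<dots> = delbar A 0 c x v"
    proof (rule del_sum_scale(2)[OF \<zeta> c _ complex_atlasD(2)[OF A c(1)] eighth_root_power_norm, symmetric])
      fix y and w :: "(complex^'b) list"
      assume y: "y \<in> chart_image c" and "Suc (length w) = length v"
      then obtain a b where w: "w = [a, b]"
        using 3 by (auto simp: length_Suc_conv numeral_3_eq_3)
      note L = smooth_formsD(2)[OF \<zeta> c(1) y]
      have e: "map ((*s) (eighth_root ^ 0)) w = [a, b]"
        "map ((*s) (eighth_root ^ 1)) w = [eighth_root *s a, eighth_root *s b]"
        "map ((*s) (eighth_root ^ 2)) w = [\<i> *s a, \<i> *s b]"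
        "map ((*s) (eighth_root ^ 3)) w = [eighth_root ^ 3 *s a, eighth_root ^ 3 *s b]"
        by (simp_all add: eighth_root(1) w)
      show "0 c y w = (\<Sum>m<4. (- 1) ^ m / 4 * \<zeta> c y (map ((*s) (eighth_root ^ m)) w))"
        unfolding sum_lessThan_4 e alternating_two_eighth_root[OF L] by (simp add: field_simps)
    qed
    also have "\<dots> = 0"
      by (simp add: delbar_def ext_deriv_def diff_const)
    finally show ?thesis .
  qed (simp add: del_outside)
  then show "del A (part20 \<eta>) c x v = 0 c x v" by simp
qed

section \<open>Hermitian-symplectic metrics\<close>

text \<open>With \<open>\<theta> = part20 \<eta>\<close>, the form \<open>\<rho> = - conj_form \<theta>\<close> works: the four components of
  \<open>d (conj_form \<rho> + \<omega> + \<rho>)\<close> are \<open>- del \<theta>\<close>, \<open>del \<omega> - delbar \<theta>\<close> and their conjugates.\<close>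

lemma hermitian_symplecticI:
  assumes A: "complex_atlas A" and \<omega>: "hermitian_metric A \<omega>" and \<eta>: "\<eta> \<in> smooth_forms A"
    and eq: "del A \<omega> = delbar A \<eta>" and closed: "del A (part20 \<eta>) = 0"
  shows "hermitian_symplectic A \<omega>"
proof -
  define \<theta> where "\<theta> = part20 \<eta>"
  define \<rho> where "\<rho> = (\<lambda>c x v. - 1 * conj_form \<theta> c x v)"
  have pq: "\<omega> \<in> pq_forms A 1 1" and sm: "\<omega> \<in> smooth_forms A"
    using \<omega> by (auto simp: hermitian_metric_def pq_forms_def)
  have \<theta>: "\<theta> \<in> smooth_forms A"
    using smooth_forms_part20[OF A \<eta>] by (simp add: \<theta>_def)
  have c\<theta>: "conj_form \<theta> \<in> smooth_forms A"
    by (rule smooth_forms_conj[OF A \<theta>])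
  have \<rho>: "\<rho> \<in> smooth_forms A"
    unfolding \<rho>_def by (rule smooth_forms_cmult[OF A c\<theta>])
  have c\<rho>: "conj_form \<rho> \<in> smooth_forms A"
    by (rule smooth_forms_conj[OF A \<rho>])
  have bi: "bidegree_alt 0 2 (\<rho> c x)" if "c \<in> A" "x \<in> chart_image c" for c x
  proof (rule bidegree_alt_02)
    note L = smooth_formsD(2)[OF \<eta> that]
    note P = part20_complex_bilinear[of \<eta> c x, OF L]
    show "\<rho> c x [u + u', w] = \<rho> c x [u, w] + \<rho> c x [u', w]" for u u' w
      by (simp add: \<rho>_def \<theta>_def conj_form_def P(3))
    show "\<rho> c x [z *s u, w] = cnj z * \<rho> c x [u, w]" for z u w
      by (simp add: \<rho>_def \<theta>_def conj_form_def P(1))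
    show "\<rho> c x [w, u] = - \<rho> c x [u, w]" for u w
      using P(5)[of w u] by (simp add: \<rho>_def \<theta>_def conj_form_def)
  qed (simp add: \<rho>_def \<theta>_def conj_form_def part20_def)
  have real: "conj_form \<omega> = \<omega>"
    by (rule hermitian_metric_real[OF \<omega>])
  have 1: "delbar A \<theta> = del A \<omega>"
    unfolding \<theta>_def by (rule delbar_part20[OF A \<eta> pq eq])
  have 2: "del A \<theta> = 0" using closed by (simp add: \<theta>_def)
  have 3: "del A (conj_form \<theta>) = delbar A \<omega>"
    using conj_del(2)[OF \<theta>] conj_del(1)[OF sm] 1 real by simp
  have 4: "delbar A (conj_form \<theta>) = 0"
    using conj_del(1)[OF \<theta>] 2 by (simp add: fun_eq_iff conj_form_def)
  have c\<rho>': "conj_form \<rho> = (\<lambda>c x v. - 1 * \<theta> c x v)"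
    by (simp add: fun_eq_iff \<rho>_def conj_form_def)
  have sm2: "conj_form \<rho> + \<omega> \<in> smooth_forms A"
    using smooth_forms_add[OF A c\<rho> sm] .
  have "d_op A (conj_form \<rho> + \<omega> + \<rho>) =
     (del A (conj_form \<rho>) + del A \<omega> + del A \<rho>) + (delbar A (conj_form \<rho>) + delbar A \<omega> + delbar A \<rho>)"
    unfolding d_op_eq del_add[OF sm2 \<rho>] del_add[OF c\<rho> sm] ..
  also have "\<dots> = 0"
    unfolding c\<rho>' unfolding \<rho>_def del_cmult[OF \<theta>] del_cmult[OF c\<theta>] 1 2 3 4
    by (simp add: fun_eq_iff)
  finally have "d_op A (conj_form \<rho> + \<omega> + \<rho>) = 0" .
  moreover have "\<rho> \<in> pq_forms A 0 2"
    using \<rho> bi by (simp add: pq_forms_def)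
  ultimately show ?thesis
    unfolding hermitian_symplectic_def by blast
qed

text \<open>Closedness of \<open>conj_form \<rho> + \<omega> + \<rho>\<close> is one equation between three-forms of mixed type. It splits into its
  four components because these have different weights.\<close>

lemma hermitian_symplecticD:
  assumes A: "complex_atlas A" and \<omega>: "hermitian_metric A \<omega>" and HS: "hermitian_symplectic A \<omega>"
  obtains \<rho> where "\<rho> \<in> smooth_forms A" "del A (conj_form \<rho>) = 0"
    "del A \<omega> + delbar A (conj_form \<rho>) = 0" "delbar A \<omega> + del A \<rho> = 0" "delbar A \<rho> = 0"
proof -
  obtain \<rho> where \<rho>pq: "\<rho> \<in> pq_forms A 0 2" and d: "d_op A (conj_form \<rho> + \<omega> + \<rho>) = 0"
    using HS unfolding hermitian_symplectic_def by blast
  have pq: "\<omega> \<in> pq_forms A 1 1" and sm: "\<omega> \<in> smooth_forms A" and \<rho>: "\<rho> \<in> smooth_forms A"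
    using \<omega> \<rho>pq by (auto simp: hermitian_metric_def pq_forms_def)
  have c\<rho>: "conj_form \<rho> \<in> smooth_forms A"
    by (rule smooth_forms_conj[OF A \<rho>])
  have sm2: "conj_form \<rho> + \<omega> \<in> smooth_forms A"
    using smooth_forms_add[OF A c\<rho> sm] .
  have sum0: "(del A (conj_form \<rho>) + del A \<omega> + del A \<rho>) + (delbar A (conj_form \<rho>) + delbar A \<omega> + delbar A \<rho>) = 0"
    using d unfolding d_op_eq del_add[OF sm2 \<rho>] del_add[OF c\<rho> sm] .
  have comp: "del A (conj_form \<rho>) c x v = 0 \<and> (del A \<omega> c x v + delbar A (conj_form \<rho>) c x v) = 0 \<and>
      (delbar A \<omega> c x v + del A \<rho> c x v) = 0 \<and> delbar A \<rho> c x v = 0" for c x v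
  proof (rule odd_weights_independent)
    fix z :: complex assume "norm z = 1"
    then have z: "z * cnj z = 1"
      by (simp add: complex_norm_square[symmetric])
    have "conj_form \<rho> c y (map ((*s) z) w) = z ^ 2 * conj_form \<rho> c y w" for c y w
      using pq_forms_scale[OF \<rho>pq, of c y z w] by (simp add: conj_form_def)
    note w1 = del_weight[OF c\<rho> this, of c x v]
    have "\<rho> c y (map ((*s) z) w) = cnj z ^ 2 * \<rho> c y w" for c y w
      using pq_forms_scale[OF \<rho>pq, of c y z w] by simp
    note w2 = del_weight[OF \<rho> this, of c x v]
    have "\<omega> c y (map ((*s) z) w) = 1 * \<omega> c y w" for c y w
      using pq_forms_scale[OF pq, of c y z w] z by simp
    note w3 = del_weight[OF sm this, of c x v]
    have zz: "cnj z * z\<^sup>2 = z" "z * (cnj z)\<^sup>2 = cnj z"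
    proof -
      have "cnj z * z\<^sup>2 = z * cnj z * z" "z * (cnj z)\<^sup>2 = z * cnj z * cnj z"
        by (simp_all add: power2_eq_square mult_ac)
      then show "cnj z * z\<^sup>2 = z" "z * (cnj z)\<^sup>2 = cnj z"
        by (simp_all only: z mult_1)
    qed
    have "z * z\<^sup>2 * del A (conj_form \<rho>) c x v + z * 1 * del A \<omega> c x v + z * (cnj z)\<^sup>2 * del A \<rho> c x v
       + (cnj z * z\<^sup>2 * delbar A (conj_form \<rho>) c x v + cnj z * 1 * delbar A \<omega> c x v
       + cnj z * (cnj z)\<^sup>2 * delbar A \<rho> c x v) = 0"
      using sum0[unfolded fun_eq_iff, rule_format, of c x "map ((*s) z) v"]
      unfolding plus_fun_apply zero_fun_apply w1 w2 w3 .
    then show "z ^ 3 * del A (conj_form \<rho>) c x v + z * (del A \<omega> c x v + delbar A (conj_form \<rho>) c x v) +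
      cnj z * (delbar A \<omega> c x v + del A \<rho> c x v) + cnj z ^ 3 * delbar A \<rho> c x v = 0"
      unfolding zz by (simp add: power3_eq_cube power2_eq_square algebra_simps)
  qed
  show thesis
    using comp \<rho> by (intro that[of \<rho>]) (simp_all add: fun_eq_iff)
qed

text \<open>The towers are \<open>\<omega>, - conj_form \<rho>, 0\<close> and \<open>\<omega>, - \<rho>, 0\<close>.\<close>

lemma hermitian_symplectic_imp_E3_closed:
  assumes A: "complex_atlas A" and \<omega>: "hermitian_metric A \<omega>" and HS: "hermitian_symplectic A \<omega>"
  shows "\<omega> \<in> Er_closed A 3 1 1"
proof -
  have pq: "\<omega> \<in> pq_forms A 1 1" and sm: "\<omega> \<in> smooth_forms A"
    using \<omega> by (auto simp: hermitian_metric_def pq_forms_def)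
  obtain \<rho> where \<rho>: "\<rho> \<in> smooth_forms A" "del A (conj_form \<rho>) = 0"
    "del A \<omega> + delbar A (conj_form \<rho>) = 0" "delbar A \<omega> + del A \<rho> = 0" "delbar A \<rho> = 0"
    using hermitian_symplecticD[OF assms] .
  note c\<rho> = smooth_forms_conj[OF A \<rho>(1)]
  let ?neg = "\<lambda>\<alpha> c x v. - 1 * \<alpha> c x v"
  note neg = smooth_forms_cmult[OF A c\<rho>, of "- 1"] smooth_forms_cmult[OF A \<rho>(1), of "- 1"]
  have zero: "del A 0 = 0" "delbar A 0 = 0"
    by (simp_all add: fun_eq_iff del_def delbar_def ext_deriv_def diff_const)
  have l: "(l::nat) < 3 \<longleftrightarrow> l = 0 \<or> l = 1 \<or> l = 2" "(l::nat) < 3 - 1 \<longleftrightarrow> l = 0 \<or> l = 1" for l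
    by auto
  have n1: "del A \<omega> = delbar A (?neg (conj_form \<rho>))" "del A (?neg (conj_form \<rho>)) = delbar A 0"
    unfolding del_cmult[OF c\<rho>] zero using \<rho>(2,3) by (simp_all add: fun_eq_iff eq_neg_iff_add_eq_0)
  have n2: "delbar A \<omega> = del A (?neg \<rho>)" "delbar A (?neg \<rho>) = del A 0"
    unfolding del_cmult[OF \<rho>(1)] zero using \<rho>(4,5) by (simp_all add: fun_eq_iff eq_neg_iff_add_eq_0)
  define \<eta> where "\<eta> = (\<lambda>l::nat. if l = 0 then \<omega> else if l = 1 then ?neg (conj_form \<rho>) else 0)"
  have \<eta>: "\<eta> 0 = \<omega>" "\<eta> (Suc 0) = ?neg (conj_form \<rho>)" "\<eta> 2 = 0"
    by (simp_all only: \<eta>_def) simp_all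
  define \<zeta> where "\<zeta> = (\<lambda>l::nat. if l = 0 then \<omega> else if l = 1 then ?neg \<rho> else 0)"
  have \<zeta>: "\<zeta> 0 = \<omega>" "\<zeta> (Suc 0) = ?neg \<rho>" "\<zeta> 2 = 0"
    by (simp_all only: \<zeta>_def) simp_all
  have 2: "Suc 1 = 2" "1 = Suc 0" by simp_all
  have "(\<forall>l<3. \<eta> l \<in> smooth_forms A) \<and> (\<forall>l<3 - 1. del A (\<eta> l) = delbar A (\<eta> (Suc l)))"
    unfolding l using \<eta> n1 sm neg(1) smooth_forms_zero[of A] 2 by metis
  moreover have "(\<forall>l<3. \<zeta> l \<in> smooth_forms A) \<and> (\<forall>l<3 - 1. delbar A (\<zeta> l) = del A (\<zeta> (Suc l)))"
    unfolding l using \<zeta> n2 sm neg(2) smooth_forms_zero[of A] 2 by metis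
  ultimately show ?thesis
    using pq \<eta>(1) \<zeta>(1) unfolding Er_closed_def by blast
qed

lemma Er_closed_mono:
  assumes "r \<le> s" shows "Er_closed A s p q \<subseteq> Er_closed A r p q"
proof -
  have "l < r \<Longrightarrow> l < s" "l < r - 1 \<Longrightarrow> l < s - 1" for l
    using assms by auto
  then show ?thesis
    unfolding Er_closed_def by blast
qed

lemma hermitian_symplectic_iff_E3_closed:
  assumes A: "complex_atlas A" and \<omega>: "hermitian_metric A \<omega>"
  shows "hermitian_symplectic A \<omega> \<longleftrightarrow> \<omega> \<in> Er_closed A 3 1 1"
proof
  assume "\<omega> \<in> Er_closed A 3 1 1"
  then obtain \<eta> where \<eta>: "\<eta> 0 = \<omega>" "\<And>l. l < 3 \<Longrightarrow> \<eta> l \<in> smooth_forms A"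
    "\<And>l. l < 3 - 1 \<Longrightarrow> del A (\<eta> l) = delbar A (\<eta> (Suc l))"
    unfolding Er_closed_def by blast
  show "hermitian_symplectic A \<omega>"
  proof (rule hermitian_symplecticI[OF A \<omega>])
    show "\<eta> 1 \<in> smooth_forms A" "del A \<omega> = delbar A (\<eta> 1)"
      using \<eta>(2)[of 1] \<eta>(3)[of 0] \<eta>(1) by simp_all
    show "del A (part20 (\<eta> 1)) = 0"
      using \<eta>(2)[of 1] \<eta>(2)[of 2] \<eta>(3)[of 1] by (intro del_part20[OF A, of _ "\<eta> 2"]) (simp_all add: numeral_2_eq_2)
  qed
qed (rule hermitian_symplectic_imp_E3_closed[OF A \<omega>])

section \<open>The real Jacobian of a complex linear map\<close>

text \<open>Gaussian elimination. A nonnegative multiplicative function is 1 on involutions, in particular on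
  exchanges of two columns. It is also 1 on a shear, since a reflection conjugates the shear into
  its inverse. So row and column operations change neither function, and every matrix
  can be brought into diagonal form or into one with a zero row.\<close>

lemma multiplicative_matrix_function_unique:
  fixes \<mu> \<nu> :: "'a::field^'n::finite^'n \<Rightarrow> real"
  assumes mult: "\<And>A B. \<mu> (A ** B) = \<mu> A * \<mu> B" "\<And>A B. \<nu> (A ** B) = \<nu> A * \<nu> B"
    and nonneg: "\<And>A. \<mu> A \<ge> 0" "\<And>A. \<nu> A \<ge> 0"
    and one: "\<mu> (mat 1) = 1" "\<nu> (mat 1) = 1"
    and diag: "\<And>A. (\<And>i j. i \<noteq> j \<Longrightarrow> A $ i $ j = 0) \<Longrightarrow> \<mu> A = \<nu> A"
    and zero: "\<And>A i. row i A = 0 \<Longrightarrow> \<mu> A = \<nu> A"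
  shows "\<mu> A = \<nu> A"
proof -
  have invol: "f S = 1" if "S ** S = mat 1" "\<And>A B. f (A ** B) = f A * f B" "f (mat 1) = 1" "f S \<ge> 0"
    for f :: "'a^'n^'n \<Rightarrow> real" and S
  proof -
    have "f S * f S = 1" using that by metis
    then show ?thesis using that(4)
      by (metis abs_of_nonneg abs_square_eq_1 power2_eq_square)
  qed
  (* Off the columns in K the matrix is already diagonal. *)
  have "\<mu> A = \<nu> A" if "finite K" "\<And>i j. j \<notin> K \<Longrightarrow> i \<noteq> j \<Longrightarrow> A $ i $ j = 0" for A and K :: "'n set"
    using that
  proof (induction K arbitrary: A rule: finite_induct)
    case empty
    then show ?case by (intro diag) auto
  next
    case (insert k K)
    have pivot: "\<mu> A = \<nu> A"
      if A: "\<And>i j. j \<notin> insert k K \<Longrightarrow> i \<noteq> j \<Longrightarrow> A $ i $ j = 0" and nz: "A $ k $ k \<noteq> 0" for A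
    proof -
      define u where "u i = (if i = k then 0 else A $ i $ k / A $ k $ k)" for i
      define E where "E s = (\<chi> i j. (if i = j then 1 else 0) + (if j = k then s * u i else 0))" for s
      define D :: "'a^'n^'n" where "D = (\<chi> i j. if i = j then (if i = k then - 1 else 1) else 0)"
      have E_mult: "(E s ** B) $ i $ j = B $ i $ j + s * u i * B $ k $ j" for s B i j
      proof -
        have "(E s ** B) $ i $ j = (\<Sum>l\<in>UNIV. (if l = i then B $ i $ j else 0) + (if l = k then s * u i * B $ k $ j else 0))"
          unfolding matrix_matrix_mult_def E_def vec_lambda_beta by (rule sum.cong) (auto simp: distrib_right)
        then show ?thesis by (simp add: sum.distrib)
      qed
      have D_mult: "(D ** B) $ i $ j = (if i = k then - (B $ i $ j) else B $ i $ j)" for B i j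
      proof -
        have "(D ** B) $ i $ j = (\<Sum>l\<in>UNIV. if l = i then (if i = k then - (B $ i $ j) else B $ i $ j) else 0)"
          unfolding matrix_matrix_mult_def D_def vec_lambda_beta by (rule sum.cong) auto
        then show ?thesis by simp
      qed
      have DD: "D ** D = mat 1"
        unfolding vec_eq_iff D_mult by (simp add: D_def mat_def)
      have EE: "E s ** E (- s) = mat 1" for s
        unfolding vec_eq_iff E_mult by (auto simp: E_def mat_def u_def)
      have DED: "D ** (E s ** D) = E (- s)" for s
        unfolding vec_eq_iff D_mult E_mult by (auto simp: E_def D_def u_def)
      have E1: "f (E s) = 1" if f: "\<And>A B. f (A ** B) = f A * f B" "f (mat 1) = 1" "\<And>A. f A \<ge> 0"
        for f :: "'a^'n^'n \<Rightarrow> real" and s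
      proof -
        have "f D = 1" using invol[of D f] DD f by simp
        then have "f (E (- s)) = f (E s)" using arg_cong[OF DED[of s], of f] by (simp add: f)
        then have "f (E s) * f (E s) = 1" using arg_cong[OF EE[of s], of f] by (simp add: f)
        then show ?thesis using f(3)
          by (metis abs_of_nonneg abs_square_eq_1 power2_eq_square)
      qed
      have "\<mu> (E (- 1) ** A) = \<nu> (E (- 1) ** A)"
      proof (rule insert.IH)
        fix i j assume j: "j \<notin> K" "i \<noteq> j"
        show "(E (- 1) ** A) $ i $ j = 0"
          using A[of j i] A[of j k] j nz unfolding E_mult by (cases "j = k") (auto simp: u_def)
      qed
      then show ?thesis
        using E1[of \<mu>] E1[of \<nu>] mult nonneg one by simp
    qed
    consider "A $ k $ k \<noteq> 0" | m where "A $ k $ k = 0" "m \<in> K" "A $ k $ m \<noteq> 0" | "\<And>m. m \<in> insert k K \<Longrightarrow> A $ k $ m = 0"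
      by blast
    then show ?case
    proof cases
      case 1
      then show ?thesis using insert.prems by (rule pivot[rotated])
    next
      case (2 m)
      define S :: "'a^'n^'n" where "S = (\<chi> i j. if i = Transposition.transpose k m j then 1 else 0)"
      have S_mult: "(B ** S) $ i $ j = B $ i $ Transposition.transpose k m j" for B i j
        unfolding matrix_matrix_mult_def S_def by (simp add: if_distrib cong: if_cong)
      have SS: "S ** S = mat 1"
        unfolding vec_eq_iff S_mult by (simp add: S_def mat_def)
      have "m \<noteq> k" using 2 insert.hyps by auto
      have "\<mu> (A ** S) = \<nu> (A ** S)"
      proof (rule pivot)
        show "(A ** S) $ k $ k \<noteq> 0"
          using 2 by (simp add: S_mult)
        fix i j assume "j \<notin> insert k K" "i \<noteq> j"
        moreover from this have "Transposition.transpose k m j = j"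
          using 2 by (intro transpose_apply_other) auto
        ultimately show "(A ** S) $ i $ j = 0"
          using insert.prems by (simp add: S_mult)
      qed
      then show ?thesis
        using invol[of S \<mu>] invol[of S \<nu>] SS mult nonneg one by simp
    next
      case 3
      have "A $ k $ m = 0" for m
        using 3[of m] insert.prems[of m k] by (cases "m \<in> insert k K") auto
      then show ?thesis by (intro zero[of k]) (simp add: row_def vec_eq_iff)
    qed
  qed
  from this[of UNIV A] show ?thesis by simp
qed

text \<open>Real coordinates on \<open>complex^'n\<close>, indexed through a bijection with a type for which real
  determinants can be formed; \<open>True\<close> marks real and \<open>False\<close> imaginary parts.\<close>

definition complex_coords :: "('m \<Rightarrow> 'n \<times> bool) \<Rightarrow> real^'m \<Rightarrow> complex^'n" where
  "complex_coords e x = (\<chi> j. Complex (x $ inv e (j, True)) (x $ inv e (j, False)))"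

definition real_coords :: "('m \<Rightarrow> 'n \<times> bool) \<Rightarrow> complex^'n \<Rightarrow> real^'m" where
  "real_coords e z = (\<chi> i. if snd (e i) then Re (z $ fst (e i)) else Im (z $ fst (e i)))"

lemma coords_inverse:
  assumes "bij e"
  shows "complex_coords e (real_coords e z) = z" "real_coords e (complex_coords e x) = x"
proof -
  have "e (inv e p) = p" "inv e (e i) = i" for p i
    using assms by (simp_all add: bij_is_surj surj_f_inv_f bij_is_inj)
  then show "complex_coords e (real_coords e z) = z" "real_coords e (complex_coords e x) = x"
    unfolding complex_coords_def real_coords_def vec_eq_iff
    by (simp_all add: complex_eq_iff) (metis prod.collapse)
qed

lemma coords_linear: "linear (complex_coords e)" "linear (real_coords e)"
  unfolding complex_coords_def real_coords_def linear_iff vec_eq_iff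
  by (simp_all add: complex_eq_iff)

lemma real_coords_inner:
  fixes e :: "'m::finite \<Rightarrow> 'n::finite \<times> bool"
  assumes "bij e"
  shows "real_coords e z \<bullet> real_coords e w = z \<bullet> w"
proof -
  have "real_coords e z \<bullet> real_coords e w =
      (\<Sum>i\<in>UNIV. (\<lambda>(j, b). if b then Re (z $ j) * Re (w $ j) else Im (z $ j) * Im (w $ j)) (e i))"
    by (simp add: inner_vec_def real_coords_def case_prod_beta)
      (intro sum.cong refl; simp)
  also have "\<dots> = (\<Sum>(j, b)\<in>UNIV. if b then Re (z $ j) * Re (w $ j) else Im (z $ j) * Im (w $ j))"
    using sum.reindex_bij_betw[OF assms] by blast
  also have "\<dots> = (\<Sum>j\<in>UNIV. \<Sum>b\<in>UNIV. if b then Re (z $ j) * Re (w $ j) else Im (z $ j) * Im (w $ j))"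
    by (simp add: sum.cartesian_product)
  also have "\<dots> = z \<bullet> w"
    by (simp add: UNIV_bool inner_vec_def inner_complex_def add.commute)
  finally show ?thesis .
qed

lemma complex_coords_inner:
  fixes e :: "'m::finite \<Rightarrow> 'n::finite \<times> bool"
  assumes "bij e"
  shows "complex_coords e x \<bullet> complex_coords e y = x \<bullet> y"
  using real_coords_inner[OF assms, of "complex_coords e x" "complex_coords e y"]
  by (simp add: coords_inverse[OF assms])

definition real_det :: "('m::finite \<Rightarrow> 'n::finite \<times> bool) \<Rightarrow> complex^'n^'n \<Rightarrow> real" where
  "real_det e M = \<bar>det (matrix (\<lambda>x. real_coords e (M *v complex_coords e x)))\<bar>"

lemma linear_matrix_vector_complex: "linear ((*v) (M :: complex^'n^'m))"
  unfolding linear_iff matrix_vector_mult_def vec_eq_iff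
  by (simp add: distrib_left sum.distrib scaleR_sum_right)

lemma linear_real_matrix: "linear (\<lambda>x. real_coords e (M *v complex_coords e x))"
  using linear_compose[OF linear_compose[OF coords_linear(1) linear_matrix_vector_complex] coords_linear(2)]
  by (simp add: o_def)

lemma real_det_mult:
  assumes "bij e"
  shows "real_det e (M ** N) = real_det e M * real_det e N"
proof -
  have "(\<lambda>x. real_coords e ((M ** N) *v complex_coords e x)) =
     (\<lambda>x. real_coords e (M *v complex_coords e x)) \<circ> (\<lambda>x. real_coords e (N *v complex_coords e x))"
    by (simp add: fun_eq_iff coords_inverse[OF assms] matrix_vector_mul_assoc)
  then show ?thesis
    unfolding real_det_def
    by (simp add: matrix_compose[OF linear_real_matrix linear_real_matrix] det_mul abs_mult)
qed

text \<open>By polar decomposition of the entries the matrix is the product of a unitary and a nonnegative diagonal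
  matrix. The first is an isometry, and in real coordinates the second is diagonal with every modulus
  occurring twice.\<close>

lemma real_det_diagonal:
  fixes e :: "'m::finite \<Rightarrow> 'n::finite \<times> bool"
  assumes e: "bij e" and M: "\<And>i j. i \<noteq> j \<Longrightarrow> M $ i $ j = 0"
  shows "real_det e M = (cmod (det M))\<^sup>2"
proof -
  define r where "r j = cmod (M $ j $ j)" for j
  (* Where the entry is zero any unit serves as its phase. *)
  define u where "u j = (if M $ j $ j = 0 then 1 else M $ j $ j / r j)" for j
  define R :: "complex^'n^'n" where "R = (\<chi> i j. if i = j then complex_of_real (r i) else 0)"
  define U :: "complex^'n^'n" where "U = (\<chi> i j. if i = j then u i else 0)"
  have Rv: "R *v z = (\<chi> i. r i * z $ i)" and Uv: "U *v z = (\<chi> i. u i * z $ i)" for z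
    by (simp_all add: R_def U_def matrix_vector_mult_def if_distrib if_distribR cong: if_cong)
  have "(R ** U) $ i $ j = M $ i $ j" for i j
  proof -
    have "(R ** U) $ i $ j = (\<Sum>k\<in>UNIV. if k = i then r i * U $ i $ j else 0)"
      unfolding matrix_matrix_mult_def R_def vec_lambda_beta by (rule sum.cong) auto
    then show ?thesis
      using M[of i j] by (auto simp: U_def u_def r_def)
  qed
  then have MRU: "M = R ** U" by (simp add: vec_eq_iff)
  have norm_u: "cmod (u j) = 1" for j
    by (simp add: u_def r_def norm_divide)
  have "norm (U *v z) = norm z" for z
    by (simp add: Uv norm_vec_def L2_set_def norm_mult norm_u)
  then have inner_U: "norm (real_coords e (U *v complex_coords e x)) = norm x" for x
    by (simp add: norm_eq_sqrt_inner real_coords_inner[OF e] complex_coords_inner[OF e])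
  have detU: "real_det e U = 1"
    unfolding real_det_def
    by (rule orthogonal_transformation_det) (simp add: orthogonal_transformation linear_real_matrix inner_U)
  have e_inv: "e (inv e p) = p" for p
    using e by (simp add: bij_is_surj surj_f_inv_f)
  have entry: "matrix (\<lambda>x. real_coords e (R *v complex_coords e x)) $ i $ k = (if i = k then r (fst (e i)) else 0)" for i k
  proof -
    have "complex_coords e (axis k 1) $ j = Complex (if inv e (j, True) = k then 1 else 0) (if inv e (j, False) = k then 1 else 0)" for j
      by (simp add: complex_coords_def axis_def)
    moreover have "inv e p = k \<longleftrightarrow> p = e k" for p
      using e by (metis bij_inv_eq_iff)
    moreover have "i = k \<longleftrightarrow> fst (e i) = fst (e k) \<and> snd (e i) = snd (e k)"
      using bij_is_inj[OF e] by (simp add: inj_eq prod_eq_iff[symmetric])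
    ultimately show ?thesis
      by (auto simp: matrix_def real_coords_def Rv prod_eq_iff)
  qed
  have "det (matrix (\<lambda>x. real_coords e (R *v complex_coords e x))) = (\<Prod>i\<in>UNIV. r (fst (e i)))"
    by (subst det_diagonal) (simp_all add: entry)
  also have "\<dots> = (\<Prod>(j, b)\<in>(UNIV::('n \<times> bool) set). r j)"
    using prod.reindex_bij_betw[OF e, of "\<lambda>(j, b). r j"] by (simp add: case_prod_beta)
  also have "\<dots> = (\<Prod>j\<in>UNIV. \<Prod>b\<in>(UNIV::bool set). r j)"
    by (subst prod.cartesian_product) simp
  also have "\<dots> = (\<Prod>j\<in>UNIV. r j)\<^sup>2"
    by (simp add: UNIV_bool power2_eq_square prod.distrib)
  finally have "real_det e R = (\<Prod>j\<in>UNIV. r j)\<^sup>2"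
    by (simp add: real_det_def)
  moreover have "cmod (det M) = (\<Prod>j\<in>UNIV. r j)"
    by (simp add: det_diagonal[OF M] r_def prod_norm)
  ultimately show ?thesis
    using detU by (subst MRU) (simp add: real_det_mult[OF e])
qed

text \<open>The Jacobian determinant of a holomorphic map is the squared modulus of its complex determinant.
  Both sides are multiplicative, so it is enough to compare them on diagonal matrices and to note that both
  vanish for a zero row.\<close>

lemma real_det_eq:
  fixes e :: "'m::finite \<Rightarrow> 'n::finite \<times> bool"
  assumes e: "bij e"
  shows "real_det e M = (cmod (det M))\<^sup>2"
proof (rule multiplicative_matrix_function_unique)
  show "real_det e M = (cmod (det M))\<^sup>2" if "\<And>i j. i \<noteq> j \<Longrightarrow> M $ i $ j = 0" for M :: "complex^'n^'n"
    using real_det_diagonal[OF e that] .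
  show "real_det e (mat 1) = 1"
    by (subst real_det_diagonal[OF e]) (auto simp: mat_def[symmetric], simp add: mat_def)
  show "real_det e M = (cmod (det M))\<^sup>2" if "row j M = 0" for M :: "complex^'n^'n" and j
  proof -
    let ?f = "\<lambda>x. real_coords e (M *v complex_coords e x)"
    have "M $ j $ k = 0" for k using that by (simp add: row_def vec_eq_iff)
    then have "(M *v z) $ j = 0" for z by (simp add: matrix_vector_mult_def)
    moreover have "e (inv e (j, True)) = (j, True)"
      using e by (simp add: bij_is_surj surj_f_inv_f)
    ultimately have "row (inv e (j, True)) (matrix ?f) = 0"
      by (simp add: row_def vec_eq_iff matrix_def real_coords_def)
    then have "det (matrix ?f) = 0" by (rule det_zero_row)
    then show ?thesis using det_zero_row(1)[OF that] by (simp add: real_det_def)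
  qed
qed (simp_all add: real_det_mult[OF e] det_mul norm_mult power_mult_distrib, simp_all add: real_det_def)

section \<open>Change of variables\<close>

lemma distr_complex_coords:
  fixes e :: "'m::finite \<Rightarrow> 'n::finite \<times> bool"
  assumes e: "bij e"
  shows "distr lborel borel (complex_coords e) = lborel"
proof (rule lborel_eqI[symmetric])
  have meas: "complex_coords e \<in> borel_measurable borel"
    by (intro borel_measurable_continuous_onI linear_continuous_on linear_conv_bounded_linear[THEN iffD1] coords_linear)
  have cx: "complex_coords e (axis i 1) = axis (fst (e i)) (if snd (e i) then 1 else \<i>)" for i
  proof -
    have "inv e p = i \<longleftrightarrow> p = e i" for p
      using e by (metis bij_inv_eq_iff)
    then show ?thesis
      by (auto simp: vec_eq_iff complex_coords_def axis_def complex_eq_iff prod_eq_iff)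
  qed
  have bij: "bij_betw (complex_coords e) Basis Basis"
    unfolding bij_betw_def
  proof
    show "inj_on (complex_coords e) Basis"
      using coords_inverse(2)[OF e] by (metis inj_on_def)
    have "axis j z \<in> complex_coords e ` Basis" if "z \<in> {1, \<i>}" for j z
    proof -
      have "e (inv e (j, z = 1)) = (j, z = 1)"
        using e by (simp add: bij_is_surj surj_f_inv_f)
      then have "complex_coords e (axis (inv e (j, z = 1)) 1) = axis j z"
        unfolding cx using that by auto
      moreover have "axis (inv e (j, z = 1)) 1 \<in> (Basis :: (real^'m) set)"
        by (auto simp: Basis_vec_def)
      ultimately show ?thesis by (metis imageI)
    qed
    then show "complex_coords e ` Basis = Basis"
      by (auto simp: Basis_vec_def cx Basis_complex_def)
  qed
  fix l u :: "complex^'n" assume le: "\<And>b. b \<in> Basis \<Longrightarrow> l \<bullet> b \<le> u \<bullet> b"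
  have ip: "real_coords e z \<bullet> b = z \<bullet> complex_coords e b" for z b
    using complex_coords_inner[OF e, of "real_coords e z" b] by (simp add: coords_inverse[OF e])
  have "complex_coords e -` box l u = box (real_coords e l) (real_coords e u)"
  proof -
    have "complex_coords e x \<in> box l u \<longleftrightarrow> x \<in> box (real_coords e l) (real_coords e u)" for x
    proof -
      have "complex_coords e x \<in> box l u \<longleftrightarrow>
          (\<forall>b\<in>complex_coords e ` Basis. l \<bullet> b < complex_coords e x \<bullet> b \<and> complex_coords e x \<bullet> b < u \<bullet> b)"
        using bij by (simp add: mem_box bij_betw_def)
      then show ?thesis
        by (simp add: mem_box ip complex_coords_inner[OF e])
    qed
    then show ?thesis by auto
  qed
  then have "emeasure (distr lborel borel (complex_coords e)) (box l u) =
      emeasure lborel (box (real_coords e l) (real_coords e u))"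
    using meas by (subst emeasure_distr) auto
  also have "\<dots> = (\<Prod>b\<in>Basis. (real_coords e u - real_coords e l) \<bullet> b)"
  proof (rule emeasure_lborel_box)
    fix b :: "real^'m" assume "b \<in> Basis"
    then have "complex_coords e b \<in> Basis"
      using bij by (rule bij_betwE[rule_format, rotated])
    then show "real_coords e l \<bullet> b \<le> real_coords e u \<bullet> b"
      unfolding ip by (rule le)
  qed
  also have "(\<Prod>b\<in>Basis. (real_coords e u - real_coords e l) \<bullet> b) = (\<Prod>b\<in>Basis. (u - l) \<bullet> complex_coords e b)"
    by (simp add: inner_diff_left ip)
  also have "\<dots> = (\<Prod>b\<in>Basis. (u - l) \<bullet> b)"
    by (rule prod.reindex_bij_betw[OF bij])
  finally show "emeasure (distr lborel borel (complex_coords e)) (box l u) = (\<Prod>b\<in>Basis. (u - l) \<bullet> b)" .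
qed simp

text \<open>The real change of variables formula, read in real coordinates. Integration of the square of
  the modulus of a form of type \<open>(n, 0)\<close> is independent of the chart because of this Jacobian.\<close>

lemma holomorphic_change_of_variables:
  fixes e :: "'m::{finite,wellorder} \<Rightarrow> 'n::finite \<times> bool" and f g :: "complex^'n \<Rightarrow> real"
  assumes e: "bij e" and S: "open S" and inj: "inj_on \<phi> S"
    and der: "\<And>x. x \<in> S \<Longrightarrow> (\<phi> has_derivative ((*v) (M x))) (at x)"
    and f: "integrable lborel f" "\<And>y. y \<notin> \<phi> ` S \<Longrightarrow> f y = 0"
    and g: "integrable lborel g" "\<And>x. x \<notin> S \<Longrightarrow> g x = 0"
      "\<And>x. x \<in> S \<Longrightarrow> g x = (cmod (det (M x)))\<^sup>2 * f (\<phi> x)"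
  shows "integral\<^sup>L lborel g = integral\<^sup>L lborel f"
proof -
  let ?C = "complex_coords e" and ?R = "real_coords e"
  note inverse = coords_inverse[OF e]
  have C_cont: "continuous_on UNIV ?C" and R_cont: "continuous_on UNIV ?R"
    by (intro linear_continuous_on linear_conv_bounded_linear[THEN iffD1] coords_linear)+
  have meas: "?C \<in> borel_measurable borel"
    using C_cont by (rule borel_measurable_continuous_onI)
  have transport: "integrable lborel (\<lambda>x. h (?C x))" "integral\<^sup>L lborel (\<lambda>x. h (?C x)) = integral\<^sup>L lborel h"
    if "integrable lborel h" for h :: "complex^'n \<Rightarrow> real"
    using that meas integrable_distr[of ?C lborel borel h] integral_distr[of ?C lborel borel h]
    by (simp_all add: distr_complex_coords[OF e])
  define T where "T = ?C -` S"
  define \<psi> where "\<psi> x = ?R (\<phi> (?C x))" for x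
  define \<psi>' where "\<psi>' x = (\<lambda>u. ?R (M (?C x) *v ?C u))" for x
  have T_open: "open T"
    unfolding T_def using S C_cont by (simp add: open_vimage)
  have der\<psi>: "(\<psi> has_derivative \<psi>' x) (at x within T)" if "x \<in> T" for x
  proof -
    have C: "(?C has_derivative ?C) (at x)" and R: "(?R has_derivative ?R) (at y)" for y
      by (intro bounded_linear_imp_has_derivative linear_conv_bounded_linear[THEN iffD1] coords_linear)+
    have "(\<phi> has_derivative ((*v) (M (?C x)))) (at (?C x))"
      using der that by (simp add: T_def)
    from has_derivative_compose[OF has_derivative_compose[OF C this] R]
    show ?thesis unfolding \<psi>_def[abs_def] \<psi>'_def by (rule has_derivative_at_withinI)
  qed
  have inj\<psi>: "inj_on \<psi> T"
  proof (rule inj_onI)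
    fix x y assume xy: "x \<in> T" "y \<in> T" "\<psi> x = \<psi> y"
    then have "\<phi> (?C x) = \<phi> (?C y)"
      unfolding \<psi>_def by (metis inverse(1))
    then show "x = y"
      using xy inj unfolding T_def by (metis inj_onD inverse(2) vimageD)
  qed
  have img: "y \<in> \<psi> ` T \<longleftrightarrow> ?C y \<in> \<phi> ` S" for y
  proof
    assume "?C y \<in> \<phi> ` S"
    then obtain z where z: "z \<in> S" "?C y = \<phi> z" by auto
    then have "?R z \<in> T" "\<psi> (?R z) = y"
      by (simp_all add: T_def \<psi>_def inverse) (metis inverse(2))
    then show "y \<in> \<psi> ` T" by blast
  qed (auto simp: T_def \<psi>_def inverse)
  let ?f = "\<lambda>x. f (?C x)" and ?g = "\<lambda>x. g (?C x)"
  have f0: "?f = (\<lambda>x. if x \<in> \<psi> ` T then ?f x else 0)"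
    using f(2) img by auto
  have g0: "?g = (\<lambda>x. if x \<in> T then ?g x else 0)"
    using g(2) by (auto simp: T_def)
  have abs: "h absolutely_integrable_on UNIV" if "integrable lborel h" for h :: "real^'m::_ \<Rightarrow> real"
    using that by (simp add: set_integrable_def integrable_completion borel_measurable_integrable)
  have fabs: "?f absolutely_integrable_on \<psi> ` T"
    using abs[OF transport(1)[OF f(1)]] f0 absolutely_integrable_restrict_UNIV[of "\<psi> ` T" ?f] by simp
  have geq: "\<bar>det (matrix (\<psi>' x))\<bar> * ?f (\<psi> x) = ?g x" if "x \<in> T" for x
    using that g(3)[of "?C x"] real_det_eq[OF e, of "M (?C x)"]
    by (simp add: T_def \<psi>_def \<psi>'_def inverse real_det_def)
  have "(\<lambda>x. \<bar>det (matrix (\<psi>' x))\<bar> *\<^sub>R (vec (?f (\<psi> x)) :: real^1)) absolutely_integrable_on T \<and>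
      integral T (\<lambda>x. \<bar>det (matrix (\<psi>' x))\<bar> *\<^sub>R (vec (?f (\<psi> x)) :: real^1)) = vec (integral (\<psi> ` T) ?f)"
    using fabs
    by (subst has_absolute_integral_change_of_variables[where f="\<lambda>x. vec (?f x) :: real^1", OF _ der\<psi> inj\<psi>])
      (simp_all add: T_open absolutely_integrable_on_1_iff integral_on_1_eq)
  then have "integral T (\<lambda>x. \<bar>det (matrix (\<psi>' x))\<bar> * ?f (\<psi> x)) = integral (\<psi> ` T) ?f"
    by (simp add: integral_on_1_eq)
  then have "integral T ?g = integral (\<psi> ` T) ?f"
    using geq by (simp cong: Henstock_Kurzweil_Integration.integral_cong)
  then have "integral UNIV ?g = integral UNIV ?f"
    using Henstock_Kurzweil_Integration.integral_restrict_UNIV[of T ?g]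
      Henstock_Kurzweil_Integration.integral_restrict_UNIV[of "\<psi> ` T" ?f] f0 g0 by simp
  then show ?thesis
    using transport[OF f(1)] transport[OF g(1)] by (simp add: integral_lborel)
qed

section \<open>Compactly supported functions\<close>

lemma integrable_continuous_compact_support:
  fixes f :: "'a::euclidean_space \<Rightarrow> 'b::{banach, second_countable_topology}"
  assumes "continuous_on UNIV f" "compact K" "\<And>x. x \<notin> K \<Longrightarrow> f x = 0"
  shows "integrable lborel f"
proof -
  have "integrable lborel (\<lambda>x. indicator K x *\<^sub>R f x)"
    using assms(1,2) by (intro borel_integrable_compact) (auto intro: continuous_on_subset)
  moreover have "(\<lambda>x. indicator K x *\<^sub>R f x) = f"
    using assms(3) by (auto simp: fun_eq_iff indicator_def)
  ultimately show ?thesis by simp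
qed

lemma Ck_on_zero_extension:
  fixes f :: "'a::real_normed_vector \<Rightarrow> 'b::real_normed_vector"
  assumes S: "open S" and f: "Ck_on k S f" and K: "compact K" "K \<subseteq> S"
    and zero: "\<And>x. x \<in> S - K \<Longrightarrow> f x = 0"
  shows "Ck_on k UNIV (\<lambda>x. if x \<in> S then f x else 0)"
proof -
  let ?g = "\<lambda>x. if x \<in> S then f x else 0"
  have op: "open (- K)" using compact_imp_closed[OF K(1)] by (rule open_Compl)
  have "Ck_on k S ?g"
    using f S by (rule Ck_on_eqI) auto
  moreover have "Ck_on k (- K) ?g"
    by (rule Ck_on_eqI[OF Ck_on_const[of k "- K" 0] op]) (use zero in auto)
  ultimately have "Ck_on k (S \<union> - K) ?g"
    using S op by (intro Ck_on_Un)
  moreover have "S \<union> - K = UNIV" using K(2) by auto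
  ultimately show ?thesis by simp
qed

lemma vector_derivative_quotient_tendsto:
  fixes f :: "'a::real_normed_vector \<Rightarrow> 'b::real_normed_vector"
  assumes "((\<lambda>t. f (x + t *\<^sub>R u)) has_vector_derivative D) (at 0)"
  shows "((\<lambda>t. (1 / t) *\<^sub>R (f (x + t *\<^sub>R u) - f x)) \<longlongrightarrow> D) (at 0)"
proof -
  have "((\<lambda>h. norm (f (x + h *\<^sub>R u) - f x - h *\<^sub>R D) / norm h) \<longlongrightarrow> 0) (at 0)"
    using assms unfolding has_vector_derivative_def has_derivative_at by simp
  moreover have "\<forall>\<^sub>F h in at 0. norm (f (x + h *\<^sub>R u) - f x - h *\<^sub>R D) / norm h =
      norm ((1 / h) *\<^sub>R (f (x + h *\<^sub>R u) - f x) - D)"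
  proof (rule eventually_at_filter[THEN iffD2], intro always_eventually allI impI)
    fix h :: real assume "h \<noteq> 0"
    then have "(1 / h) *\<^sub>R (f (x + h *\<^sub>R u) - f x) - D = (1 / h) *\<^sub>R (f (x + h *\<^sub>R u) - f x - h *\<^sub>R D)"
      by (simp add: scaleR_right_diff_distrib)
    then show "norm (f (x + h *\<^sub>R u) - f x - h *\<^sub>R D) / norm h =
      norm ((1 / h) *\<^sub>R (f (x + h *\<^sub>R u) - f x) - D)"
      by (simp add: divide_inverse mult.commute)
  qed
  ultimately have "((\<lambda>h. norm ((1 / h) *\<^sub>R (f (x + h *\<^sub>R u) - f x) - D)) \<longlongrightarrow> 0) (at 0)"
    by (rule Lim_transform_eventually)
  then show ?thesis
    by (simp add: tendsto_norm_zero_iff LIM_zero_iff)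
qed

text \<open>By translation invariance the integral of every difference quotient is zero. The difference quotients
  converge to the derivative and are dominated by a constant on a compact set that contains all their
  supports.\<close>

lemma integral_derivative_compact_support:
  fixes f :: "'a::euclidean_space \<Rightarrow> 'b::euclidean_space"
  assumes f: "Ck_on 1 UNIV f" and K: "compact K" and zero: "\<And>x. x \<notin> K \<Longrightarrow> f x = 0"
  shows "integrable lborel (\<lambda>x. frechet_derivative f (at x) u)"
    and "integral\<^sup>L lborel (\<lambda>x. frechet_derivative f (at x) u) = 0"
proof -
  let ?D = "\<lambda>x. frechet_derivative f (at x) u"
  have der: "(f has_derivative frechet_derivative f (at x)) (at x)" for x
    using f by (simp add: frechet_derivative_works[symmetric])
  have D_cont: "continuous_on UNIV ?D" and f_cont: "continuous_on UNIV f"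
    using f Ck_on_SucD[of 0 UNIV f] by simp_all
  have D0: "?D x = 0" if "x \<notin> K" for x
  proof -
    have "frechet_derivative f (at x) = frechet_derivative (\<lambda>_. 0) (at x)"
      using compact_imp_closed[OF K] that zero
      by (intro frechet_derivative_cong_open[of "- K"]) auto
    then show ?thesis by (simp add: frechet_derivative_const)
  qed
  show intD: "integrable lborel ?D"
    using D_cont K D0 by (rule integrable_continuous_compact_support)
  have f_int: "integrable lborel f"
    using f_cont K zero by (rule integrable_continuous_compact_support)
  have "compact (?D ` K)"
    using D_cont K by (intro compact_continuous_image) (auto intro: continuous_on_subset)
  then obtain B where B: "\<And>x. x \<in> K \<Longrightarrow> norm (?D x) \<le> B"
    unfolding bounded_iff[THEN iffD1, OF compact_imp_bounded] by (meson compact_imp_bounded bounded_iff imageI)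
  (* For empty K the bound B may be negative. *)
  define C where "C = max B 0"
  have C: "norm (?D x) \<le> C" for x
    using B[of x] D0[of x] by (cases "x \<in> K") (auto simp: C_def)
  define K' where "K' = (\<lambda>(y, t). y - t *\<^sub>R u) ` (K \<times> {0..1::real})"
  have K': "compact K'"
    unfolding K'_def using K
    by (intro compact_continuous_image compact_Times) (auto simp: case_prod_beta intro!: continuous_intros)
  define s where "s k x = real (Suc k) *\<^sub>R (f (x + (1 / real (Suc k)) *\<^sub>R u) - f x)" for k x
  have "(\<lambda>k. integral\<^sup>L lborel (s k)) \<longlonglongrightarrow> integral\<^sup>L lborel ?D"
  proof (rule integral_dominated_convergence[where w="\<lambda>x. indicator K' x *\<^sub>R C"])
    show "?D \<in> borel_measurable lborel"
      using D_cont by (simp add: borel_measurable_continuous_onI)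
    show "s k \<in> borel_measurable lborel" for k
    proof -
      have "continuous_on UNIV (s k)"
        unfolding s_def
        by (intro continuous_intros continuous_on_compose2[OF f_cont]) auto
      then show ?thesis by (simp add: borel_measurable_continuous_onI)
    qed
    show "integrable lborel (\<lambda>x. indicator K' x *\<^sub>R C)"
      using K' by (intro borel_integrable_compact) auto
    show "AE x in lborel. (\<lambda>k. s k x) \<longlonglongrightarrow> ?D x"
    proof (rule AE_I2)
      fix x
      have lin: "linear (frechet_derivative f (at x))"
        using der by (rule has_derivative_linear)
      have "((\<lambda>t. f (x + t *\<^sub>R u)) has_derivative (\<lambda>r. frechet_derivative f (at (x + 0 *\<^sub>R u)) (r *\<^sub>R u))) (at 0)"
        by (rule has_derivative_compose[of "\<lambda>t. x + t *\<^sub>R u" "\<lambda>r. r *\<^sub>R u" 0 UNIV f])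
          (use der[of "x + 0 *\<^sub>R u"] in \<open>auto intro!: derivative_eq_intros\<close>)
      then have "((\<lambda>t. f (x + t *\<^sub>R u)) has_vector_derivative ?D x) (at 0)"
        unfolding has_vector_derivative_def by (simp add: linear_cmul[OF lin])
      then have "((\<lambda>t. (1 / t) *\<^sub>R (f (x + t *\<^sub>R u) - f x)) \<longlongrightarrow> ?D x) (at 0)"
        by (rule vector_derivative_quotient_tendsto)
      moreover have "filterlim (\<lambda>k. 1 / real (Suc k)) (at 0) sequentially"
        unfolding filterlim_at using LIMSEQ_inverse_real_of_nat by (simp add: inverse_eq_divide)
      ultimately have "((\<lambda>k. (1 / (1 / real (Suc k))) *\<^sub>R (f (x + (1 / real (Suc k)) *\<^sub>R u) - f x)) \<longlongrightarrow> ?D x) sequentially"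
        by (rule filterlim_compose)
      then show "(\<lambda>k. s k x) \<longlonglongrightarrow> ?D x"
        by (simp add: s_def)
    qed
    show "AE x in lborel. norm (s k x) \<le> indicator K' x *\<^sub>R C" for k
    proof (rule AE_I2)
      fix x
      let ?h = "1 / real (Suc k)"
      show "norm (s k x) \<le> indicator K' x *\<^sub>R C"
      proof (cases "x \<in> K'")
        case False
        have "x \<notin> K" using False unfolding K'_def by force
        moreover have "x + ?h *\<^sub>R u \<notin> K"
        proof
          assume "x + ?h *\<^sub>R u \<in> K"
          then have "(x + ?h *\<^sub>R u, ?h) \<in> K \<times> {0..1}" by auto
          then show False
            using False unfolding K'_def by (metis (no_types, lifting) add_diff_cancel_right' case_prod_conv imageI)
        qed
        ultimately show ?thesis using zero False by (simp add: s_def)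
      next
        case True
        have "norm (f (x + ?h *\<^sub>R u) - f (x + 0 *\<^sub>R u)) \<le> C * norm (?h - 0)"
        proof (rule differentiable_bound[where S = UNIV and f = "\<lambda>t. f (x + t *\<^sub>R u)" and
              f' = "\<lambda>t r. r *\<^sub>R ?D (x + t *\<^sub>R u)"])
          fix t
          have lin: "linear (frechet_derivative f (at (x + t *\<^sub>R u)))"
            using der by (rule has_derivative_linear)
          have "((\<lambda>t. f (x + t *\<^sub>R u)) has_derivative (\<lambda>r. frechet_derivative f (at (x + t *\<^sub>R u)) (r *\<^sub>R u))) (at t)"
            by (rule has_derivative_compose[of "\<lambda>t. x + t *\<^sub>R u" "\<lambda>r. r *\<^sub>R u" t UNIV f])
              (use der[of "x + t *\<^sub>R u"] in \<open>auto intro!: derivative_eq_intros\<close>)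
          then show "((\<lambda>t. f (x + t *\<^sub>R u)) has_derivative (\<lambda>r. r *\<^sub>R ?D (x + t *\<^sub>R u))) (at t)"
            by (simp add: linear_cmul[OF lin])
          show "onorm (\<lambda>r. r *\<^sub>R ?D (x + t *\<^sub>R u)) \<le> C"
          proof (rule onorm_le)
            show "norm (r *\<^sub>R ?D (x + t *\<^sub>R u)) \<le> C * norm r" for r
              using mult_left_mono[OF C[of "x + t *\<^sub>R u"], of "\<bar>r\<bar>"] by (simp add: mult.commute)
          qed
        qed auto
        then have "norm (f (x + ?h *\<^sub>R u) - f x) \<le> C * ?h" by simp
        then have "real (Suc k) * norm (f (x + ?h *\<^sub>R u) - f x) \<le> real (Suc k) * (C * ?h)"
          by (rule mult_left_mono) simp
        then show ?thesis
          using True by (simp add: s_def)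
      qed
    qed
  qed
  moreover have "integral\<^sup>L lborel (s k) = 0" for k
  proof -
    let ?a = "(1 / real (Suc k)) *\<^sub>R u"
    have m: "(+) ?a \<in> measurable lborel borel" by simp
    have "integral\<^sup>L lborel (\<lambda>x. f (?a + x)) = integral\<^sup>L (distr lborel borel ((+) ?a)) f"
      using f_cont by (subst integral_distr[OF m]) (auto intro: borel_measurable_continuous_onI)
    then have "integral\<^sup>L lborel (\<lambda>x. f (x + ?a)) = integral\<^sup>L lborel f"
      unfolding lborel_distr_plus by (simp add: add.commute)
    moreover have "integrable lborel (\<lambda>x. f (x + ?a))"
      using integrable_distr[OF m, of f] f_int unfolding lborel_distr_plus by (simp add: add.commute)
    ultimately show ?thesis
      unfolding s_def using f_int by simp
  qed
  ultimately show "integral\<^sup>L lborel ?D = 0"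
    by (simp add: LIMSEQ_const_iff)
qed

section \<open>Partitions of unity\<close>

lemma positive_part_square_derivative:
  "((\<lambda>t::real. (max 0 t)\<^sup>2) has_real_derivative 2 * max 0 t) (at t)"
proof -
  consider "t > 0" | "t < 0" | "t = 0" by linarith
  then show ?thesis
  proof cases
    case 1
    have "((\<lambda>t::real. t\<^sup>2) has_real_derivative 2 * max 0 t) (at t)"
      using 1 by (auto intro!: derivative_eq_intros)
    then show ?thesis
      by (rule has_field_derivative_transform_within_open[where S = "{0<..}"]) (use 1 in auto)
  next
    case 2
    have "((\<lambda>t::real. 0) has_real_derivative 2 * max 0 t) (at t)"
      using 2 by (auto intro!: derivative_eq_intros)
    then show ?thesis
      by (rule has_field_derivative_transform_within_open[where S = "{..<0}"]) (use 2 in auto)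
  next
    case 3
    have "((\<lambda>h::real. (max 0 h)\<^sup>2 / h) \<longlongrightarrow> 0) (at 0)"
    proof (rule Lim_null_comparison)
      show "\<forall>\<^sub>F h in at 0. norm ((max 0 h)\<^sup>2 / h) \<le> \<bar>h :: real\<bar>"
        by (intro always_eventually) (auto simp: max_def power2_eq_square)
      show "((\<lambda>h::real. \<bar>h\<bar>) \<longlongrightarrow> 0) (at 0)"
        by (intro tendsto_rabs_zero tendsto_ident_at)
    qed
    then show ?thesis
      using 3 by (simp add: DERIV_def)
  qed
qed

text \<open>In coordinates the bump is the square of the positive part of \<open>r\<^sup>2 - |y - a|\<^sup>2\<close>. It is only once continuously
  differentiable, which is enough for a single integration by parts.\<close>

lemma chart_bump:
  fixes A :: "('a::t2_space, 'n::finite) chart set"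
  assumes A: "complex_atlas A" and c: "c \<in> A" and p: "p \<in> fst c"
  obtains K U and b :: "'a \<Rightarrow> real" where "compact K" "K \<subseteq> fst c" "\<And>q. q \<notin> K \<Longrightarrow> b q = 0"
    "open U" "p \<in> U" "\<And>q. q \<in> U \<Longrightarrow> b q > 0" "\<And>q. b q \<ge> 0"
    "\<And>d. d \<in> A \<Longrightarrow> Ck_on 1 (chart_image d) (\<lambda>x. b (inv_into (fst d) (snd d) x))"
proof -
  let ?\<psi> = "\<lambda>d. inv_into (fst d) (snd d)"
  define a where "a = snd c p"
  have hom: "homeomorphism (fst d) (chart_image d) (snd d) (?\<psi> d)" if "d \<in> A" for d
    using complex_atlasD(3)[OF A that] .
  have a: "a \<in> chart_image c" using p by (simp add: a_def chart_image_def)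
  obtain r where r: "r > 0" "cball a r \<subseteq> chart_image c"
    using open_contains_cball complex_atlasD(2)[OF A c] a by blast
  define K where "K = ?\<psi> c ` cball a r"
  define U where "U = fst c \<inter> snd c -` ball a r"
  define m where "m y = r\<^sup>2 - (y - a) \<bullet> (y - a)" for y :: "complex^'n"
  define b where "b q = (if q \<in> fst c then (max 0 (m (snd c q)))\<^sup>2 else 0)" for q
  have m_pos: "m y > 0 \<longleftrightarrow> dist a y < r" for y
  proof -
    have "m y > 0 \<longleftrightarrow> (norm (y - a))\<^sup>2 < r\<^sup>2"
      by (simp add: m_def power2_norm_eq_inner)
    also have "\<dots> \<longleftrightarrow> norm (y - a) < r"
      using r(1) by (metis abs_norm_cancel abs_of_pos power2_less_imp_less power_strict_mono less_imp_le norm_ge_zero zero_less_numeral)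
    finally show ?thesis by (simp add: dist_norm norm_minus_commute)
  qed
  show thesis
  proof
    show K: "compact K"
      unfolding K_def using hom[OF c] r(2)
      by (intro compact_continuous_image) (auto simp: homeomorphism_def intro: continuous_on_subset)
    show Kc: "K \<subseteq> fst c"
      unfolding K_def using r(2) chart_inverse(2)[OF A c] by auto
    show off: "b q = 0" if "q \<notin> K" for q
    proof (cases "q \<in> fst c")
      case True
      then have "snd c q \<notin> cball a r"
        using that chart_inverse(1)[OF A c True] unfolding K_def by force
      then have "\<not> m (snd c q) > 0" unfolding m_pos by simp
      then show ?thesis by (simp add: b_def)
    qed (simp add: b_def)
    show "open U"
      unfolding U_def using hom[OF c] complex_atlasD(1)[OF A c]
      by (intro continuous_open_preimage) (auto simp: homeomorphism_def)
    show "p \<in> U" using p r(1) by (simp add: U_def a_def)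
    show "b q > 0" if "q \<in> U" for q
      using that m_pos[of "snd c q"] by (simp add: U_def b_def)
    show "b q \<ge> 0" for q by (simp add: b_def)
    fix d assume d: "d \<in> A"
    (* On V the bump vanishes, on the overlap with c it is known; together they cover the chart d. *)
    define V where "V = chart_image d \<inter> ?\<psi> d -` (- K)"
    have "open (- K)" using compact_imp_closed[OF K] by (rule open_Compl)
    then have V: "open V"
      unfolding V_def using hom[OF d] complex_atlasD(2)[OF A d]
      by (intro continuous_open_preimage) (auto simp: homeomorphism_def)
    have W: "open (overlap d c)" by (rule open_overlap[OF A d c])
    have "Ck_on 1 V (\<lambda>x. b (?\<psi> d x))"
      by (rule Ck_on_eqI[OF Ck_on_const[of 1 V 0] V]) (auto simp: V_def off)
    moreover have "Ck_on 1 (overlap d c) (\<lambda>x. b (?\<psi> d x))"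
    proof -
      have T: "Ck_on 1 (overlap d c) (transition d c)"
        using A d c unfolding complex_atlas_def holomorphic_map_on_def smooth_on_def by blast
      have shift: "Ck_on 1 (overlap d c) (\<lambda>x. transition d c x + (- a))"
        by (rule Ck_on_add[OF W T Ck_on_const])
      have sq: "Ck_on 1 (overlap d c) (\<lambda>x. (transition d c x + (- a)) \<bullet> (transition d c x + (- a)))"
        by (rule bounded_bilinear.Ck_on_prod[OF bounded_bilinear_inner W shift shift])
      have "Ck_on 1 (overlap d c) (\<lambda>x. r\<^sup>2 + (- 1) * ((transition d c x + (- a)) \<bullet> (transition d c x + (- a))))"
        by (rule Ck_on_add[OF W Ck_on_const bounded_bilinear.Ck_on_prod[OF bounded_bilinear_mult W Ck_on_const sq]])
      then have "Ck_on 1 (overlap d c) (\<lambda>x. m (transition d c x))"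
        by (rule Ck_on_eqI[OF _ W]) (simp add: m_def)
      then have "Ck_on 1 (overlap d c) (\<lambda>x. (max 0 (m (transition d c x)))\<^sup>2)"
        by (intro C1_on_compose_real[OF W, of "\<lambda>x. m (transition d c x)" "\<lambda>t. (max 0 t)\<^sup>2" "\<lambda>t. 2 * max 0 t"]
            positive_part_square_derivative continuous_intros)
      then show ?thesis
      proof (rule Ck_on_eqI[OF _ W])
        fix x assume "x \<in> overlap d c"
        from overlapE[OF A d this] show "b (?\<psi> d x) = (max 0 (m (transition d c x)))\<^sup>2"
          by (metis b_def)
      qed
    qed
    ultimately have "Ck_on 1 (V \<union> overlap d c) (\<lambda>x. b (?\<psi> d x))"
      using V W by (rule Ck_on_Un)
    moreover have "V \<union> overlap d c = chart_image d"
    proof -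
      have "x \<in> overlap d c" if "x \<in> chart_image d" "?\<psi> d x \<in> K" for x
        using that chart_inverse(2,3)[OF A d that(1)] Kc unfolding overlap_def by force
      then show ?thesis using overlap_subset[of d c] by (auto simp: V_def)
    qed
    ultimately show "Ck_on 1 (chart_image d) (\<lambda>x. b (?\<psi> d x))" by simp
  qed
qed

lemma C1_partition_of_unity:
  fixes A :: "('a::t2_space, 'n::finite) chart set"
  assumes M: "compact_complex_manifold A"
  obtains P :: "'a set" and c K and \<rho> :: "'a \<Rightarrow> 'a \<Rightarrow> real" where
    "finite P" "\<And>p. c p \<in> A" "\<And>p. compact (K p)" "\<And>p. K p \<subseteq> fst (c p)"
    "\<And>p q. q \<notin> K p \<Longrightarrow> \<rho> p q = 0" "\<And>p q. \<rho> p q \<ge> 0" "\<And>q. (\<Sum>p\<in>P. \<rho> p q) = 1"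
    "\<And>p d. d \<in> A \<Longrightarrow> Ck_on 1 (chart_image d) (\<lambda>x. \<rho> p (inv_into (fst d) (snd d) x))"
proof -
  have A: "complex_atlas A" and comp: "compact (UNIV :: 'a set)"
    using M by (auto simp: compact_complex_manifold_def)
  let ?\<psi> = "\<lambda>d. inv_into (fst d) (snd d)"
  have "\<exists>c K U b. c \<in> A \<and> compact K \<and> K \<subseteq> fst c \<and> (\<forall>q. q \<notin> K \<longrightarrow> b q = 0) \<and> open U \<and> p \<in> U \<and>
      (\<forall>q\<in>U. b q > 0) \<and> (\<forall>q. b q \<ge> (0::real)) \<and> (\<forall>d\<in>A. Ck_on 1 (chart_image d) (\<lambda>x. b (?\<psi> d x)))" for p
  proof -
    have "p \<in> (\<Union>c\<in>A. fst c)"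
      using A by (simp add: complex_atlas_def)
    then obtain c where c: "c \<in> A" "p \<in> fst c" by auto
    show ?thesis
    proof (rule chart_bump[OF A c])
      fix K U and b :: "'a \<Rightarrow> real"
      assume *: "compact K" "K \<subseteq> fst c" "\<And>q. q \<notin> K \<Longrightarrow> b q = 0" "open U" "p \<in> U"
        "\<And>q. q \<in> U \<Longrightarrow> b q > 0" "\<And>q. b q \<ge> 0"
        "\<And>d. d \<in> A \<Longrightarrow> Ck_on 1 (chart_image d) (\<lambda>x. b (?\<psi> d x))"
      show ?thesis
        by (rule exI[of _ c], rule exI[of _ K], rule exI[of _ U], rule exI[of _ b])
          (intro conjI c(1) * ballI allI impI; assumption)
    qed
  qed
  then obtain c K U b where cA: "\<And>p. c p \<in> A" and K: "\<And>p. compact (K p)" "\<And>p. K p \<subseteq> fst (c p)"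
    and off: "\<And>p q. q \<notin> K p \<Longrightarrow> b p q = 0" and U: "\<And>p. open (U p)" "\<And>p. p \<in> U p"
    and pos: "\<And>p q. q \<in> U p \<Longrightarrow> b p q > 0" and nonneg: "\<And>p q. b p q \<ge> (0::real)"
    and C1: "\<And>p d. d \<in> A \<Longrightarrow> Ck_on 1 (chart_image d) (\<lambda>x. b p (?\<psi> d x))"
    by metis
  have "UNIV \<subseteq> (\<Union>p\<in>UNIV. U p)" using U(2) by auto
  from compactE_image[OF comp _ this] U(1) obtain P where P: "finite P" "UNIV \<subseteq> (\<Union>p\<in>P. U p)"
    by metis
  define S where "S q = (\<Sum>p\<in>P. b p q)" for q
  have S: "S q > 0" for q
  proof -
    obtain p where "p \<in> P" "q \<in> U p" using P(2) by blast
    then show ?thesis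
      unfolding S_def using P(1) nonneg pos by (intro sum_pos2[of _ p]) auto
  qed
  define \<rho> where "\<rho> p q = b p q * inverse (S q)" for p q
  show thesis
  proof (rule that[of P c K \<rho>])
    show "\<rho> p q = 0" if "q \<notin> K p" for p q using off[OF that] by (simp add: \<rho>_def)
    show "\<rho> p q \<ge> 0" for p q using nonneg S[of q] by (simp add: \<rho>_def)
    show "(\<Sum>p\<in>P. \<rho> p q) = 1" for q
      using S[of q] unfolding \<rho>_def sum_distrib_right[symmetric] S_def[symmetric] by simp
    fix p d assume d: "d \<in> A"
    note op = complex_atlasD(2)[OF A d]
    have "Ck_on 1 (chart_image d) (\<lambda>x. S (?\<psi> d x))"
      unfolding S_def by (intro Ck_on_sum[OF op] C1[OF d])
    then have "Ck_on 1 (chart_image d) (\<lambda>x. inverse (S (?\<psi> d x)))"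
    proof (rule C1_on_compose_real[OF op, of _ inverse "\<lambda>t. - (inverse t ^ Suc (Suc 0))"])
      fix t assume "t \<in> (\<lambda>x. S (?\<psi> d x)) ` chart_image d"
      then have "t \<noteq> 0" using S by (metis imageE less_irrefl)
      then show "(inverse has_real_derivative - (inverse t ^ Suc (Suc 0))) (at t)"
        by (rule DERIV_inverse)
    next
      have "t \<noteq> 0" if "t \<in> (\<lambda>x. S (?\<psi> d x)) ` chart_image d" for t
        using that S by (metis imageE less_irrefl)
      then show "continuous_on ((\<lambda>x. S (?\<psi> d x)) ` chart_image d) (\<lambda>t. - (inverse t ^ Suc (Suc 0)))"
        by (intro continuous_intros) auto
    qed
    then show "Ck_on 1 (chart_image d) (\<lambda>x. \<rho> p (?\<psi> d x))"
      unfolding \<rho>_def by (intro bounded_bilinear.Ck_on_prod[OF bounded_bilinear_mult op] C1[OF d])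
  qed (use P cA K in auto)
qed

section \<open>Wirtinger derivatives\<close>

lemma diff_vector_add:
  assumes "f differentiable (at x)"
  shows "diff10 f x (u + w) = diff10 f x u + diff10 f x w" "diff01 f x (u + w) = diff01 f x u + diff01 f x w"
  using linear_frechet_derivative[OF assms]
  by (simp_all add: diff10_def diff01_def vector_add_ldistrib linear_add add_divide_distrib
      diff_divide_distrib algebra_simps)

lemma diff_mult:
  assumes "f differentiable (at x)" "g differentiable (at x)"
  shows "diff10 (\<lambda>y. f y * g y) x u = f x * diff10 g x u + diff10 f x u * g x"
    and "diff01 (\<lambda>y. f y * g y) x u = f x * diff01 g x u + diff01 f x u * g x"
  unfolding diff10_def diff01_def bounded_bilinear.frechet_derivative_prod[OF bounded_bilinear_mult assms]
  by (simp_all add: field_simps)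

lemma diff_sum:
  assumes "\<And>m. m \<in> I \<Longrightarrow> f m differentiable (at x)"
  shows "diff10 (\<lambda>y. \<Sum>m\<in>I. f m y) x u = (\<Sum>m\<in>I. diff10 (f m) x u)"
  using diff_sum_cmult(1)[of I f x "\<lambda>_. 1" u] assms by simp

lemma diff_eq_derivative:
  "diff10 f x u = (1 / 2) * (frechet_derivative f (at x) u + (- \<i>) * frechet_derivative f (at x) (\<i> *s u))"
  "diff01 f x u = (1 / 2) * (frechet_derivative f (at x) u + \<i> * frechet_derivative f (at x) (\<i> *s u))"
  by (simp_all add: diff10_def diff01_def)

lemma Ck_on_diff:
  assumes "open S" "Ck_on (Suc k) S f"
  shows "Ck_on k S (\<lambda>y. diff10 f y u)" "Ck_on k S (\<lambda>y. diff01 f y u)"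
proof -
  note mult = bounded_bilinear.Ck_on_prod[OF bounded_bilinear_mult assms(1)]
  have D: "Ck_on k S (\<lambda>y. frechet_derivative f (at y) u)" for u
    using assms(2) by simp
  show "Ck_on k S (\<lambda>y. diff10 f y u)" "Ck_on k S (\<lambda>y. diff01 f y u)"
    unfolding diff_eq_derivative by (rule mult Ck_on_const Ck_on_add[OF assms(1)] D)+
qed

lemma smooth_on_diff:
  assumes "open S" "smooth_on S f"
  shows "smooth_on S (\<lambda>y. diff10 f y u)" "smooth_on S (\<lambda>y. diff01 f y u)"
  using assms Ck_on_diff unfolding smooth_on_def by blast+

text \<open>Both sides are the same combination of second derivatives, up to the order of differentiation.\<close>

lemma diff_commute:
  assumes S: "open S" "smooth_on S f" "x \<in> S"
  shows "diff10 (\<lambda>y. diff10 f y a) x b = diff10 (\<lambda>y. diff10 f y b) x a"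
    and "diff01 (\<lambda>y. diff10 f y a) x b = diff10 (\<lambda>y. diff01 f y b) x a"
proof -
  define H where "H a b = frechet_derivative (\<lambda>y. frechet_derivative f (at y) a) (at x) b" for a b
  have sym: "H a b = H b a" for a b
    unfolding H_def by (rule second_derivative_symmetric[OF S(1) smooth_onD[OF S(2)] S(3)])
  have H: "((\<lambda>y. frechet_derivative f (at y) a) has_derivative H a) (at x)" for a
    using smooth_on_differentiable[OF smooth_on_derivative[OF S(2)] S(3), of a]
    unfolding H_def frechet_derivative_works .
  have 10: "frechet_derivative (\<lambda>y. diff10 f y a) (at x) = (\<lambda>b. (1 / 2) * (H a b + (- \<i>) * H (\<i> *s a) b))" for a
    unfolding diff_eq_derivative
    by (rule frechet_derivative_eqI) (intro has_derivative_mult_right has_derivative_add H)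
  have 01: "frechet_derivative (\<lambda>y. diff01 f y a) (at x) = (\<lambda>b. (1 / 2) * (H a b + \<i> * H (\<i> *s a) b))" for a
    unfolding diff_eq_derivative
    by (rule frechet_derivative_eqI) (intro has_derivative_mult_right has_derivative_add H)
  note s = sym[of b a] sym[of "\<i> *s b" a] sym[of b "\<i> *s a"] sym[of "\<i> *s b" "\<i> *s a"]
  show "diff10 (\<lambda>y. diff10 f y a) x b = diff10 (\<lambda>y. diff10 f y b) x a"
    unfolding diff_eq_derivative(1)[of "\<lambda>y. diff10 f y _"] 10 s by (simp add: algebra_simps)
  show "diff01 (\<lambda>y. diff10 f y a) x b = diff10 (\<lambda>y. diff01 f y b) x a"
    unfolding diff_eq_derivative(2)[of "\<lambda>y. diff10 f y _"] diff_eq_derivative(1)[of "\<lambda>y. diff01 f y _"] 10 01 s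
    by (simp add: algebra_simps)
qed

section \<open>Forms of type (2,0) and their derivatives\<close>

text \<open>Forms of type (2,0) in degree two. Additivity and skew symmetry are contained in membership in
  \<open>smooth_forms\<close>.\<close>

definition complex_bilinear_form :: "('a::t2_space, 'n::finite) chart set \<Rightarrow> ('a, 'n) form \<Rightarrow> bool" where
  "complex_bilinear_form A \<theta> \<longleftrightarrow> \<theta> \<in> smooth_forms A \<and>
     (\<forall>c\<in>A. \<forall>x\<in>chart_image c. \<forall>z u w. \<theta> c x [z *s u, w] = z * \<theta> c x [u, w])"

lemma complex_bilinear_formD:
  assumes "complex_bilinear_form A \<theta>"
  shows "\<theta> \<in> smooth_forms A"
    and "c \<in> A \<Longrightarrow> x \<in> chart_image c \<Longrightarrow> \<theta> c x [z *s u, w] = z * \<theta> c x [u, w]"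
    and "c \<in> A \<Longrightarrow> x \<in> chart_image c \<Longrightarrow> \<theta> c x [u, z *s w] = z * \<theta> c x [u, w]"
    and "c \<in> A \<Longrightarrow> x \<in> chart_image c \<Longrightarrow> \<theta> c x [u + u', w] = \<theta> c x [u, w] + \<theta> c x [u', w]"
    and "c \<in> A \<Longrightarrow> x \<in> chart_image c \<Longrightarrow> \<theta> c x [u, w + w'] = \<theta> c x [u, w] + \<theta> c x [u, w']"
    and "c \<in> A \<Longrightarrow> x \<in> chart_image c \<Longrightarrow> \<theta> c x [w, u] = - \<theta> c x [u, w]"
proof -
  show sm: "\<theta> \<in> smooth_forms A" using assms by (simp add: complex_bilinear_form_def)
  assume c: "c \<in> A" "x \<in> chart_image c"
  note L = smooth_formsD(2)[OF sm c]
  show z: "\<theta> c x [z *s u, w] = z * \<theta> c x [u, w]" for u w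
    using assms c by (simp add: complex_bilinear_form_def)
  show "\<theta> c x [u + u', w] = \<theta> c x [u, w] + \<theta> c x [u', w]" "\<theta> c x [u, w + w'] = \<theta> c x [u, w] + \<theta> c x [u, w']"
    by (rule alternating_two[OF L])+
  show sk: "\<theta> c x [w, u] = - \<theta> c x [u, w]" for u w
    by (rule alternating_two(6)[OF L])
  show "\<theta> c x [u, z *s w] = z * \<theta> c x [u, w]"
    using z[of w u] sk[of "z *s w" u] sk[of w u] by simp
qed

lemma complex_bilinear_form_expansion:
  fixes \<theta> :: "('a::t2_space, 'n::finite) form"
  assumes "complex_bilinear_form A \<theta>" "c \<in> A" "x \<in> chart_image c"
  shows "\<theta> c x [u, w] = (\<Sum>k\<in>UNIV. \<Sum>l\<in>UNIV. u $ k * w $ l * \<theta> c x [axis k 1, axis l 1])"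
proof -
  note D = complex_bilinear_formD(2-5)[OF assms]
  have "\<theta> c x [u, w] = (\<Sum>k\<in>UNIV. u $ k * \<theta> c x [axis k 1, w])"
    by (rule complex_linear_expansion[of "\<lambda>u. \<theta> c x [u, w]" "\<lambda>z. z"]) (rule D)+
  also have "\<dots> = (\<Sum>k\<in>UNIV. u $ k * (\<Sum>l\<in>UNIV. w $ l * \<theta> c x [axis k 1, axis l 1]))"
    by (intro sum.cong refl arg_cong2[where f="(*)"] complex_linear_expansion[of "\<lambda>w. \<theta> c x [_, w]" "\<lambda>z. z"]) (rule D)+
  finally show ?thesis by (simp add: sum_distrib_left mult.assoc)
qed

lemma del_three:
  assumes "c \<in> A" "x \<in> chart_image c"
  shows "del A \<alpha> c x [a, b, e] = diff10 (\<lambda>y. \<alpha> c y [b, e]) x a - diff10 (\<lambda>y. \<alpha> c y [a, e]) x b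
      + diff10 (\<lambda>y. \<alpha> c y [a, b]) x e"
    and "delbar A \<alpha> c x [a, b, e] = diff01 (\<lambda>y. \<alpha> c y [b, e]) x a - diff01 (\<lambda>y. \<alpha> c y [a, e]) x b
      + diff01 (\<lambda>y. \<alpha> c y [a, b]) x e"
  by (simp_all add: del_apply[OF assms] lessThan_Suc)

text \<open>Linearity in the first argument and the two adjacent transpositions generate all the other rules.\<close>

definition alternating_trilinear :: "(complex^'n \<Rightarrow> complex^'n \<Rightarrow> complex^'n \<Rightarrow> complex) \<Rightarrow> bool" where
  "alternating_trilinear F \<longleftrightarrow> (\<forall>a a' b e. F (a + a') b e = F a b e + F a' b e) \<and>
     (\<forall>z a b e. F (z *s a) b e = z * F a b e) \<and>
     (\<forall>a b e. F b a e = - F a b e) \<and> (\<forall>a b e. F a e b = - F a b e)"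

lemma alternating_trilinearD:
  assumes "alternating_trilinear F"
  shows "F (a + a') b e = F a b e + F a' b e" "F a (b + b') e = F a b e + F a b' e"
    "F a b (e + e') = F a b e + F a b e'" "F (z *s a) b e = z * F a b e" "F a (z *s b) e = z * F a b e"
    "F a b (z *s e) = z * F a b e" "F b a e = - F a b e" "F a e b = - F a b e"
    "F a a e = 0" "F a b b = 0" "F a b a = 0"
proof -
  show 1: "F (a + a') b e = F a b e + F a' b e" "F (z *s a) b e = z * F a b e" for a a' b e
    using assms unfolding alternating_trilinear_def by blast+
  show 2: "F b a e = - F a b e" "F a e b = - F a b e" for a b e
    using assms unfolding alternating_trilinear_def by blast+
  show 3: "F a (b + b') e = F a b e + F a b' e" "F a (z *s b) e = z * F a b e" for a b b' e
    using 1(1)[of b b' a e] 1(2)[of b a e] 2(1)[of a "b + b'" e] 2(1)[of a b e] 2(1)[of a b' e] 2(1)[of a "z *s b" e]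
    by simp_all
  show "F a b (e + e') = F a b e + F a b e'" "F a b (z *s e) = z * F a b e"
    using 3(1)[of a e e' b] 3(2)[of a e b] 2(2)[of a b "e + e'"] 2(2)[of a b e] 2(2)[of a b e'] 2(2)[of a b "z *s e"]
    by simp_all
  have zero: "z = 0" if "z = - z" for z :: complex using that by simp
  show "F a a e = 0" "F a b b = 0" for a b e
    using zero 2(1)[of a a e] 2(2)[of a b b] by blast+
  then show "F a b a = 0" using 2(1)[of a b a] by simp
qed

lemma det_three:
  fixes M :: "'a::comm_ring_1^'n::finite^'n"
  assumes U: "UNIV = {i, j, k :: 'n}" and d: "i \<noteq> j" "i \<noteq> k" "j \<noteq> k"
  shows "det M = M $ i $ i * M $ j $ j * M $ k $ k + M $ i $ j * M $ j $ k * M $ k $ i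
     + M $ i $ k * M $ j $ i * M $ k $ j - M $ i $ i * M $ j $ k * M $ k $ j
     - M $ i $ j * M $ j $ i * M $ k $ k - M $ i $ k * M $ j $ j * M $ k $ i"
proof -
  have f: "finite {j, k}" "i \<notin> {j, k}" "finite {k}" "j \<notin> {k}"
    using d by auto
  show ?thesis
    unfolding det_def U sum_over_permutations_insert[OF f(1,2)] sum_over_permutations_insert[OF f(3,4)]
      permutes_sing
    using d by (simp add: sign_swap_id permutation_swap_id sign_compose sign_id swap_id_eq algebra_simps
        Transposition.transpose_def)
qed

text \<open>Of the 27 terms of the expansion in columns, the six with distinct basis vectors survive.\<close>

lemma alternating_trilinear_det:
  fixes M :: "complex^'n::finite^'n"
  assumes F: "alternating_trilinear F" and U: "UNIV = {i, j, k :: 'n}" and d: "i \<noteq> j" "i \<noteq> k" "j \<noteq> k"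
  shows "F (M *v axis i 1) (M *v axis j 1) (M *v axis k 1) = det M * F (axis i 1) (axis j 1) (axis k 1)"
proof -
  have exp: "v = v $ i *s axis i 1 + v $ j *s axis j 1 + v $ k *s axis k 1" for v :: "complex^'n"
    using basis_expansion[of v] d unfolding U by (simp add: add.assoc)
  have col: "M *v axis l 1 = M $ i $ l *s axis i 1 + M $ j $ l *s axis j 1 + M $ k $ l *s axis k 1" for l
    by (subst exp) (simp add: matrix_vector_mult_def axis_def if_distrib cong: if_cong)
  note D = alternating_trilinearD[OF F]
  let ?ei = "axis i 1" and ?ej = "axis j 1" and ?ek = "axis k 1"
  have perm: "F ?ej ?ei ?ek = - F ?ei ?ej ?ek" "F ?ei ?ek ?ej = - F ?ei ?ej ?ek"
    "F ?ek ?ej ?ei = - F ?ei ?ej ?ek" "F ?ej ?ek ?ei = F ?ei ?ej ?ek" "F ?ek ?ei ?ej = F ?ei ?ej ?ek"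
    using D(7)[of ?ej ?ei ?ek] D(8)[of ?ei ?ek ?ej] D(8)[of ?ek ?ej ?ei] D(7)[of ?ek ?ei ?ej]
      D(8)[of ?ej ?ek ?ei] by simp_all
  show ?thesis
    unfolding col[of i] col[of j] col[of k] D(1-6) D(9-11) perm det_three[OF U d]
    by (simp add: algebra_simps)
qed

lemma alternating_trilinear_del:
  assumes A: "complex_atlas A" and \<theta>: "complex_bilinear_form A \<theta>" and c: "c \<in> A" "x \<in> chart_image c"
  shows "alternating_trilinear (\<lambda>a b e. del A \<theta> c x [a, b, e])"
proof -
  note sm = complex_bilinear_formD(1)[OF \<theta>]
  note op = complex_atlasD(2)[OF A c(1)]
  note df = smooth_forms_differentiable[OF sm c]
  have add1: "diff10 (\<lambda>y. \<theta> c y [a + a', b]) x u = diff10 (\<lambda>y. \<theta> c y [a, b]) x u + diff10 (\<lambda>y. \<theta> c y [a', b]) x u" for a a' b u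
    using diff_cong_open(1)[OF op c(2), of "\<lambda>y. \<theta> c y [a + a', b]" "\<lambda>y. \<theta> c y [a, b] + \<theta> c y [a', b]" u]
      complex_bilinear_formD(4)[OF \<theta> c(1)] by (simp add: diff_add(1)[OF df df])
  have scale1: "diff10 (\<lambda>y. \<theta> c y [z *s a, b]) x u = z * diff10 (\<lambda>y. \<theta> c y [a, b]) x u" for z a b u
    using diff_cong_open(1)[OF op c(2), of "\<lambda>y. \<theta> c y [z *s a, b]" "\<lambda>y. z * \<theta> c y [a, b]" u]
      complex_bilinear_formD(2)[OF \<theta> c(1)] by (simp add: diff_cmult(1)[OF df])
  have skew: "diff10 (\<lambda>y. \<theta> c y [b, a]) x u = - diff10 (\<lambda>y. \<theta> c y [a, b]) x u" for a b u
    using diff_cong_open(1)[OF op c(2), of "\<lambda>y. \<theta> c y [b, a]" "\<lambda>y. - 1 * \<theta> c y [a, b]" u]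
      complex_bilinear_formD(6)[OF \<theta> c(1), of _ b a] diff_cmult(1)[OF df, of "- 1" "[a, b]" u] by simp
  show ?thesis
    unfolding alternating_trilinear_def del_three[OF c]
  proof (intro conjI allI)
    fix a b e
    show "diff10 (\<lambda>y. \<theta> c y [a, e]) x b - diff10 (\<lambda>y. \<theta> c y [b, e]) x a + diff10 (\<lambda>y. \<theta> c y [b, a]) x e =
      - (diff10 (\<lambda>y. \<theta> c y [b, e]) x a - diff10 (\<lambda>y. \<theta> c y [a, e]) x b + diff10 (\<lambda>y. \<theta> c y [a, b]) x e)"
      using skew[of b a e] by simp
    show "diff10 (\<lambda>y. \<theta> c y [e, b]) x a - diff10 (\<lambda>y. \<theta> c y [a, b]) x e + diff10 (\<lambda>y. \<theta> c y [a, e]) x b =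
      - (diff10 (\<lambda>y. \<theta> c y [b, e]) x a - diff10 (\<lambda>y. \<theta> c y [a, e]) x b + diff10 (\<lambda>y. \<theta> c y [a, b]) x e)"
      using skew[of e b a] by simp
  qed (simp_all add: add1 scale1 diff_vector_add(1)[OF df] diff_vector_scale(1)[OF df] algebra_simps)
qed

lemma alternating_trilinear_wedge:
  assumes \<theta>: "complex_bilinear_form A \<theta>" and c: "c \<in> A" "x \<in> chart_image c"
    and \<sigma>: "\<And>u w. \<sigma> (u + w) = \<sigma> u + \<sigma> w" "\<And>z u. \<sigma> (z *s u) = z * \<sigma> u"
  shows "alternating_trilinear (\<lambda>a b e. \<sigma> a * \<theta> c x [b, e] - \<sigma> b * \<theta> c x [a, e] + \<sigma> e * \<theta> c x [a, b])"
proof -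
  note D = complex_bilinear_formD[OF \<theta>]
  show ?thesis
    unfolding alternating_trilinear_def
  proof (intro conjI allI)
    fix a b e
    show "\<sigma> b * \<theta> c x [a, e] - \<sigma> a * \<theta> c x [b, e] + \<sigma> e * \<theta> c x [b, a] =
      - (\<sigma> a * \<theta> c x [b, e] - \<sigma> b * \<theta> c x [a, e] + \<sigma> e * \<theta> c x [a, b])"
      using D(6)[OF c, of b a] by simp
    show "\<sigma> a * \<theta> c x [e, b] - \<sigma> e * \<theta> c x [a, b] + \<sigma> b * \<theta> c x [a, e] =
      - (\<sigma> a * \<theta> c x [b, e] - \<sigma> b * \<theta> c x [a, e] + \<sigma> e * \<theta> c x [a, b])"
      using D(6)[OF c, of e b] by simp
  qed (simp_all add: D(2,4)[OF c] \<sigma> algebra_simps)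
qed

text \<open>Naturality of the exterior derivative for forms of type (2,0). Differentiating the pullback also
  differentiates the Jacobian of the transition map, which produces the terms with its second
  derivative \<open>Q\<close>. These cancel in the alternating sum, since \<open>Q\<close> is symmetric.\<close>

lemma del_natural:
  fixes \<theta> :: "('a::t2_space, 'n::finite) form"
  assumes A: "complex_atlas A" and \<theta>: "complex_bilinear_form A \<theta>"
    and cd: "c \<in> A" "d \<in> A" "x \<in> overlap c d"
  defines "T \<equiv> frechet_derivative (transition c d) (at x)"
  shows "del A \<theta> c x [a, b, e] = del A \<theta> d (transition c d x) [T a, T b, T e]"
proof -
  let ?\<phi> = "transition c d" and ?W = "overlap c d"
  note sm = complex_bilinear_formD(1)[OF \<theta>]
  have W: "open ?W" by (rule open_overlap[OF A cd(1,2)])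
  have xc: "x \<in> chart_image c" using overlap_subset cd(3) by blast
  have xd: "?\<phi> x \<in> chart_image d" by (rule transition_in_chart_image[OF A cd(1,3)])
  have sm\<phi>: "smooth_on ?W ?\<phi>"
    using A cd(1,2) unfolding complex_atlas_def holomorphic_map_on_def by blast
  note T = transition_derivative[OF A cd(1,2)]
  define h where "h k l z = \<theta> d z [axis k 1, axis l 1]" for k l z
  define B where "B k b y = frechet_derivative ?\<phi> (at y) b $ k" for k b y
  define Q where "Q a b = (\<chi> k. diff10 (B k b) x a)" for a b
  have Bx: "B k b x = T b $ k" for k b by (simp add: B_def T_def)
  have B_smooth: "smooth_on ?W (B k b)" for k b
    unfolding B_def[abs_def]
    by (rule smooth_on_bounded_linear[OF bounded_linear_vec_nth W smooth_on_derivative[OF sm\<phi>]])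
  note B_df = smooth_on_differentiable[OF B_smooth cd(3)]
  have \<phi>_smooth: "smooth_on ?W (\<lambda>y. ?\<phi> y $ k)" for k
    by (rule smooth_on_bounded_linear[OF bounded_linear_vec_nth W sm\<phi>])
  have B_eq: "B k b y = diff10 (\<lambda>y. ?\<phi> y $ k) y b" if "y \<in> ?W" for k b y
  proof -
    have "frechet_derivative (\<lambda>y. ?\<phi> y $ k) (at y) = (\<lambda>u. frechet_derivative ?\<phi> (at y) u $ k)"
      by (rule frechet_derivative_bounded_linear_comp[OF bounded_linear_vec_nth smooth_on_differentiable[OF sm\<phi> that]])
    then show ?thesis
      using T(3)[OF that] by (simp add: diff10_def B_def)
  qed
  have Q_sym: "Q a b = Q b a" for a b
  proof -
    have "diff10 (B k b) x a = diff10 (\<lambda>y. diff10 (\<lambda>y. ?\<phi> y $ k) y b) x a" for k a b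
      by (rule diff_cong_open(1)[OF W cd(3)]) (rule B_eq)
    then show ?thesis
      using diff_commute(1)[OF W \<phi>_smooth cd(3)] by (simp add: Q_def vec_eq_iff)
  qed
  have h_df: "h k l differentiable (at (?\<phi> x))" for k l
    unfolding h_def[abs_def] by (rule smooth_forms_differentiable[OF sm cd(2) xd])
  have chain: "((\<lambda>y. h k l (?\<phi> y)) has_derivative (\<lambda>u. frechet_derivative (h k l) (at (?\<phi> x)) (T u))) (at x)" for k l
    unfolding T_def
    by (rule has_derivative_compose[OF T(1)[OF cd(3)] h_df[unfolded frechet_derivative_works]])
  have h\<phi>_df: "(\<lambda>y. h k l (?\<phi> y)) differentiable (at x)" for k l
    using chain by (auto simp: differentiable_def)
  have Ti: "T (\<i> *s u) = \<i> *s T u" for u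
    unfolding T_def by (rule T(3)[OF cd(3)])
  have h\<phi>: "diff10 (\<lambda>y. h k l (?\<phi> y)) x u = diff10 (h k l) (?\<phi> x) (T u)" for k l u
    unfolding diff10_def frechet_derivative_eqI[OF chain] Ti ..
  have main: "diff10 (\<lambda>y. \<theta> c y [b, e]) x a =
      \<theta> d (?\<phi> x) [Q a b, T e] + \<theta> d (?\<phi> x) [T b, Q a e] + diff10 (\<lambda>z. \<theta> d z [T b, T e]) (?\<phi> x) (T a)" for a b e
  proof -
    have 1: "\<theta> c y [b, e] = (\<Sum>k\<in>UNIV. \<Sum>l\<in>UNIV. B k b y * B l e y * h k l (?\<phi> y))" if "y \<in> ?W" for y
    proof -
      have "\<theta> c y [b, e] = \<theta> d (?\<phi> y) [frechet_derivative ?\<phi> (at y) b, frechet_derivative ?\<phi> (at y) e]"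
        using smooth_formsD(4)[OF sm cd(1,2) that, of "[b, e]"] by simp
      then show ?thesis
        unfolding complex_bilinear_form_expansion[OF \<theta> cd(2) transition_in_chart_image[OF A cd(1) that],
            of "frechet_derivative _ _ _"] B_def h_def .
    qed
    have "diff10 (\<lambda>y. \<theta> c y [b, e]) x a = diff10 (\<lambda>y. \<Sum>k\<in>UNIV. \<Sum>l\<in>UNIV. B k b y * B l e y * h k l (?\<phi> y)) x a"
      by (rule diff_cong_open(1)[OF W cd(3) 1])
    also have "\<dots> = (\<Sum>k\<in>UNIV. \<Sum>l\<in>UNIV. diff10 (\<lambda>y. B k b y * B l e y * h k l (?\<phi> y)) x a)"
      using B_df h\<phi>_df by (subst diff_sum, fastforce intro!: derivative_intros, subst diff_sum)
        (auto intro!: derivative_intros)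
    also have "\<dots> = (\<Sum>k\<in>UNIV. \<Sum>l\<in>UNIV. Q a b $ k * T e $ l * h k l (?\<phi> x) + T b $ k * Q a e $ l * h k l (?\<phi> x)
        + T b $ k * T e $ l * diff10 (h k l) (?\<phi> x) (T a))"
    proof (intro sum.cong refl)
      fix k l
      have "(\<lambda>y. B k b y * B l e y) differentiable (at x)"
        using B_df by (intro differentiable_mult)
      then show "diff10 (\<lambda>y. B k b y * B l e y * h k l (?\<phi> y)) x a =
         Q a b $ k * T e $ l * h k l (?\<phi> x) + T b $ k * Q a e $ l * h k l (?\<phi> x)
        + T b $ k * T e $ l * diff10 (h k l) (?\<phi> x) (T a)"
        by (simp add: diff_mult(1) B_df h\<phi>_df h\<phi> Bx Q_def algebra_simps)
    qed
    also have "\<dots> = \<theta> d (?\<phi> x) [Q a b, T e] + \<theta> d (?\<phi> x) [T b, Q a e]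
        + (\<Sum>k\<in>UNIV. \<Sum>l\<in>UNIV. T b $ k * T e $ l * diff10 (h k l) (?\<phi> x) (T a))"
      unfolding complex_bilinear_form_expansion[OF \<theta> cd(2) xd, of "Q a b"]
        complex_bilinear_form_expansion[OF \<theta> cd(2) xd, of "T b"] h_def
      by (simp only: sum.distrib)
    also have "(\<Sum>k\<in>UNIV. \<Sum>l\<in>UNIV. T b $ k * T e $ l * diff10 (h k l) (?\<phi> x) (T a)) =
        diff10 (\<lambda>z. \<Sum>k\<in>UNIV. \<Sum>l\<in>UNIV. T b $ k * T e $ l * h k l z) (?\<phi> x) (T a)"
    proof -
      have "(\<lambda>z. \<Sum>l\<in>UNIV. T b $ k * T e $ l * h k l z) differentiable (at (?\<phi> x))" for k
        using h_df by (intro differentiable_sum) (auto intro!: differentiable_mult)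
      then show ?thesis
        using h_df by (simp add: diff_sum diff_cmult(1)[OF h_df] differentiable_mult)
    qed
    also have "\<dots> = diff10 (\<lambda>z. \<theta> d z [T b, T e]) (?\<phi> x) (T a)"
      by (rule diff_cong_open(1)[OF complex_atlasD(2)[OF A cd(2)] xd])
        (simp only: complex_bilinear_form_expansion[OF \<theta> cd(2), of _ "T b"] h_def)
    finally show ?thesis .
  qed
  have skew: "\<theta> d (?\<phi> x) [Q a e, T b] = - \<theta> d (?\<phi> x) [T b, Q a e]"
    by (rule complex_bilinear_formD(6)[OF \<theta> cd(2) xd])
  show ?thesis
    unfolding del_three[OF cd(1) xc] del_three[OF cd(2) xd] main Q_sym[of b a] Q_sym[of e a] Q_sym[of e b] skew
    by simp
qed

text \<open>This is \<open>delbar (del \<theta>) = - del (delbar \<theta>) = - del (del \<omega>) = 0\<close> in coordinates. Extracting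
  from \<open>delbar A \<theta> = del A \<omega>\<close> the part that is conjugate linear in \<open>w\<close> expresses the derivative of \<open>\<theta>\<close> in the direction \<open>w\<close>
  through the functions \<open>g\<close>, the conjugate linear part of \<open>\<omega>\<close> in its first argument; the resulting second
  derivatives of \<open>g\<close> cancel in pairs.\<close>

lemma del_holomorphic:
  assumes A: "complex_atlas A" and \<theta>: "complex_bilinear_form A \<theta>" and \<omega>: "\<omega> \<in> smooth_forms A"
    and eq: "delbar A \<theta> = del A \<omega>" and c: "c \<in> A" "x \<in> chart_image c"
  shows "diff01 (\<lambda>y. del A \<theta> c y [a, b, e]) x w = 0"
proof -
  note sm = complex_bilinear_formD(1)[OF \<theta>]
  note op = complex_atlasD(2)[OF A c(1)]
  define g where "g l y = (1 / 2) * (\<omega> c y [w, l] + \<i> * \<omega> c y [\<i> *s w, l])" for l y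
  have g_smooth: "smooth_on (chart_image c) (g l)" for l
    unfolding g_def[abs_def]
    by (intro smooth_on_cmult[OF op] smooth_on_add[OF op] smooth_formsD(3)[OF \<omega> c(1)])
  have \<theta>_smooth: "smooth_on (chart_image c) (\<lambda>y. \<theta> c y [k, l])" for k l
    by (rule smooth_formsD(3)[OF sm c(1)])
  have key: "diff01 (\<lambda>y. \<theta> c y [k, l]) y w = diff10 (g k) y l - diff10 (g l) y k"
    if y: "y \<in> chart_image c" for k l y
  proof -
    note df = smooth_forms_differentiable[OF sm c(1) y]
    note d\<omega> = smooth_forms_differentiable[OF \<omega> c(1) y]
    have i1: "diff01 (\<lambda>y. \<theta> c y [\<i> *s w, l]) y u = \<i> * diff01 (\<lambda>y. \<theta> c y [w, l]) y u" for l u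
      using diff_cong_open(2)[OF op y, of "\<lambda>y. \<theta> c y [\<i> *s w, l]" "\<lambda>y. \<i> * \<theta> c y [w, l]" u]
        complex_bilinear_formD(2)[OF \<theta> c(1)] by (simp add: diff_cmult(2)[OF df])
    have "delbar A \<theta> c y [w, k, l] + \<i> * delbar A \<theta> c y [\<i> *s w, k, l] = 2 * diff01 (\<lambda>y. \<theta> c y [k, l]) y w"
      unfolding del_three[OF c(1) y] i1 diff_vector_scale(2)[OF df] by (simp add: algebra_simps)
    moreover have gd: "diff10 (g l) y u = (1 / 2) * (diff10 (\<lambda>y. \<omega> c y [w, l]) y u + \<i> * diff10 (\<lambda>y. \<omega> c y [\<i> *s w, l]) y u)" for l u
    proof -
      have d2: "(\<lambda>y. \<i> * \<omega> c y [\<i> *s w, l]) differentiable (at y)"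
        using d\<omega> by (intro differentiable_mult) auto
      show ?thesis
        unfolding g_def[abs_def]
        using d2 d\<omega> by (subst diff_cmult(1)) (auto simp: diff_add(1)[OF d\<omega> d2] diff_cmult(1)[OF d\<omega>] intro: differentiable_add)
    qed
    have "del A \<omega> c y [w, k, l] + \<i> * del A \<omega> c y [\<i> *s w, k, l] = 2 * (diff10 (g k) y l - diff10 (g l) y k)"
      unfolding del_three[OF c(1) y] gd diff_vector_scale(1)[OF d\<omega>] by (simp add: algebra_simps)
    ultimately have "2 * diff01 (\<lambda>y. \<theta> c y [k, l]) y w = 2 * (diff10 (g k) y l - diff10 (g l) y k)"
      by (simp only: eq)
    then show ?thesis by (simp only: mult_cancel_left) simp
  qed
  have comm: "diff01 (\<lambda>y. diff10 (\<lambda>y. \<theta> c y [k, l]) y j) x w =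
      diff10 (\<lambda>y. diff10 (g k) y l) x j - diff10 (\<lambda>y. diff10 (g l) y k) x j" for k l j
  proof -
    have gg: "(\<lambda>y. diff10 (g k) y l) differentiable (at x)" for k l
      using smooth_on_differentiable[OF smooth_on_diff(1)[OF op g_smooth] c(2)] .
    have "diff01 (\<lambda>y. diff10 (\<lambda>y. \<theta> c y [k, l]) y j) x w = diff10 (\<lambda>y. diff01 (\<lambda>y. \<theta> c y [k, l]) y w) x j"
      by (rule diff_commute(2)[OF op \<theta>_smooth c(2)])
    also have "\<dots> = diff10 (\<lambda>y. diff10 (g k) y l + (- 1) * diff10 (g l) y k) x j"
      by (rule diff_cong_open(1)[OF op c(2)]) (simp add: key)
    also have "\<dots> = diff10 (\<lambda>y. diff10 (g k) y l) x j + (- 1) * diff10 (\<lambda>y. diff10 (g l) y k) x j"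
      unfolding diff_cmult(1)[OF gg, symmetric] by (rule diff_add(1)) (intro gg differentiable_mult differentiable_const)+
    finally show ?thesis by simp
  qed
  have dd: "(\<lambda>y. diff10 (\<lambda>y. \<theta> c y [k, l]) y j) differentiable (at x)" for k l j
    using smooth_on_differentiable[OF smooth_on_diff(1)[OF op \<theta>_smooth] c(2)] .
  have "diff01 (\<lambda>y. del A \<theta> c y [a, b, e]) x w =
      diff01 (\<lambda>y. diff10 (\<lambda>y. \<theta> c y [b, e]) y a + (- 1) * diff10 (\<lambda>y. \<theta> c y [a, e]) y b
         + diff10 (\<lambda>y. \<theta> c y [a, b]) y e) x w"
    by (rule diff_cong_open(2)[OF op c(2)]) (simp add: del_three[OF c(1)])
  also have "\<dots> = diff01 (\<lambda>y. diff10 (\<lambda>y. \<theta> c y [b, e]) y a) x w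
      + (- 1) * diff01 (\<lambda>y. diff10 (\<lambda>y. \<theta> c y [a, e]) y b) x w + diff01 (\<lambda>y. diff10 (\<lambda>y. \<theta> c y [a, b]) y e) x w"
    unfolding diff_cmult(2)[OF dd, symmetric]
    by (subst diff_add(2), (intro dd differentiable_mult differentiable_const differentiable_add)+)+ simp
  also have "\<dots> = 0"
    unfolding comm
    using diff_commute(1)[OF op g_smooth c(2), of b a e] diff_commute(1)[OF op g_smooth c(2), of e a b]
      diff_commute(1)[OF op g_smooth c(2), of a b e]
    by simp
  finally show ?thesis .
qed

section \<open>Stokes' theorem for exact holomorphic forms\<close>

lemma matrix_vector_mult_axis:
  fixes M :: "'a::semiring_1^'n::finite^'m"
  shows "M *v axis k 1 = (\<chi> i. M $ i $ k)"
  by (simp add: matrix_vector_mult_def axis_def vec_eq_iff if_distrib cong: if_cong)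

lemma complex_linear_matrix:
  fixes T :: "complex^'n::finite \<Rightarrow> complex^'m::finite"
  assumes "linear T" "\<And>a u. T (a *s u) = a *s T u"
  shows "T = (*v) (\<chi> i j. T (axis j 1) $ i)"
proof -
  have expansion: "T u $ i = (\<Sum>j\<in>UNIV. u $ j * T (axis j 1) $ i)" for u i
    by (rule complex_linear_expansion[of "\<lambda>u. T u $ i" "\<lambda>z. z"])
      (simp_all add: linear_add[OF assms(1)] assms(2))
  show ?thesis
  proof (intro ext vec_eq_iff[THEN iffD2] allI)
    show "T u $ i = ((\<chi> i j. T (axis j 1) $ i) *v u) $ i" for u i
      by (subst expansion) (simp add: matrix_vector_mult_def mult.commute)
  qed
qed

lemma nonneg_integral_zero:
  fixes f :: "'a::euclidean_space \<Rightarrow> real"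
  assumes "continuous_on UNIV f" "\<And>x. f x \<ge> 0" "integrable lborel f" "integral\<^sup>L lborel f = 0"
  shows "f x = 0"
proof -
  have "AE x in lborel. f x = 0"
    using assms integral_nonneg_eq_0_iff_AE[OF assms(3)] by simp
  then obtain N where N: "N \<in> null_sets lborel" "{x. f x \<noteq> 0} \<subseteq> N"
    by (auto elim!: AE_E simp: null_sets_def)
  have "N \<in> null_sets lebesgue"
    using N(1) by (rule null_sets_completionI)
  then have "negligible {x. f x \<noteq> 0}"
    using N(2) negligible_subset negligible_iff_null_sets by blast
  moreover have "open {x. f x \<noteq> 0}"
    using assms(1) by (intro open_Collect_neq) auto
  ultimately have "{x. f x \<noteq> 0} = {}"
    using open_not_negligible by blast
  then show ?thesis by auto
qed

lemma integral_diff10_compact_support: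
  fixes g :: "complex^'n::finite \<Rightarrow> complex"
  assumes "Ck_on 1 UNIV g" "compact K" "\<And>x. x \<notin> K \<Longrightarrow> g x = 0"
  shows "integrable lborel (\<lambda>x. diff10 g x u)" "integral\<^sup>L lborel (\<lambda>x. diff10 g x u) = 0"
  using integral_derivative_compact_support[OF assms, of u]
    integral_derivative_compact_support[OF assms, of "\<i> *s u"]
  unfolding diff10_def by simp_all

text \<open>The integrand is the \<open>diff10\<close>-derivative of \<open>s * v * cnj g\<close>, extended by zero: the last factor is
  constant for this derivative as \<open>g\<close> is holomorphic in the direction \<open>a\<close>.\<close>

lemma local_divergence:
  fixes s v g :: "complex^'n::finite \<Rightarrow> complex"
  assumes S: "open S" and K: "compact K" "K \<subseteq> S" and s: "Ck_on 1 S s" "\<And>x. x \<in> S - K \<Longrightarrow> s x = 0"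
    and v: "Ck_on 1 S v" and g: "Ck_on 1 S g" and hol: "\<And>x. x \<in> S \<Longrightarrow> diff01 g x a = 0"
  defines "h \<equiv> \<lambda>x. if x \<in> S then (diff10 s x a * v x + s x * diff10 v x a) * cnj (g x) else 0"
  shows "integrable lborel h" "integral\<^sup>L lborel h = 0"
proof -
  note mult = bounded_bilinear.Ck_on_prod[OF bounded_bilinear_mult S]
  define G where "G x = (if x \<in> S then s x * v x * cnj (g x) else 0)" for x
  have cg: "Ck_on 1 S (\<lambda>x. cnj (g x))"
    by (rule Ck_on_bounded_linear[OF bounded_linear_cnj S g])
  have G: "Ck_on 1 UNIV G"
    unfolding G_def[abs_def]
    by (rule Ck_on_zero_extension[OF S mult[OF mult[OF s(1) v] cg] K]) (simp add: s(2))
  have G0: "G x = 0" if "x \<notin> K" for x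
    using that s(2) by (auto simp: G_def)
  have df: "s differentiable (at x)" "v differentiable (at x)" "g differentiable (at x)" "(\<lambda>x. cnj (g x)) differentiable (at x)"
    if "x \<in> S" for x
    using that s(1) v g cg by auto
  have "diff10 G x a = h x" for x
  proof (cases "x \<in> S")
    case True
    have "diff10 G x a = diff10 (\<lambda>x. s x * v x * cnj (g x)) x a"
      by (rule diff_cong_open(1)[OF S True]) (simp add: G_def)
    also have "\<dots> = s x * v x * diff10 (\<lambda>x. cnj (g x)) x a + diff10 (\<lambda>x. s x * v x) x a * cnj (g x)"
      by (rule diff_mult(1)) (intro differentiable_mult df True)+
    also have "\<dots> = h x"
      using True hol[OF True] unfolding diff_cnj(2)[OF df(3)[OF True]] diff_mult(1)[OF df(1)[OF True] df(2)[OF True]]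
      by (simp add: h_def algebra_simps)
    finally show ?thesis .
  next
    case False
    have "diff10 G x a = diff10 (\<lambda>_. 0) x a"
      by (rule diff_cong_open(1)[OF open_Compl[OF compact_imp_closed[OF K(1)]]]) (use False K(2) G0 in auto)
    then show ?thesis using False by (simp add: diff_const h_def)
  qed
  then have "h = (\<lambda>x. diff10 G x a)" by auto
  then show "integrable lborel h" "integral\<^sup>L lborel h = 0"
    using integral_diff10_compact_support[OF G K(1) G0, of a] by simp_all
qed

text \<open>For a holomorphic form \<open>f = del \<theta>\<close> of top degree, the square of its modulus is a density on the manifold
  which is the divergence of \<open>\<theta> \<and> cnj f\<close>, so its integral is zero by Stokes' theorem and \<open>f\<close>
  vanishes.
  
  Instead of an integral over the manifold, only integrals in charts are used. Cut off by the
  member \<open>\<rho> p\<close> of a partition of unity, the density can be integrated by parts in the chart \<open>c p\<close>, which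
  leaves the integral of \<open>H p\<close>, the real part of \<open>\<partial>(\<rho> p) \<and> \<theta> \<and> cnj f\<close>. Inserting the partition once more and
  changing from the chart \<open>c p\<close> to the chart \<open>c q\<close> in the term with \<open>\<rho> p\<close> and \<open>\<rho> q\<close>, the sum over \<open>p\<close>
  can be carried out in a fixed chart, where it is zero because the \<open>\<rho> p\<close> add up to a constant.\<close>

lemma exact_holomorphic_3form_zero:
  fixes A :: "('a::t2_space, 'n::finite) chart set"
  assumes M: "compact_complex_manifold A" and n: "CARD('n) = 3"
    and \<theta>: "complex_bilinear_form A \<theta>"
    and hol: "\<And>c x a b e w. c \<in> A \<Longrightarrow> x \<in> chart_image c \<Longrightarrow> diff01 (\<lambda>y. del A \<theta> c y [a, b, e]) x w = 0"
    and cx: "c0 \<in> A" "x0 \<in> chart_image c0"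
  shows "del A \<theta> c0 x0 [a0, b0, e0] = 0"
proof -
  have A: "complex_atlas A" using M by (simp add: compact_complex_manifold_def)
  note sm = complex_bilinear_formD(1)[OF \<theta>]
  let ?\<psi> = "\<lambda>d. inv_into (fst d) (snd d)"
  note op = complex_atlasD(2)[OF A]
  obtain i1 i2 i3 :: 'n where U: "UNIV = {i1, i2, i3}" and dist: "i1 \<noteq> i2" "i1 \<noteq> i3" "i2 \<noteq> i3"
    using n by (auto simp: card_3_iff)
  define e1 e2 e3 :: "complex^'n" where "e1 = axis i1 1" and "e2 = axis i2 1" and "e3 = axis i3 1"
  note detF = alternating_trilinear_det[OF _ U dist, folded e1_def e2_def e3_def]
  obtain P :: "'a set" and c K and \<rho> :: "'a \<Rightarrow> 'a \<Rightarrow> real" where P: "finite P" and cA: "\<And>p. c p \<in> A"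
    and K: "\<And>p. compact (K p)" "\<And>p. K p \<subseteq> fst (c p)"
    and \<rho>0: "\<And>p q. q \<notin> K p \<Longrightarrow> \<rho> p q = 0" and \<rho>_nonneg: "\<And>p q. \<rho> p q \<ge> 0"
    and \<rho>1: "\<And>q. (\<Sum>p\<in>P. \<rho> p q) = 1"
    and \<rho>C1: "\<And>p d. d \<in> A \<Longrightarrow> Ck_on 1 (chart_image d) (\<lambda>x. \<rho> p (?\<psi> d x))"
    using C1_partition_of_unity[OF M] by blast
  define f where "f d x = del A \<theta> d x [e1, e2, e3]" for d :: "('a, 'n) chart" and x
  define r where "r p d x = complex_of_real (\<rho> p (?\<psi> d x))" for p and d :: "('a, 'n) chart" and x
  define E where "E p d x = diff10 (r p d) x e1 * \<theta> d x [e2, e3] - diff10 (r p d) x e2 * \<theta> d x [e1, e3]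
      + diff10 (r p d) x e3 * \<theta> d x [e1, e2]" for p and d :: "('a, 'n) chart" and x
  define H where "H p d x = Re (E p d x * cnj (f d x))" for p and d :: "('a, 'n) chart" and x
  define N where "N p d x = \<rho> p (?\<psi> d x) * (cmod (f d x))\<^sup>2" for p and d :: "('a, 'n) chart" and x
  define Z where "Z d h x = (if x \<in> chart_image d then h x else 0)" for d :: "('a, 'n) chart" and h :: "complex^'n \<Rightarrow> real" and x

  have \<theta>_smooth: "smooth_on (chart_image d) (\<lambda>y. \<theta> d y v)" if "d \<in> A" for d v
    by (rule smooth_formsD(3)[OF sm that])
  have f_eq: "f d y = diff10 (\<lambda>y. \<theta> d y [e2, e3]) y e1 + (- 1) * diff10 (\<lambda>y. \<theta> d y [e1, e3]) y e2
      + diff10 (\<lambda>y. \<theta> d y [e1, e2]) y e3" if "d \<in> A" "y \<in> chart_image d" for d y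
    by (simp add: f_def del_three(1)[OF that])
  have f_smooth: "smooth_on (chart_image d) (f d)" if d: "d \<in> A" for d
  proof -
    have "smooth_on (chart_image d) (\<lambda>y. diff10 (\<lambda>y. \<theta> d y [e2, e3]) y e1 + (- 1) * diff10 (\<lambda>y. \<theta> d y [e1, e3]) y e2
      + diff10 (\<lambda>y. \<theta> d y [e1, e2]) y e3)"
      by (rule smooth_on_add[OF op[OF d]] smooth_on_cmult[OF op[OF d]] smooth_on_diff(1)[OF op[OF d]] \<theta>_smooth[OF d])+
    then show ?thesis
      by (rule smooth_on_cong[OF op[OF d], THEN iffD1, rotated]) (simp add: f_eq[OF d])
  qed
  have rC1: "Ck_on 1 (chart_image d) (r p d)" if "d \<in> A" for p d
    unfolding r_def[abs_def] by (rule Ck_on_bounded_linear[OF bounded_linear_of_real op[OF that] \<rho>C1[OF that]])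
  have r_df: "r p d differentiable (at x)" if "d \<in> A" "x \<in> chart_image d" for p d x
    using rC1[OF that(1)] that(2) by simp
  have E_cont: "continuous_on (chart_image d) (E p d)" if d: "d \<in> A" for p d
  proof -
    have "continuous_on (chart_image d) (\<lambda>x. diff10 (r p d) x u)" for u
      using Ck_on_diff(1)[OF op[OF d], of 0 "r p d" u] rC1[OF d, of p] by simp
    then show ?thesis
      unfolding E_def[abs_def] using smooth_on_continuous[OF \<theta>_smooth[OF d]]
      by (intro continuous_intros)
  qed
  have f_cont: "continuous_on (chart_image d) (f d)" if "d \<in> A" for d
    by (rule smooth_on_continuous[OF f_smooth[OF that]])
  have \<rho>_cont: "continuous_on (chart_image d) (\<lambda>x. \<rho> p (?\<psi> d x))" if "d \<in> A" for p d
    using Ck_on_SucD[of 0 "chart_image d" "\<lambda>x. \<rho> p (?\<psi> d x)"] \<rho>C1[OF that] by simp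
  have H_cont: "continuous_on (chart_image d) (H p d)" and N_cont: "continuous_on (chart_image d) (N p d)"
    if d: "d \<in> A" for p d
    unfolding H_def[abs_def] N_def[abs_def]
    by (intro continuous_intros E_cont[OF d] f_cont[OF d] \<rho>_cont[OF d])+

  \<comment> \<open>In the chart \<open>c p\<close> everything with a factor \<open>\<rho> p\<close> or its derivative is supported in \<open>L p\<close>.\<close>
  define L where "L p = snd (c p) ` K p" for p
  have L: "compact (L p)" "L p \<subseteq> chart_image (c p)" for p
  proof -
    have "continuous_on (fst (c p)) (snd (c p))"
      using complex_atlasD(3)[OF A cA] by (simp add: homeomorphism_def)
    then show "compact (L p)"
      unfolding L_def using K by (intro compact_continuous_image) (auto intro: continuous_on_subset)
    show "L p \<subseteq> chart_image (c p)"
      using K by (auto simp: L_def chart_image_def)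
  qed
  have off: "?\<psi> (c p) x \<notin> K p" if "x \<in> chart_image (c p) - L p" for p x
    using that chart_inverse(3)[OF A cA, of x p] unfolding L_def by force
  have E0: "E p d x = 0" if d: "d \<in> A" and x: "x \<in> chart_image d" "?\<psi> d x \<notin> K p" for p d x
  proof -
    let ?V = "chart_image d \<inter> ?\<psi> d -` (- K p)"
    have "open (- K p)" using compact_imp_closed[OF K(1)] by (rule open_Compl)
    then have V: "open ?V"
      using complex_atlasD(3)[OF A d] op[OF d]
      by (intro continuous_open_preimage) (auto simp: homeomorphism_def)
    have "diff10 (r p d) x u = diff10 (\<lambda>_. 0) x u" for u
      by (rule diff_cong_open(1)[OF V]) (use x in \<open>auto simp: r_def \<rho>0\<close>)
    then show ?thesis by (simp add: E_def diff_const)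
  qed
  have Z_cont: "continuous_on UNIV (Z (c p) h)" and Z_int: "integrable lborel (Z (c p) h)"
    if "continuous_on (chart_image (c p)) h" "\<And>x. x \<in> chart_image (c p) \<Longrightarrow> ?\<psi> (c p) x \<notin> K p \<Longrightarrow> h x = 0"
    for p h
  proof -
    have h0: "h x = 0" if "x \<in> chart_image (c p) - L p" for x
      using that off[OF that] \<open>\<And>x. x \<in> chart_image (c p) \<Longrightarrow> ?\<psi> (c p) x \<notin> K p \<Longrightarrow> h x = 0\<close> by blast
    show cont: "continuous_on UNIV (Z (c p) h)"
      using Ck_on_zero_extension[OF op[OF cA], of 0 p h "L p"] that(1) L[of p] h0
      unfolding Z_def[abs_def] by simp
    show "integrable lborel (Z (c p) h)"
      by (rule integrable_continuous_compact_support[OF cont L(1)[of p]]) (use h0 in \<open>auto simp: Z_def\<close>)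
  qed

  \<comment> \<open>Both \<open>f\<close> and \<open>E p\<close> are coefficients of forms of type (3,0), so that \<open>H p\<close> is a density.\<close>
  have chg: "f d x = det M * f d' (transition d d' x)" "E p d x = det M * E p d' (transition d d' x)"
    "?\<psi> d x = ?\<psi> d' (transition d d' x)"
    if dd: "d \<in> A" "d' \<in> A" "x \<in> overlap d d'"
      and M: "frechet_derivative (transition d d') (at x) = (*v) M" for d d' x p and M :: "complex^'n^'n"
  proof -
    let ?\<phi> = "transition d d'" and ?T = "frechet_derivative (transition d d') (at x)"
    have xd: "x \<in> chart_image d" using overlap_subset dd(3) by blast
    have xd': "?\<phi> x \<in> chart_image d'" by (rule transition_in_chart_image[OF A dd(1,3)])
    have same: "?\<psi> d y = ?\<psi> d' (?\<phi> y)" if "y \<in> overlap d d'" for y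
      using overlapE[OF A dd(1) that] chart_inverse(1)[OF A dd(2)] by metis
    then show "?\<psi> d x = ?\<psi> d' (?\<phi> x)" using dd(3) by blast
    have "f d x = del A \<theta> d' (?\<phi> x) [M *v e1, M *v e2, M *v e3]"
      using del_natural[OF A \<theta> dd, of e1 e2 e3] by (simp add: f_def M)
    then show "f d x = det M * f d' (?\<phi> x)"
      using detF[OF alternating_trilinear_del[OF A \<theta> dd(2) xd'], of M] by (simp add: f_def)
    have \<theta>': "\<theta> d x [u, w] = \<theta> d' (?\<phi> x) [?T u, ?T w]" for u w
      using smooth_formsD(4)[OF sm dd, of "[u, w]"] by simp
    have r': "diff10 (r p d) x u = diff10 (r p d') (?\<phi> x) (?T u)" for u
    proof -
      have "diff10 (r p d) x u = diff10 (\<lambda>y. r p d' (?\<phi> y)) x u"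
        by (rule diff_cong_open(1)[OF open_overlap[OF A dd(1,2)] dd(3)]) (simp add: r_def same)
      moreover have "((\<lambda>y. r p d' (?\<phi> y)) has_derivative (\<lambda>u. frechet_derivative (r p d') (at (?\<phi> x)) (?T u))) (at x)"
        by (rule has_derivative_compose[OF transition_derivative(1)[OF A dd] r_df[OF dd(2) xd', unfolded frechet_derivative_works]])
      ultimately show ?thesis
        by (simp add: diff10_def frechet_derivative_eqI transition_derivative(3)[OF A dd])
    qed
    have "alternating_trilinear (\<lambda>a b e. diff10 (r p d') (?\<phi> x) a * \<theta> d' (?\<phi> x) [b, e]
        - diff10 (r p d') (?\<phi> x) b * \<theta> d' (?\<phi> x) [a, e] + diff10 (r p d') (?\<phi> x) e * \<theta> d' (?\<phi> x) [a, b])"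
      by (rule alternating_trilinear_wedge[OF \<theta> dd(2) xd'])
        (simp_all add: diff_vector_add(1) diff_vector_scale(1) r_df[OF dd(2) xd'])
    from detF[OF this, of M] show "E p d x = det M * E p d' (?\<phi> x)"
      unfolding E_def \<theta>' r' M .
  qed

  have parts: "integral\<^sup>L lborel (Z (c p) (N p (c p))) = - integral\<^sup>L lborel (Z (c p) (H p (c p)))" for p
  proof -
    let ?d = "c p" and ?S = "chart_image (c p)"
    note d = cA[of p]
    let ?h = "\<lambda>v a x. if x \<in> ?S then (diff10 (r p ?d) x a * \<theta> ?d x v + r p ?d x * diff10 (\<lambda>y. \<theta> ?d y v) x a) * cnj (f ?d x) else 0"
    have h: "integrable lborel (?h v a)" "integral\<^sup>L lborel (?h v a) = 0" for v a
    proof -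
      have zero: "r p ?d x = 0" if "x \<in> ?S - L p" for x
        using off[OF that] by (simp add: r_def \<rho>0)
      have "diff01 (f ?d) x a = 0" if "x \<in> ?S" for x
        unfolding f_def[abs_def] by (rule hol[OF d that])
      note div = local_divergence[OF op[OF d] L rC1[OF d] zero smooth_onD[OF \<theta>_smooth[OF d]]
          smooth_onD[OF f_smooth[OF d]] this, of v]
      show "integrable lborel (?h v a)" by (rule div(1))
      show "integral\<^sup>L lborel (?h v a) = 0" by (rule div(2))
    qed
    have sum: "?h [e2, e3] e1 x - ?h [e1, e3] e2 x + ?h [e1, e2] e3 x =
       (if x \<in> ?S then E p ?d x * cnj (f ?d x) + r p ?d x * (f ?d x * cnj (f ?d x)) else 0)" for x
      by (simp add: E_def f_eq[OF d] algebra_simps)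
    have "Z ?d (H p ?d) x + Z ?d (N p ?d) x = Re (?h [e2, e3] e1 x - ?h [e1, e3] e2 x + ?h [e1, e2] e3 x)" for x
      unfolding sum by (simp add: Z_def H_def N_def r_def complex_norm_square[symmetric] del: of_real_power)
    then have "(\<lambda>x. Z ?d (H p ?d) x + Z ?d (N p ?d) x) = (\<lambda>x. Re (?h [e2, e3] e1 x - ?h [e1, e3] e2 x + ?h [e1, e2] e3 x))"
      by (rule ext)
    then have "integral\<^sup>L lborel (\<lambda>x. Z ?d (H p ?d) x + Z ?d (N p ?d) x) =
        Re (integral\<^sup>L lborel (\<lambda>x. ?h [e2, e3] e1 x - ?h [e1, e3] e2 x + ?h [e1, e2] e3 x))"
      using h(1) by (simp only: integral_Re Bochner_Integration.integrable_add Bochner_Integration.integrable_diff)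
    also have "\<dots> = 0"
      using h by (simp only: Bochner_Integration.integral_add Bochner_Integration.integral_diff
          Bochner_Integration.integrable_diff) simp
    finally have "integral\<^sup>L lborel (\<lambda>x. Z ?d (H p ?d) x + Z ?d (N p ?d) x) = 0" .
    moreover have "integrable lborel (Z ?d (H p ?d))"
      by (rule Z_int[OF H_cont[OF d]]) (simp add: H_def E0[OF d])
    moreover have "integrable lborel (Z ?d (N p ?d))"
      by (rule Z_int[OF N_cont[OF d]]) (simp add: N_def \<rho>0)
    ultimately show ?thesis by simp
  qed

  \<comment> \<open>Six real coordinates, needed for the change of variables.\<close>
  obtain \<epsilon> :: "6 \<Rightarrow> 'n \<times> bool" where \<epsilon>: "bij \<epsilon>"
  proof -
    have "card (UNIV :: 6 set) = card (UNIV :: ('n \<times> bool) set)"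
      using n by (simp add: card_cartesian_product flip: UNIV_Times_UNIV)
    then show thesis
      using finite_same_card_bij[of "UNIV :: 6 set" "UNIV :: ('n \<times> bool) set"] that by auto
  qed
  \<comment> \<open>The density with both cut-offs is supported in the intersection of the charts \<open>c p\<close> and \<open>c q\<close>.\<close>
  define X where "X p q d x = \<rho> q (?\<psi> d x) * H p d x" for p q and d :: "('a, 'n) chart" and x
  have X_cont: "continuous_on (chart_image d) (X p q d)" if "d \<in> A" for p q d
    unfolding X_def[abs_def] by (intro continuous_intros \<rho>_cont[OF that] H_cont[OF that])
  have X0: "X p q d x = 0" if "d \<in> A" "x \<in> chart_image d" "?\<psi> d x \<notin> K p \<inter> K q" for p q d x
    using that E0[OF that(1,2)] by (auto simp: X_def \<rho>0 H_def)
  have X_int: "integrable lborel (Z (c p) (X p q (c p)))" "integrable lborel (Z (c q) (X p q (c q)))" for p q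
    by (rule Z_int[OF X_cont[OF cA]]; use X0[OF cA] in blast)+
  have transport: "integral\<^sup>L lborel (Z (c p) (X p q (c p))) = integral\<^sup>L lborel (Z (c q) (X p q (c q)))" for p q
  proof (rule holomorphic_change_of_variables[OF \<epsilon> open_overlap[OF A cA cA, of p q], where \<phi> = "transition (c p) (c q)"])
    let ?\<phi> = "transition (c p) (c q)" and ?W = "overlap (c p) (c q)"
    let ?M = "\<lambda>x. \<chi> i j. frechet_derivative ?\<phi> (at x) (axis j 1) $ i"
    note tr = transition_derivative[OF A cA cA, of _ p q]
    have M: "frechet_derivative ?\<phi> (at x) = (*v) (?M x)" if "x \<in> ?W" for x
      by (rule complex_linear_matrix) (rule tr(2,3)[OF that])+
    show "inj_on ?\<phi> ?W"
    proof (rule inj_onI)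
      fix x y assume xy: "x \<in> ?W" "y \<in> ?W" "?\<phi> x = ?\<phi> y"
      then have "?\<psi> (c p) x = ?\<psi> (c p) y"
        using overlapE[OF A cA xy(1)] overlapE[OF A cA xy(2)] chart_inverse(1)[OF A cA[of q]] by metis
      then show "x = y"
        using xy overlap_subset chart_inverse(3)[OF A cA[of p]] by (metis subsetD)
    qed
    show "(?\<phi> has_derivative (*v) (?M x)) (at x)" if "x \<in> ?W" for x
      by (rule subst[where P = "\<lambda>D. (?\<phi> has_derivative D) (at x)", OF M[OF that] tr(1)[OF that]])
    show "integrable lborel (Z (c p) (X p q (c p)))" "integrable lborel (Z (c q) (X p q (c q)))"
      by (rule X_int)+
    show "Z (c q) (X p q (c q)) y = 0" if "y \<notin> ?\<phi> ` ?W" for y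
    proof (cases "y \<in> chart_image (c q)")
      case True
      have "?\<psi> (c q) y \<notin> K p"
      proof
        assume Kp: "?\<psi> (c q) y \<in> K p"
        let ?s = "?\<psi> (c q) y"
        have s: "?s \<in> fst (c q)" "?s \<in> fst (c p)" "snd (c q) ?s = y"
          using Kp K(2) chart_inverse(2,3)[OF A cA True] by auto
        then have "snd (c p) ?s \<in> ?W" by (auto simp: overlap_def)
        moreover have "?\<phi> (snd (c p) ?s) = y"
          using s chart_inverse(1)[OF A cA s(2)] by (simp add: transition_def)
        ultimately show False using that by (metis imageI)
      qed
      then show ?thesis using X0[OF cA True] True by (simp add: Z_def)
    qed (simp add: Z_def)
    show "Z (c p) (X p q (c p)) x = 0" if "x \<notin> ?W" for x
    proof (cases "x \<in> chart_image (c p)")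
      case True
      have "?\<psi> (c p) x \<notin> K q"
      proof
        assume Kq: "?\<psi> (c p) x \<in> K q"
        have s: "?\<psi> (c p) x \<in> fst (c p)" "?\<psi> (c p) x \<in> fst (c q)" "snd (c p) (?\<psi> (c p) x) = x"
          using Kq K(2) chart_inverse(2,3)[OF A cA True] by auto
        have "snd (c p) (?\<psi> (c p) x) \<in> ?W" by (rule overlapI[OF s(1,2)])
        then show False using that s(3) by simp
      qed
      then show ?thesis using X0[OF cA True] True by (simp add: Z_def)
    qed (simp add: Z_def)
    show "Z (c p) (X p q (c p)) x = (cmod (det (?M x)))\<^sup>2 * Z (c q) (X p q (c q)) (?\<phi> x)" if "x \<in> ?W" for x
    proof -
      note C = chg[OF cA cA that M[OF that]]
      have in_c: "x \<in> chart_image (c p)" "?\<phi> x \<in> chart_image (c q)"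
        using that overlap_subset transition_in_chart_image[OF A cA that] by blast+
      have "H p (c p) x = (cmod (det (?M x)))\<^sup>2 * H p (c q) (?\<phi> x)"
      proof -
        have "E p (c p) x * cnj (f (c p) x) =
            complex_of_real ((cmod (det (?M x)))\<^sup>2) * (E p (c q) (?\<phi> x) * cnj (f (c q) (?\<phi> x)))"
          unfolding C(1) C(2)[of p] complex_norm_square by (simp add: mult_ac)
        moreover have "Re (complex_of_real t * z) = t * Re z" for t z by simp
        ultimately show ?thesis
          unfolding H_def by (simp only:)
      qed
      then show ?thesis
        using in_c by (simp add: Z_def X_def C(3))
    qed
  qed

  have E_sum: "(\<Sum>p\<in>P. E p d x) = 0" if d: "d \<in> A" "x \<in> chart_image d" for d x
  proof -
    have "(\<Sum>p\<in>P. diff10 (r p d) x u) = 0" for u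
    proof -
      have "(\<Sum>p\<in>P. diff10 (r p d) x u) = diff10 (\<lambda>y. \<Sum>p\<in>P. r p d y) x u"
        by (rule diff_sum[symmetric]) (rule r_df[OF d])
      also have "(\<lambda>y. \<Sum>p\<in>P. r p d y) = (\<lambda>y. 1)"
        unfolding r_def of_real_sum[symmetric] \<rho>1 by simp
      finally show ?thesis by (simp add: diff_const)
    qed
    then show ?thesis
      by (simp add: E_def sum.distrib sum_subtractf sum_distrib_right[symmetric])
  qed
  have split: "integral\<^sup>L lborel (Z (c p) (H p (c p))) = (\<Sum>q\<in>P. integral\<^sup>L lborel (Z (c p) (X p q (c p))))" for p
  proof -
    have "Z (c p) (H p (c p)) = (\<lambda>x. \<Sum>q\<in>P. Z (c p) (X p q (c p)) x)"
      by (auto simp: fun_eq_iff Z_def X_def sum_distrib_right[symmetric] \<rho>1)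
    then show ?thesis
      by (simp add: Bochner_Integration.integral_sum X_int(1))
  qed
  have cancel: "(\<Sum>p\<in>P. integral\<^sup>L lborel (Z (c q) (X p q (c q)))) = 0" for q
  proof -
    have "(\<Sum>p\<in>P. Z (c q) (X p q (c q)) x) = 0" for x
    proof (cases "x \<in> chart_image (c q)")
      case True
      have "(\<Sum>p\<in>P. H p (c q) x) = Re ((\<Sum>p\<in>P. E p (c q) x) * cnj (f (c q) x))"
        by (simp add: H_def sum_distrib_right)
      then show ?thesis
        using True E_sum[OF cA True] by (simp add: Z_def X_def sum_distrib_left[symmetric])
    qed (simp add: Z_def)
    then show ?thesis
      using Bochner_Integration.integral_sum[of P lborel "\<lambda>p. Z (c q) (X p q (c q))"] X_int(2)
      by simp
  qed
  have "(\<Sum>p\<in>P. integral\<^sup>L lborel (Z (c p) (N p (c p)))) = - (\<Sum>p\<in>P. \<Sum>q\<in>P. integral\<^sup>L lborel (Z (c q) (X p q (c q))))"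
    unfolding parts split sum_negf by (intro arg_cong[where f = uminus] sum.cong refl transport)
  also have "\<dots> = - (\<Sum>q\<in>P. \<Sum>p\<in>P. integral\<^sup>L lborel (Z (c q) (X p q (c q))))"
    by (subst sum.swap) simp
  also have "\<dots> = 0"
    by (simp add: cancel)
  finally have total: "(\<Sum>p\<in>P. integral\<^sup>L lborel (Z (c p) (N p (c p)))) = 0" .
  have N_nonneg: "Z d (N p d) x \<ge> 0" for p d x
    by (simp add: Z_def N_def \<rho>_nonneg)
  have N_zero: "N p (c p) x = 0" if p: "p \<in> P" and x: "x \<in> chart_image (c p)" for p x
  proof -
    have N0: "x \<in> chart_image (c p) \<Longrightarrow> ?\<psi> (c p) x \<notin> K p \<Longrightarrow> N p (c p) x = 0" for x
      by (simp add: N_def \<rho>0)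
    have "integral\<^sup>L lborel (Z (c p) (N p (c p))) = 0"
      using total p P N_nonneg by (subst (asm) sum_nonneg_eq_0_iff) (auto intro: Bochner_Integration.integral_nonneg)
    then have "Z (c p) (N p (c p)) x = 0"
      using nonneg_integral_zero[OF Z_cont[OF N_cont[OF cA] N0] N_nonneg Z_int[OF N_cont[OF cA] N0]] by blast
    then show ?thesis using x by (simp add: Z_def)
  qed
  have f_zero: "f d x = 0" if d: "d \<in> A" "x \<in> chart_image d" for d x
  proof -
    let ?s = "?\<psi> d x"
    obtain p where p: "p \<in> P" "\<rho> p ?s \<noteq> 0"
      using \<rho>1[of ?s] by (metis sum.neutral zero_neq_one)
    have s: "?s \<in> fst d" "snd d ?s = x" "?s \<in> fst (c p)"
      using chart_inverse(2,3)[OF A d] p(2) \<rho>0 K(2) by blast+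
    have "snd d ?s \<in> overlap d (c p)" by (rule overlapI[OF s(1,3)])
    then have W: "x \<in> overlap d (c p)" using s(2) by simp
    let ?y = "transition d (c p) x"
    have y: "?y \<in> chart_image (c p)" by (rule transition_in_chart_image[OF A d(1) W])
    let ?T = "frechet_derivative (transition d (c p)) (at x)"
    have T: "?T = (*v) (\<chi> i j. ?T (axis j 1) $ i)"
      by (rule complex_linear_matrix) (rule transition_derivative(2,3)[OF A d(1) cA W])+
    note C = chg[OF d(1) cA W T]
    have "f (c p) ?y = 0"
      using N_zero[OF p(1) y] p(2) C(3) by (simp add: N_def)
    then show ?thesis using C(1) by simp
  qed
  \<comment> \<open>Arbitrary arguments are the images of the basis under the matrix with these columns.\<close>
  define M0 :: "complex^'n^'n" where
    "M0 = (\<chi> i j. if j = i1 then a0 $ i else if j = i2 then b0 $ i else e0 $ i)"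
  have "M0 *v e1 = a0" "M0 *v e2 = b0" "M0 *v e3 = e0"
    using dist by (simp_all add: M0_def e1_def e2_def e3_def vec_eq_iff matrix_vector_mult_axis)
  then show ?thesis
    using detF[OF alternating_trilinear_del[OF A \<theta> cx], of M0] f_zero[OF cx] by (simp add: f_def)
qed

section \<open>Dimension three\<close>

text \<open>One equation of the tower is missing compared with \<open>hermitian_symplectic_iff_E3_closed\<close>. It
  is supplied by \<open>exact_holomorphic_3form_zero\<close>: in dimension three, \<open>del A (part20 \<eta>)\<close> is a holomorphic
  form of top degree which is \<open>del\<close>-exact.\<close>

lemma hermitian_symplectic_iff_E2_closed:
  fixes A :: "('a::t2_space, 'n::finite) chart set"
  assumes M: "compact_complex_manifold A" and \<omega>: "hermitian_metric A \<omega>" and n: "CARD('n) = 3"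
  shows "hermitian_symplectic A \<omega> \<longleftrightarrow> \<omega> \<in> Er_closed A 2 1 1"
proof
  have A: "complex_atlas A" using M by (simp add: compact_complex_manifold_def)
  show "\<omega> \<in> Er_closed A 2 1 1" if "hermitian_symplectic A \<omega>"
    using hermitian_symplectic_imp_E3_closed[OF A \<omega> that] Er_closed_mono[of 2 3 A 1 1] by auto
  assume "\<omega> \<in> Er_closed A 2 1 1"
  then obtain \<eta> where \<eta>: "\<eta> 0 = \<omega>" "\<And>l. l < 2 \<Longrightarrow> \<eta> l \<in> smooth_forms A"
    "\<And>l. l < 2 - 1 \<Longrightarrow> del A (\<eta> l) = delbar A (\<eta> (Suc l))"
    unfolding Er_closed_def by blast
  have sm: "\<eta> 1 \<in> smooth_forms A" and eq: "del A \<omega> = delbar A (\<eta> 1)"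
    using \<eta>(2)[of 1] \<eta>(3)[of 0] \<eta>(1) by simp_all
  have pq: "\<omega> \<in> pq_forms A 1 1" and sm\<omega>: "\<omega> \<in> smooth_forms A"
    using \<omega> by (auto simp: hermitian_metric_def pq_forms_def)
  let ?\<theta> = "part20 (\<eta> 1)"
  have \<theta>: "complex_bilinear_form A ?\<theta>"
    unfolding complex_bilinear_form_def
    using smooth_forms_part20[OF A sm] part20_complex_bilinear(1) smooth_formsD(2)[OF sm] by blast
  have hol: "diff01 (\<lambda>y. del A ?\<theta> c y [a, b, e]) x w = 0" if "c \<in> A" "x \<in> chart_image c" for c x a b e w
    by (rule del_holomorphic[OF A \<theta> sm\<omega> delbar_part20[OF A sm pq eq] that])
  have "del A ?\<theta> c x v = 0" for c x v
  proof -
    consider "c \<notin> A \<or> x \<notin> chart_image c" | "length v \<noteq> Suc 2" | "c \<in> A" "x \<in> chart_image c" "length v = Suc 2"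
      by blast
    then show ?thesis
    proof cases
      case 2
      show ?thesis by (rule del_degree(1)[OF _ 2]) (simp add: part20_def)
    next
      case 3
      then obtain a b e where v: "v = [a, b, e]"
        by (auto simp: length_Suc_conv numeral_2_eq_2)
      show ?thesis
        unfolding v by (rule exact_holomorphic_3form_zero[OF M n \<theta> hol 3(1,2)])
    qed (simp add: del_outside)
  qed
  then have "del A ?\<theta> = 0" by (simp add: fun_eq_iff)
  then show "hermitian_symplectic A \<omega>"
    by (rule hermitian_symplecticI[OF A \<omega> sm eq])
qed

section \<open>The characterisations\<close>

lemma aeppli_class_in:
  "\<alpha> \<in> Er_closed A r p q \<Longrightarrow> aeppli_class A r p q \<alpha> \<in> Er_aeppli A r p q"
  unfolding aeppli_class_def Er_aeppli_def by (rule quotientI)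

theorem proposition6p2:
  fixes A :: "('a::t2_space, 'n::finite) chart set" and \<omega> :: "('a, 'n) form"
  assumes "compact_complex_manifold A" and "hermitian_metric A \<omega>"
  defines "n \<equiv> CARD('n)"
  shows
    "(strongly_Gauduchon A \<omega> \<longleftrightarrow> wedge_power A \<omega> (n - 1) \<in> Er_closed A 2 (n - 1) (n - 1)) \<and>
     (strongly_Gauduchon A \<omega> \<longrightarrow>
        aeppli_class A 2 (n - 1) (n - 1) (wedge_power A \<omega> (n - 1)) \<in> Er_aeppli A 2 (n - 1) (n - 1)) \<and>
     (hermitian_symplectic A \<omega> \<longleftrightarrow> \<omega> \<in> Er_closed A 3 1 1) \<and>
     (hermitian_symplectic A \<omega> \<longrightarrow> aeppli_class A 3 1 1 \<omega> \<in> Er_aeppli A 3 1 1) \<and>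
     (n = 3 \<longrightarrow>
        (hermitian_symplectic A \<omega> \<longleftrightarrow> \<omega> \<in> Er_closed A 2 1 1) \<and>
        (hermitian_symplectic A \<omega> \<longrightarrow> aeppli_class A 2 1 1 \<omega> \<in> Er_aeppli A 2 1 1))"
proof -
  have A: "complex_atlas A"
    using assms(1) by (simp add: compact_complex_manifold_def)
  have "strongly_Gauduchon A \<omega> \<longleftrightarrow> wedge_power A \<omega> (n - 1) \<in> Er_closed A 2 (n - 1) (n - 1)"
    unfolding n_def by (rule strongly_Gauduchon_iff[OF A assms(2)])
  moreover have "hermitian_symplectic A \<omega> \<longleftrightarrow> \<omega> \<in> Er_closed A 3 1 1"
    by (rule hermitian_symplectic_iff_E3_closed[OF A assms(2)])
  moreover have "hermitian_symplectic A \<omega> \<longleftrightarrow> \<omega> \<in> Er_closed A 2 1 1" if "n = 3"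
    using that unfolding n_def by (rule hermitian_symplectic_iff_E2_closed[OF assms(1,2)])
  ultimately show ?thesis
    using aeppli_class_in by blast
qed

end
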